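(* Let $k$ be a field, let $d\ge 1$, and let $H$ be a cointerval $d$-graph with finite vertex set $V(H)\subseteq\mathbb{Z}$. Then the labeled polyhedral complex $X_H$ supports a minimal cellular resolution of the edge ideal $I_H\subseteq S=k[x_v: v\in V(H)]$. In particular, for $i\ge 0$ and $\alpha\subseteq V(H)$, the finely graded Betti numbers satisfy $\beta_{i,\alpha}(I_H)=0$ if $i\ne|\alpha|-d$, and $$\beta_{|\alpha|-d,\alpha}(I_H)=\bigl|\{\sigma\in X_{H[\alpha]} \mid \dim\sigma=|\alpha|-d\}\bigr|.$$ In other words, $\beta_{i,\alpha}(I_H)$ is the number of faces of dimension $i$ in $X_H$ with monomial label $\prod_{v\in\alpha}x_v$.
   Context: A $d$-graph $H$ is a finite vertex set $V(H)\subseteq\mathbb{Z}$ with a set $E(H)$ of $d$-element subsets of $V(H)$, called edges. For $W\subseteq V(H)$, the induced subgraph $H[W]$ has vertex set $W$ and edges $\{e\in E(H): e\subseteq W\}$. For $v\in V(H)$, the $v$-layer of $H$ is the $(d-1)$-graph on $V(H)\setminus\{v\}$ with edge set $\{\{v_1,\dots,v_{d-1}\}: \{v,v_1,\dots,v_{d-1}\}\in E(H),\ v<v_1,\dots,v_{d-1}\}$. Cointerval $d$-graphs are defined recursively: every $1$-graph is cointerval; for $d>1$, $H$ is cointerval if (1) for every $i\in V(H)$ the $i$-layer of $H$ is cointerval, and (2) for all vertices $i<j$, the $j$-layer of $H$ is a subgraph of the $i$-layer, meaning every edge of the $j$-layer is an edge of the $i$-layer. Edge ideal: $I_H=\langle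 \prod_{v\in e}x_v : e\in E(H)\rangle\subseteq S$. The complex $X_H$: let $V=V(H)$ and let $\Delta_V$ be the simplex with vertex set $V$. For $\sigma,\tau\subseteq V$ write $\sigma<\tau$ if $s<t$ for all $s\in\sigma,t\in\tau$. $X_H$ is the subcomplex of the $d$-fold product $\Delta_V\times\cdots\times\Delta_V$ consisting of all cells $\sigma_1\times\cdots\times\sigma_d$ with $\emptyset\neq\sigma_i\subseteq V$, $\sigma_1<\sigma_2<\cdots<\sigma_d$, and such that $\{v_1,\dots,v_d\}\in E(H)$ whenever $v_i\in\sigma_i$ for all $i$. Its dimension is $\sum_i(|\sigma_i|-1)$. The cell $\sigma_1\times\cdots\times\sigma_d$ is labeled by the monomial $\prod_{i=1}^d\prod_{v\in\sigma_i}x_v$, which is the lcm of the labels of its vertices. Cellular resolutions: for an oriented polyhedral complex $X$ whose vertices carry monomial labels and each of whose faces $F$ carries the lcm $\ell(F)$ of its vertex labels, $\mathcal{F}_X$ is the complex of free $S$-modules having one generator $e_F$ of multidegree $\ell(F)$ in homological degree $\dim F$ for each nonempty face $F$, with $\partial e_F=\sum_{G}\pm\frac{\ell(F)}{\ell(G)}e_G$, the sum being over facets $G$ of $F$, with signs from the cellular boundary map. $X$ supports a cellular resolution of a monomial ideal $I$ if $\mathcal{F}_X$ together with the augmentation $e_v\mapsto \ell(v)$ is a free resolution of $I$; it is minimal if this free resolution is minimal. $\beta_{i,\alpha}(I_H)$ denotes the number of copies of $S[-\alpha]$ in homological degree $i$ of a minimal $\mathbb{Z}^{V(H)}$-graded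 free resolution of $I_H$, where homological degree $0$ corresponds to the generators of $I_H$; a subset $\alpha\subseteq V(H)$ is identified with its $0/1$ indicator vector. Betti numbers and face counts in negative degree are $0$. *)

theory Defs
  imports
    "HOL-Library.Poly_Mapping"
    "HOL-Library.Indicator_Function"
    "HOL-Algebra.Ideal"
    "HOL-Algebra.Module"
begin

section \<open>Hypergraphs\<close>

record hgraph =
  verts :: "int set"
  edges :: "int set set"

definition d_graph :: "nat \<Rightarrow> hgraph \<Rightarrow> bool" where
  "d_graph d H \<longleftrightarrow> finite (verts H) \<and> (\<forall>e\<in>edges H. e \<subseteq> verts H \<and> card e = d)"

definition induced :: "hgraph \<Rightarrow> int set \<Rightarrow> hgraph" where
  "induced H W = \<lparr>verts = W, edges = {e \<in> edges H. e \<subseteq> W}\<rparr>"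

definition layer :: "int \<Rightarrow> hgraph \<Rightarrow> hgraph" where
  "layer v H = \<lparr>verts = verts H - {v},
                edges = {f. insert v f \<in> edges H \<and> (\<forall>w\<in>f. v < w)}\<rparr>"

text \<open>Cointerval graphs are only considered for \<open>d \<ge> 1\<close>; the value at \<open>0\<close> is a convention.\<close>

fun cointerval :: "nat \<Rightarrow> hgraph \<Rightarrow> bool" where
  "cointerval 0 H \<longleftrightarrow> False"
| "cointerval (Suc 0) H \<longleftrightarrow> True"
| "cointerval (Suc (Suc n)) H \<longleftrightarrow>
     (\<forall>i\<in>verts H. cointerval (Suc n) (layer i H)) \<and>
     (\<forall>i\<in>verts H. \<forall>j\<in>verts H. i < j \<longrightarrow> edges (layer j H) \<subseteq> edges (layer i H))"


section \<open>The polynomial ring and the edge ideal\<close>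

type_synonym expo = "int \<Rightarrow>\<^sub>0 nat"
type_synonym 'k mpoly = "expo \<Rightarrow>\<^sub>0 'k"

text \<open>The ring \<open>k[x\<^sub>v : v \<in> V]\<close>, inside the polynomials with variables indexed by all integers.\<close>

definition poly_ring :: "int set \<Rightarrow> 'k::field mpoly ring" where
  "poly_ring V =
     \<lparr>carrier = {p. \<forall>m\<in>Poly_Mapping.keys p. Poly_Mapping.keys m \<subseteq> V},
      mult = (*), one = 1, zero = 0, add = (+)\<rparr>"

definition var :: "int \<Rightarrow> 'k::field mpoly" where
  "var v = Poly_Mapping.single (Poly_Mapping.single v 1) 1"

definition edge_ideal :: "hgraph \<Rightarrow> 'k::field mpoly set" where
  "edge_ideal H = genideal (poly_ring (verts H)) {\<Prod>v\<in>e. var v | e. e \<in> edges H}"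

definition irrelevant_ideal :: "int set \<Rightarrow> 'k::field mpoly set" where
  "irrelevant_ideal V = genideal (poly_ring V) (var ` V)"

definition squarefree_expo :: "int set \<Rightarrow> expo" where
  "squarefree_expo A = (\<Sum>v\<in>A. Poly_Mapping.single v 1)"

text \<open>Elements of \<open>\<int>\<^bsup>V\<^esup>\<close> are functions \<open>int \<Rightarrow> int\<close> vanishing outside \<open>V\<close>.\<close>

definition homogeneous :: "(int \<Rightarrow> int) \<Rightarrow> 'k::field mpoly \<Rightarrow> bool" where
  "homogeneous \<gamma> p \<longleftrightarrow>
     (\<forall>m\<in>Poly_Mapping.keys p. \<forall>v. int (Poly_Mapping.lookup m v) = \<gamma> v)"


section \<open>Modules and free resolutions\<close>

text \<open>The multiplication and unit components of a module record carry no meaning.\<close>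

definition free_module :: "('a, 'm) ring_scheme \<Rightarrow> 'b set \<Rightarrow> ('a, 'b \<Rightarrow> 'a) module" where
  "free_module R B =
     \<lparr>carrier = {x. (\<forall>b\<in>B. x b \<in> carrier R) \<and> (\<forall>b. b \<notin> B \<longrightarrow> x b = \<zero>\<^bsub>R\<^esub>) \<and>
                    finite {b. x b \<noteq> \<zero>\<^bsub>R\<^esub>}},
      mult = undefined, one = undefined,
      zero = (\<lambda>b. \<zero>\<^bsub>R\<^esub>), add = (\<lambda>x y b. x b \<oplus>\<^bsub>R\<^esub> y b),
      smult = (\<lambda>a x b. a \<otimes>\<^bsub>R\<^esub> x b)\<rparr>"

definition ideal_module :: "('a, 'm) ring_scheme \<Rightarrow> 'a set \<Rightarrow> ('a, 'a) module" where
  "ideal_module R I =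
     \<lparr>carrier = I, mult = undefined, one = undefined,
      zero = \<zero>\<^bsub>R\<^esub>, add = (\<lambda>x y. x \<oplus>\<^bsub>R\<^esub> y), smult = (\<lambda>a x. a \<otimes>\<^bsub>R\<^esub> x)\<rparr>"

definition linear_maps ::
  "('a, 'm) ring_scheme \<Rightarrow> ('a, 'b, 'p) module_scheme \<Rightarrow> ('a, 'c, 'q) module_scheme \<Rightarrow> ('b \<Rightarrow> 'c) set"
where
  "linear_maps R M N =
     {h \<in> carrier M \<rightarrow> carrier N.
        (\<forall>x\<in>carrier M. \<forall>y\<in>carrier M. h (x \<oplus>\<^bsub>M\<^esub> y) = h x \<oplus>\<^bsub>N\<^esub> h y) \<and>
        (\<forall>a\<in>carrier R. \<forall>x\<in>carrier M. h (a \<odot>\<^bsub>M\<^esub> x) = a \<odot>\<^bsub>N\<^esub> h x)}"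

text \<open>
  A complex of graded free modules with an augmentation. The module in homological degree \<open>i\<close> is
  free on homogeneous generators \<open>gens C i\<close>, the generator \<open>b\<close> spanning a copy of
  \<open>S[-gdeg C i b]\<close>. The differential \<open>bdry C i\<close> maps homological degree \<open>i + 1\<close> to degree \<open>i\<close>.
\<close>

record ('b, 'a) graded_complex =
  gens :: "nat \<Rightarrow> 'b set"
  gdeg :: "nat \<Rightarrow> 'b \<Rightarrow> int \<Rightarrow> int"
  bdry :: "nat \<Rightarrow> ('b \<Rightarrow> 'a) \<Rightarrow> ('b \<Rightarrow> 'a)"
  augm :: "('b \<Rightarrow> 'a) \<Rightarrow> 'a"

definition chain_module ::
  "int set \<Rightarrow> ('b, 'k::field mpoly) graded_complex \<Rightarrow> nat \<Rightarrow> ('k mpoly, 'b \<Rightarrow> 'k mpoly) module" where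
  "chain_module V C i = free_module (poly_ring V) (gens C i)"

definition free_resolution ::
  "int set \<Rightarrow> ('b, 'k::field mpoly) graded_complex \<Rightarrow> 'k mpoly set \<Rightarrow> bool" where
  "free_resolution V C I \<longleftrightarrow>
     (\<forall>i. bdry C i \<in> linear_maps (poly_ring V) (chain_module V C (Suc i)) (chain_module V C i)) \<and>
     augm C \<in> linear_maps (poly_ring V) (chain_module V C 0) (ideal_module (poly_ring V) I) \<and>
     augm C ` carrier (chain_module V C 0) = I \<and>
     {x \<in> carrier (chain_module V C 0). augm C x = 0} =
       bdry C 0 ` carrier (chain_module V C 1) \<and>
     (\<forall>i. {x \<in> carrier (chain_module V C (Suc i)). bdry C i x = (\<lambda>b. 0)} =
            bdry C (Suc i) ` carrier (chain_module V C (Suc (Suc i))))"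

definition homogeneous_chain ::
  "('b, 'k::field mpoly) graded_complex \<Rightarrow> nat \<Rightarrow> (int \<Rightarrow> int) \<Rightarrow> ('b \<Rightarrow> 'k mpoly) \<Rightarrow> bool" where
  "homogeneous_chain C i \<gamma> x \<longleftrightarrow>
     (\<forall>b\<in>gens C i. homogeneous (\<lambda>v. \<gamma> v - gdeg C i b v) (x b))"

text \<open>A \<open>\<int>\<^bsup>V\<^esup>\<close>-graded free resolution by modules of finite rank, with maps of degree \<open>0\<close>.\<close>

definition graded_free_resolution ::
  "int set \<Rightarrow> ('b, 'k::field mpoly) graded_complex \<Rightarrow> 'k mpoly set \<Rightarrow> bool" where
  "graded_free_resolution V C I \<longleftrightarrow>
     free_resolution V C I \<and>
     (\<forall>i. finite (gens C i)) \<and>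
     (\<forall>i. \<forall>b\<in>gens C i. \<forall>v. v \<notin> V \<longrightarrow> gdeg C i b v = 0) \<and>
     (\<forall>i \<gamma>. \<forall>x\<in>carrier (chain_module V C (Suc i)).
        homogeneous_chain C (Suc i) \<gamma> x \<longrightarrow> homogeneous_chain C i \<gamma> (bdry C i x)) \<and>
     (\<forall>\<gamma>. \<forall>x\<in>carrier (chain_module V C 0).
        homogeneous_chain C 0 \<gamma> x \<longrightarrow> homogeneous \<gamma> (augm C x))"

definition minimal_complex ::
  "int set \<Rightarrow> ('b, 'k::field mpoly) graded_complex \<Rightarrow> bool" where
  "minimal_complex V C \<longleftrightarrow>
     (\<forall>i. \<forall>x\<in>carrier (chain_module V C (Suc i)). \<forall>b\<in>gens C i. bdry C i x b \<in> irrelevant_ideal V)"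

definition minimal_graded_free_resolution ::
  "int set \<Rightarrow> ('b, 'k::field mpoly) graded_complex \<Rightarrow> 'k mpoly set \<Rightarrow> bool" where
  "minimal_graded_free_resolution V C I \<longleftrightarrow> graded_free_resolution V C I \<and> minimal_complex V C"

text \<open>
  The number of copies of \<open>S[-\<alpha>]\<close> in homological degree \<open>i\<close> of a minimal graded free resolution.
  As the modules have finite rank, generators can be taken to be natural numbers.
\<close>

definition betti :: "int set \<Rightarrow> 'k::field mpoly set \<Rightarrow> int \<Rightarrow> (int \<Rightarrow> int) \<Rightarrow> nat" where
  "betti V I i \<alpha> =
     (if i < 0 then 0
      else (THE n. \<exists>C :: (nat, 'k mpoly) graded_complex.
              minimal_graded_free_resolution V C I \<and>
              n = card {b \<in> gens C (nat i). gdeg C (nat i) b = \<alpha>}))"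


section \<open>Labeled polyhedral complexes and cellular resolutions\<close>

text \<open>
  An oriented polyhedral complex is recorded by its nonempty faces, the face relation, dimensions
  and the coefficients \<open>csign X F G = \<plusminus>1\<close> of the facets \<open>G\<close> of \<open>F\<close> in the cellular boundary of \<open>F\<close>.
  Monomial labels are given by their exponent vectors.
\<close>

record 'f cell_complex =
  faces :: "'f set"
  face_le :: "'f \<Rightarrow> 'f \<Rightarrow> bool"
  cdim :: "'f \<Rightarrow> nat"
  csign :: "'f \<Rightarrow> 'f \<Rightarrow> int"
  label :: "'f \<Rightarrow> expo"

definition facets :: "'f cell_complex \<Rightarrow> 'f \<Rightarrow> 'f set" where
  "facets X F = {G \<in> faces X. face_le X G F \<and> Suc (cdim X G) = cdim X F}"

text \<open>Every label is the lcm of the labels of the vertices of the face.\<close>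

definition lcm_labeled :: "'f cell_complex \<Rightarrow> bool" where
  "lcm_labeled X \<longleftrightarrow>
     (\<forall>F\<in>faces X. \<forall>u. Poly_Mapping.lookup (label X F) u =
        Max {Poly_Mapping.lookup (label X v) u | v. v \<in> faces X \<and> cdim X v = 0 \<and> face_le X v F})"

definition cellular_complex :: "'f cell_complex \<Rightarrow> ('f, 'k::field mpoly) graded_complex" where
  "cellular_complex X =
     \<lparr>gens = (\<lambda>i. {F \<in> faces X. cdim X F = i}),
      gdeg = (\<lambda>i F v. int (Poly_Mapping.lookup (label X F) v)),
      bdry = (\<lambda>i x G. \<Sum>F\<in>{F \<in> faces X. cdim X F = Suc i \<and> G \<in> facets X F}.
                x F * Poly_Mapping.single (label X F - label X G) (of_int (csign X F G))),
      augm = (\<lambda>x. \<Sum>v\<in>{v \<in> faces X. cdim X v = 0}.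
                x v * Poly_Mapping.single (label X v) 1)\<rparr>"

definition supports_minimal_cellular_resolution ::
  "int set \<Rightarrow> 'f cell_complex \<Rightarrow> 'k::field mpoly set \<Rightarrow> bool" where
  "supports_minimal_cellular_resolution V X I \<longleftrightarrow>
     lcm_labeled X \<and> minimal_graded_free_resolution V (cellular_complex X) I"


section \<open>The complex of a hypergraph\<close>

text \<open>The cell \<open>\<sigma>\<^sub>1 \<times> \<dots> \<times> \<sigma>\<^sub>d\<close> is represented by the list \<open>[\<sigma>\<^sub>1, \<dots>, \<sigma>\<^sub>d]\<close>.\<close>

type_synonym cell = "int set list"

definition cells :: "nat \<Rightarrow> hgraph \<Rightarrow> cell set" where
  "cells d H =
     {\<sigma>. length \<sigma> = d \<and>
         (\<forall>i<d. \<sigma> ! i \<noteq> {} \<and> \<sigma> ! i \<subseteq> verts H) \<and>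
         sorted_wrt (\<lambda>A B. \<forall>s\<in>A. \<forall>t\<in>B. s < t) \<sigma> \<and>
         (\<forall>vs. length vs = d \<and> (\<forall>i<d. vs ! i \<in> \<sigma> ! i) \<longrightarrow> set vs \<in> edges H)}"

definition cell_dim :: "cell \<Rightarrow> nat" where
  "cell_dim \<sigma> = (\<Sum>A\<leftarrow>\<sigma>. card A - 1)"

definition cell_label :: "cell \<Rightarrow> expo" where
  "cell_label \<sigma> = (\<Sum>A\<leftarrow>\<sigma>. squarefree_expo A)"

text \<open>
  Coefficient of \<open>\<tau>\<close> in the boundary of \<open>\<sigma>\<close> for the product orientation, from
  \<open>\<partial>(\<sigma>\<^sub>1 \<times> \<dots> \<times> \<sigma>\<^sub>d) = \<Sum>\<^sub>i (-1)^(dim \<sigma>\<^sub>1 + \<dots> + dim \<sigma>\<^sub>i\<^sub>-\<^sub>1) \<sigma>\<^sub>1 \<times> \<dots> \<times> \<partial>\<sigma>\<^sub>i \<times> \<dots> \<times> \<sigma>\<^sub>d\<close> and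
  \<open>\<partial>[v\<^sub>0 < \<dots> < v\<^sub>n] = \<Sum>\<^sub>j (-1)^j [v\<^sub>0, \<dots>, v\<^sub>n without v\<^sub>j]\<close>.
  At most one summand below is nonzero.
\<close>

definition product_sign :: "cell \<Rightarrow> cell \<Rightarrow> int" where
  "product_sign \<sigma> \<tau> =
     (\<Sum>i<length \<sigma>. \<Sum>v\<in>\<sigma> ! i.
        if \<tau> = \<sigma>[i := \<sigma> ! i - {v}]
        then (-1) ^ (cell_dim (take i \<sigma>) + card {u \<in> \<sigma> ! i. u < v}) else 0)"

text \<open>
  An arbitrary orientation of the cells: \<open>\<epsilon> \<sigma>\<close> compares the chosen orientation of \<open>\<sigma>\<close> with the
  product orientation. Vertices are positively oriented.
\<close>

definition orientation :: "nat \<Rightarrow> hgraph \<Rightarrow> (cell \<Rightarrow> int) \<Rightarrow> bool" where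
  "orientation d H \<epsilon> \<longleftrightarrow>
     (\<forall>\<sigma>\<in>cells d H. \<epsilon> \<sigma> \<in> {1, -1} \<and> (cell_dim \<sigma> = 0 \<longrightarrow> \<epsilon> \<sigma> = 1))"

definition X_complex :: "nat \<Rightarrow> hgraph \<Rightarrow> (cell \<Rightarrow> int) \<Rightarrow> cell cell_complex" where
  "X_complex d H \<epsilon> =
     \<lparr>faces = cells d H,
      face_le = list_all2 (\<subseteq>),
      cdim = cell_dim,
      csign = (\<lambda>\<sigma> \<tau>. \<epsilon> \<sigma> * product_sign \<sigma> \<tau> * \<epsilon> \<tau>),
      label = cell_label\<rparr>"

end

theory Submission
  imports Defs
begin

text \<open>
  In multidegree \<open>m\<close> the cellular complex of \<open>X\<^sub>H\<close> is the chain complex over \<open>k\<close> of \<open>X\<^sub>H\<^sub>[\<^sub>W\<^sub>]\<close>, where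
  \<open>W\<close> is the support of \<open>m\<close>. It is therefore a resolution as soon as these complexes are acyclic, which
  follows by induction on \<open>d\<close>: if \<open>i\<close> is the smallest vertex with a nonempty layer, then all layers are
  contained in the \<open>i\<close>-layer, so the first factor of every cell can be coned off with apex \<open>i\<close>. This
  contracts the complex onto the slice over \<open>i\<close>, which is the complex of the \<open>i\<close>-layer. The resolution
  is minimal since a cell involves \<open>dim + d\<close> variables, so that proper faces have smaller labels.

  For the Betti numbers, comparison maps between two minimal resolutions compose to maps homotopic
  to the identity. The homotopy vanishes between generators of equal degree because the differentials
  do, so the comparison maps restrict to mutually inverse matrices over \<open>k\<close> in each degree.
\<close>

text \<open>Coning off works because the cell condition is tested separately at each vertex of the
  first factor: \<open>A # \<tau>\<close> is a cell iff \<tau> is a cell over the layer of every v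
  in A. Adding i to A therefore only asks that \<tau> be a cell over the layer of i, which is
  automatic once that layer contains all others. As i is the least vertex that occurs, it takes
  position 0 in the first factor, so the homotopy formula needs no correction signs, and acyclicity
  holds over any nonzero commutative ring. The difficulty on the Betti side is that
  \<open>betti\<close> refers to arbitrary minimal resolutions: their maps are only known to be
  linear and graded, and the degrees of their generators may be any integer vectors on V. All
  multigraded pieces of the ring have dimension at most 1, so such a resolution can be replaced by
  matrices over the field, where the comparison becomes a count of ranks. Moreover
  \<open>betti\<close> asks for generators that are natural numbers, so the generators of the
  cellular resolution have to be renamed.\<close>

abbreviation (input) lookup where "lookup \<equiv> Poly_Mapping.lookup"
abbreviation (input) keys where "keys \<equiv> Poly_Mapping.keys"
abbreviation (input) single where "single \<equiv> Poly_Mapping.single"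

section \<open>Acyclicity of the complex of a cointerval graph\<close>

definition supp :: "('b \<Rightarrow> 'k::zero) \<Rightarrow> 'b set" where
  "supp x = {b. x b \<noteq> 0}"

definition lay :: "int \<Rightarrow> int set set \<Rightarrow> int set set" where
  "lay v E = {f. insert v f \<in> E \<and> (\<forall>w\<in>f. v < w)}"

text \<open>Recursive form of \<open>cells\<close> that suits an induction on the number of factors;
  \<open>cells_eq_product_cells\<close> identifies the two. Order and containment in a vertex set
  need not be demanded, since both are already forced by the layers. In the base case the empty
  product is a single point, present iff the empty edge is.\<close>

primrec product_cells :: "nat \<Rightarrow> int set set \<Rightarrow> cell set" where
  "product_cells 0 E = {\<sigma>. \<sigma> = [] \<and> {} \<in> E}"
| "product_cells (Suc n) E =
     {\<sigma>. \<exists>A \<tau>. \<sigma> = A # \<tau> \<and> finite A \<and> A \<noteq> {} \<and> (\<forall>v\<in>A. \<tau> \<in> product_cells n (lay v E))}"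

text \<open>
  Condition (2) of cointerval graphs, imposed only when the larger layer is nonempty: in this form
  it needs no vertex set and passes to induced subgraphs.
\<close>

primrec nested_layers :: "nat \<Rightarrow> int set set \<Rightarrow> bool" where
  "nested_layers 0 E \<longleftrightarrow> True"
| "nested_layers (Suc n) E \<longleftrightarrow> (\<forall>v. nested_layers n (lay v E)) \<and>
     (\<forall>i j. i < j \<longrightarrow> lay i E \<noteq> {} \<longrightarrow> lay j E \<subseteq> lay i E)"

text \<open>The sign of the facet B in the simplicial boundary of \<open>insert v B\<close>, given
  by the position of v.\<close>

definition sg :: "int \<Rightarrow> int set \<Rightarrow> 'k::comm_ring_1" where
  "sg v B = (-1) ^ card {u \<in> B. u < v}"

text \<open>
  \<open>bd U \<sigma> x\<close> is the coefficient of the cell \<open>\<sigma>\<close> in the boundary of the chain with coefficients \<open>x\<close>,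
  so the sum runs over the cofaces of \<open>\<sigma>\<close>. It is \<open>0\<close> if a factor of \<open>\<sigma>\<close> is empty or infinite.
\<close>

primrec bd :: "int set \<Rightarrow> cell \<Rightarrow> (cell \<Rightarrow> 'k::comm_ring_1) \<Rightarrow> 'k" where
  "bd U [] = (\<lambda>x. 0)"
| "bd U (B # \<tau>) = (\<lambda>x. if finite B \<and> B \<noteq> {} then
     (\<Sum>v\<in>U - B. sg v B * x (insert v B # \<tau>)) +
     (-1) ^ (card B - 1) * bd U \<tau> (\<lambda>\<rho>. x (B # \<rho>)) else 0)"

text \<open>The chain map induced by projecting away the first factor.\<close>

definition collapse :: "int set \<Rightarrow> (cell \<Rightarrow> 'k::comm_ring_1) \<Rightarrow> cell \<Rightarrow> 'k" where
  "collapse U x = (\<lambda>\<tau>. \<Sum>v\<in>U. x ({v} # \<tau>))"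

primrec aug :: "int set \<Rightarrow> nat \<Rightarrow> (cell \<Rightarrow> 'k::comm_ring_1) \<Rightarrow> 'k" where
  "aug U 0 x = x []"
| "aug U (Suc n) x = aug U n (collapse U x)"

section \<open>Layers, product cells and restriction to a vertex subset\<close>

lemma lay_mono: "E \<subseteq> E' \<Longrightarrow> lay v E \<subseteq> lay v E'"
  by (auto simp: lay_def)

lemma lay_empty [simp]: "lay v {} = {}"
  by (simp add: lay_def)

lemma lay_subset_Pow: "E \<subseteq> Pow U \<Longrightarrow> lay v E \<subseteq> Pow U"
  by (auto simp: lay_def)

lemma lay_nonempty_mem: "E \<subseteq> Pow U \<Longrightarrow> lay v E \<noteq> {} \<Longrightarrow> v \<in> U"
  by (auto simp: lay_def)

lemma product_cells_mono: "E \<subseteq> E' \<Longrightarrow> product_cells n E \<subseteq> product_cells n E'"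
proof (induction n arbitrary: E E')
  case (Suc n)
  have mono: "\<tau> \<in> product_cells n (lay v E) \<Longrightarrow> \<tau> \<in> product_cells n (lay v E')" for v \<tau>
    using Suc.IH[OF lay_mono[OF Suc.prems]] by (rule subsetD)
  show ?case
  proof
    fix \<sigma> assume "\<sigma> \<in> product_cells (Suc n) E"
    then obtain A \<tau> where \<sigma>: "\<sigma> = A # \<tau>" "finite A" "A \<noteq> {}" "\<And>v. v \<in> A \<Longrightarrow> \<tau> \<in> product_cells n (lay v E)"
      by auto
    then show "\<sigma> \<in> product_cells (Suc n) E'" using mono by simp
  qed
qed auto

lemma product_cells_empty [simp]: "product_cells n {} = {}"
  by (induction n) auto

lemma product_cells_subset:
  "E \<subseteq> Pow U \<Longrightarrow> \<sigma> \<in> product_cells n E \<Longrightarrow> A \<in> set \<sigma> \<Longrightarrow> A \<subseteq> U"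
proof (induction n arbitrary: E \<sigma>)
  case (Suc n)
  then obtain B \<tau> where \<sigma>: "\<sigma> = B # \<tau>" "finite B" "B \<noteq> {}" "\<forall>v\<in>B. \<tau> \<in> product_cells n (lay v E)"
    by auto
  have B: "B \<subseteq> U"
  proof
    fix v assume "v \<in> B"
    then have "lay v E \<noteq> {}" using \<sigma>(4) by fastforce
    then show "v \<in> U" using lay_nonempty_mem Suc.prems by blast
  qed
  obtain v where "v \<in> B" using \<sigma> by blast
  then show ?case using Suc.IH[OF lay_subset_Pow, of E \<tau> v] Suc.prems \<sigma> B by auto
qed auto

lemma product_cells_length: "\<sigma> \<in> product_cells n E \<Longrightarrow> length \<sigma> = n"
  by (induction n arbitrary: E \<sigma>) fastforce+

lemma finite_product_cells:
  assumes "finite U" "E \<subseteq> Pow U" shows "finite (product_cells n E)"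
proof (rule finite_subset)
  show "product_cells n E \<subseteq> {\<sigma>. set \<sigma> \<subseteq> Pow U \<and> length \<sigma> = n}"
    using product_cells_subset[OF assms(2)] product_cells_length by blast
  show "finite {\<sigma>. set \<sigma> \<subseteq> Pow U \<and> length \<sigma> = n}"
    by (rule finite_lists_length_eq) (use assms in auto)
qed

lemma lay_restrict:
  "lay v {e \<in> E. e \<subseteq> W} = (if v \<in> W then {e \<in> lay v E. e \<subseteq> W} else {})"
  by (auto simp: lay_def)

text \<open>Used to recognise strands: the cells whose label divides a monomial with support W form
  the complex of the subgraph induced on W, to which the acyclicity theorem applies.\<close>

lemma product_cells_restrict:
  "product_cells n {e \<in> E. e \<subseteq> W} = {\<sigma> \<in> product_cells n E. \<forall>A\<in>set \<sigma>. A \<subseteq> W}"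
proof (induction n arbitrary: E)
  case (Suc n)
  have step: "product_cells n (lay v {e \<in> E. e \<subseteq> W}) =
      (if v \<in> W then {\<sigma> \<in> product_cells n (lay v E). \<forall>A\<in>set \<sigma>. A \<subseteq> W} else {})" for v
    unfolding lay_restrict using Suc.IH by simp
  show ?case
  proof (rule Set.set_eqI)
    fix \<sigma>
    show "\<sigma> \<in> product_cells (Suc n) {e \<in> E. e \<subseteq> W} \<longleftrightarrow>
        \<sigma> \<in> {\<sigma> \<in> product_cells (Suc n) E. \<forall>A\<in>set \<sigma>. A \<subseteq> W}"
      by (cases \<sigma>) (simp, simp add: step, blast)
  qed
qed auto

lemma nested_layers_restrict:
  "nested_layers n E \<Longrightarrow> nested_layers n {e \<in> E. e \<subseteq> W}"
proof (induction n arbitrary: E)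
  case (Suc n)
  have e: "nested_layers n {}" for n by (induction n) auto
  have "lay j {e \<in> E. e \<subseteq> W} \<subseteq> lay i {e \<in> E. e \<subseteq> W}"
    if "i < j" "lay i {e \<in> E. e \<subseteq> W} \<noteq> {}" for i j
  proof -
    have "i \<in> W" "lay i E \<noteq> {}" using that unfolding lay_restrict by (auto split: if_splits)
    then have "lay j E \<subseteq> lay i E" using Suc.prems that by auto
    then show ?thesis unfolding lay_restrict using \<open>i \<in> W\<close> by auto
  qed
  moreover have "nested_layers n (lay v {e \<in> E. e \<subseteq> W})" for v
    unfolding lay_restrict using Suc e by auto
  ultimately show ?case by auto
qed auto

section \<open>The boundary operator, the collapse of the first factor and the augmentation\<close>

lemma bd_add: "bd U \<sigma> (\<lambda>\<rho>. x \<rho> + y \<rho>) = bd U \<sigma> x + bd U \<sigma> y"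
  by (induction \<sigma> arbitrary: x y) (auto simp: algebra_simps sum.distrib)

lemma bd_scale: "bd U \<sigma> (\<lambda>\<rho>. c * x \<rho>) = c * bd U \<sigma> x"
  by (induction \<sigma> arbitrary: x) (auto simp: algebra_simps sum_distrib_left)

lemma bd_zero [simp]: "bd U \<sigma> (\<lambda>\<rho>. 0) = 0"
  by (induction \<sigma>) auto

lemma bd_sum: "bd U \<sigma> (\<lambda>\<rho>. \<Sum>i\<in>I. x i \<rho>) = (\<Sum>i\<in>I. bd U \<sigma> (x i))"
  by (induction I rule: infinite_finite_induct) (auto simp: bd_add)

text \<open>The cancellation in pairs behind \<open>bd_bd\<close> and \<open>bd_collapse\<close>:
  the two ways of reaching the same simplex by adding v and w carry opposite signs.\<close>

lemma sum_antisym: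
  fixes g :: "int \<Rightarrow> int \<Rightarrow> 'k::comm_ring_1"
  assumes "finite U" and anti: "\<And>v w. v \<in> U \<Longrightarrow> w \<in> U \<Longrightarrow> v < w \<Longrightarrow> g v w + g w v = 0"
  shows "(\<Sum>v\<in>U. \<Sum>w\<in>U - {v}. g v w) = 0"
proof -
  have split: "(\<Sum>v\<in>U. \<Sum>w\<in>U - {v}. g v w) =
      (\<Sum>(v,w)\<in>{(v,w). v \<in> U \<and> w \<in> U \<and> v < w}. g v w) +
      (\<Sum>(v,w)\<in>{(v,w). v \<in> U \<and> w \<in> U \<and> w < v}. g v w)"
  proof -
    have fin: "finite {(v,w). v \<in> U \<and> w \<in> U \<and> v < w}" "finite {(v,w). v \<in> U \<and> w \<in> U \<and> w < v}"
      by (rule finite_subset[of _ "U \<times> U"]; use assms(1) in auto)+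
    have S: "Sigma U (\<lambda>v. U - {v}) =
        {(v,w). v \<in> U \<and> w \<in> U \<and> v < w} \<union> {(v,w). v \<in> U \<and> w \<in> U \<and> w < v}"
      by auto
    have "(\<Sum>v\<in>U. \<Sum>w\<in>U - {v}. g v w) = (\<Sum>(v,w)\<in>Sigma U (\<lambda>v. U - {v}). g v w)"
      using assms(1) by (intro sum.Sigma) auto
    then show ?thesis unfolding S by (simp only:) (rule sum.union_disjoint[OF fin], auto)
  qed
  have "(\<Sum>(v,w)\<in>{(v,w). v \<in> U \<and> w \<in> U \<and> w < v}. g v w) =
        (\<Sum>(v,w)\<in>{(v,w). v \<in> U \<and> w \<in> U \<and> v < w}. g w v)"
    by (rule sum.reindex_bij_witness[of _ prod.swap prod.swap]) auto
  then have "(\<Sum>v\<in>U. \<Sum>w\<in>U - {v}. g v w) =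
      (\<Sum>(v,w)\<in>{(v,w). v \<in> U \<and> w \<in> U \<and> v < w}. g v w + g w v)"
    unfolding split by (simp add: sum.distrib split_def)
  also have "\<dots> = 0" using anti by (intro sum.neutral) auto
  finally show ?thesis .
qed

lemma sg_insert:
  assumes "finite B" "v \<notin> B"
  shows "sg w (insert v B) = (if v < w then - sg w B else sg w B)"
proof -
  have "{u \<in> insert v B. u < w} = (if v < w then insert v {u \<in> B. u < w} else {u \<in> B. u < w})"
    by auto
  then show ?thesis using assms by (simp add: sg_def)
qed

lemma sg_empty [simp]: "sg w {} = 1"
  by (simp add: sg_def)

text \<open>Three kinds of terms occur. Two insertions into the first factor cancel by
  \<open>sum_antisym\<close>. An insertion there and a boundary in the tail can be done in either
  order, and the results cancel because enlarging B flips the sign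
  \<open>(-1) ^ (card B - 1)\<close>. Two boundaries in the tail vanish by induction.\<close>

lemma bd_bd:
  assumes "finite U"
  shows "bd U \<sigma> (\<lambda>\<rho>. bd U \<rho> x) = 0"
proof (induction \<sigma> arbitrary: x)
  case (Cons B \<tau>)
  show ?case
  proof (cases "finite B \<and> B \<noteq> {}")
    case True
    then have cB: "card B > 0" by (simp add: card_gt_0_iff)
    let ?W = "U - B"
    have sg1: "(-1) ^ (card (insert v B) - 1) = - ((-1) ^ (card B - 1) :: 'a)" if "v \<in> ?W" for v
      using that True cB by (cases "card B") auto
    have ins: "U - insert v B = ?W - {v}" for v by auto
    define X where "X = (\<Sum>v\<in>?W. sg v B * bd U \<tau> (\<lambda>\<rho>. x (insert v B # \<rho>)))"
    have "(\<Sum>v\<in>?W. sg v B * bd U (insert v B # \<tau>) x) =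
        (\<Sum>v\<in>?W. \<Sum>w\<in>?W - {v}. sg v B * (sg w (insert v B) * x (insert w (insert v B) # \<tau>)))
        - (-1) ^ (card B - 1) * X"
      unfolding X_def sum_distrib_left sum_subtractf[symmetric]
      by (rule sum.cong[OF refl]) (use True sg1 in \<open>simp add: ins algebra_simps sum_distrib_left\<close>)
    also have "(\<Sum>v\<in>?W. \<Sum>w\<in>?W - {v}. sg v B * (sg w (insert v B) * x (insert w (insert v B) # \<tau>))) = 0"
    proof (rule sum_antisym)
      fix v w assume vw: "v \<in> ?W" "w \<in> ?W" "v < w"
      have "insert w (insert v B) = insert v (insert w B)" by auto
      then show "sg v B * (sg w (insert v B) * x (insert w (insert v B) # \<tau>)) +
            sg w B * (sg v (insert w B) * x (insert v (insert w B) # \<tau>)) = 0"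
        using vw True by (simp add: sg_insert)
    qed (use assms in auto)
    finally have 1: "(\<Sum>v\<in>?W. sg v B * bd U (insert v B # \<tau>) x) = - ((-1) ^ (card B - 1) * X)"
      by simp
    have "bd U \<tau> (\<lambda>\<rho>. bd U (B # \<rho>) x) = X"
    proof -
      have "bd U \<tau> (\<lambda>\<rho>. bd U (B # \<rho>) x) = X +
          (-1) ^ (card B - 1) * bd U \<tau> (\<lambda>\<rho>. bd U \<rho> (\<lambda>\<rho>. x (B # \<rho>)))"
        using True by (simp add: bd_add bd_sum bd_scale X_def)
      then show ?thesis using Cons.IH by simp
    qed
    then show ?thesis using True 1 by (simp del: bd.simps add: bd.simps(2)[of U B \<tau>])
  qed auto
qed auto

text \<open>An edge \<open>{v, w}\<close> in the first factor is met once from each endpoint, with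
  opposite signs, so it drops out of the sum over all vertices. What is left is the boundary of the
  tail, with sign \<open>(-1) ^ 0\<close>.\<close>

lemma bd_collapse:
  assumes "finite U"
  shows "bd U \<tau> (collapse U x) = collapse U (\<lambda>\<sigma>. bd U \<sigma> x) \<tau>"
proof -
  have "(\<Sum>v\<in>U. \<Sum>w\<in>U - {v}. sg w {v} * x ({w, v} # \<tau>)) = 0"
  proof (rule sum_antisym[OF assms])
    fix v w :: int assume "v < w"
    then show "sg w {v} * x ({w, v} # \<tau>) + sg v {w} * x ({v, w} # \<tau>) = 0"
      by (simp add: sg_insert insert_commute)
  qed
  then show ?thesis unfolding collapse_def bd_sum by (simp add: sum.distrib)
qed

text \<open>Collapsing every factor is a chain map down to the cell \<open>[]\<close>, at which
  \<open>bd\<close> is 0.\<close>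

lemma aug_bd:
  assumes "finite U" shows "aug U n (\<lambda>\<sigma>. bd U \<sigma> x) = 0"
proof (induction n arbitrary: x)
  case (Suc n)
  have "collapse U (\<lambda>\<sigma>. bd U \<sigma> x) = (\<lambda>\<tau>. bd U \<tau> (collapse U x))"
    using bd_collapse[OF assms] by metis
  then show ?case using Suc.IH[of "collapse U x"] by simp
qed auto

lemma cell_dim_Cons: "cell_dim (A # \<sigma>) = card A - 1 + cell_dim \<sigma>"
  by (simp add: cell_dim_def)

text \<open>Faces of cells are cells of one dimension less. For a face in the tail, the induction
  hypothesis is used over the layer of every vertex of B.\<close>

lemma supp_bd:
  assumes U: "E \<subseteq> Pow U"
  shows "supp x \<subseteq> product_cells n E \<inter> {\<sigma>. cell_dim \<sigma> = j} \<Longrightarrow> bd U \<sigma> x \<noteq> 0 \<Longrightarrow>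
    \<sigma> \<in> product_cells n E \<and> Suc (cell_dim \<sigma>) = j"
  using U
proof (induction n arbitrary: E \<sigma> x j)
  case 0
  then have x: "x \<rho> = 0" if "\<rho> \<noteq> []" for \<rho> using that by (auto simp: supp_def)
  then have "bd U \<sigma> x = 0" by (cases \<sigma>) auto
  then show ?case using 0 by simp
next
  case (Suc n)
  have x: "x \<rho> \<noteq> 0 \<Longrightarrow> \<rho> \<in> product_cells (Suc n) E \<and> cell_dim \<rho> = j" for \<rho>
    using Suc.prems(1) by (auto simp: supp_def)
  obtain B \<tau> where \<sigma>: "\<sigma> = B # \<tau>" using Suc.prems by (cases \<sigma>) auto
  have B: "finite B" "B \<noteq> {}" using Suc.prems \<sigma> by (auto split: if_splits)
  then have cB: "card B > 0" by (simp add: card_gt_0_iff)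
  have "(\<exists>v\<in>U - B. x (insert v B # \<tau>) \<noteq> 0) \<or> bd U \<tau> (\<lambda>\<rho>. x (B # \<rho>)) \<noteq> 0"
  proof (rule ccontr)
    assume "\<not> ?thesis"
    then have "bd U \<sigma> x = 0" using B by (simp add: \<sigma>)
    then show False using Suc.prems by simp
  qed
  then show ?case
  proof
    assume "\<exists>v\<in>U - B. x (insert v B # \<tau>) \<noteq> 0"
    then obtain v where v: "v \<in> U - B" "x (insert v B # \<tau>) \<noteq> 0" by blast
    show ?thesis using x[OF v(2)] v(1) B cB by (auto simp: \<sigma> cell_dim_Cons)
  next
    assume *: "bd U \<tau> (\<lambda>\<rho>. x (B # \<rho>)) \<noteq> 0"
    have "\<tau> \<in> product_cells n (lay v E) \<and> Suc (cell_dim \<tau>) = j - (card B - 1)" if "v \<in> B" for v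
    proof (rule Suc.IH[OF _ *])
      show "supp (\<lambda>\<rho>. x (B # \<rho>)) \<subseteq> product_cells n (lay v E) \<inter> {\<sigma>. cell_dim \<sigma> = j - (card B - 1)}"
        using x that by (fastforce simp: supp_def cell_dim_Cons)
      show "lay v E \<subseteq> Pow U" using Suc.prems lay_subset_Pow by blast
    qed
    moreover from this obtain "Suc (cell_dim \<tau>) = j - (card B - 1)" using B by blast
    \<comment> \<open>The truncated difference equals a successor, so nothing was cut off.\<close>
    then have "Suc (cell_dim \<sigma>) = j" unfolding \<sigma> cell_dim_Cons by linarith
    ultimately show ?thesis using B by (simp add: \<sigma>)
  qed
qed

text \<open>
  The cone over the slice \<open>{i} \<times> \<dots>\<close>, transposed: on a coefficient function, coning off with apex
  \<open>i\<close> in the first factor reads the coefficient at the cell from which \<open>i\<close> has been removed.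
\<close>

definition cone :: "int \<Rightarrow> (cell \<Rightarrow> 'k::comm_ring_1) \<Rightarrow> cell \<Rightarrow> 'k" where
  "cone i x \<sigma> = (case \<sigma> of [] \<Rightarrow> 0
     | B # \<tau> \<Rightarrow> if i \<in> B \<and> B \<noteq> {i} then x ((B - {i}) # \<tau>) else 0)"

text \<open>A chain homotopy from the identity to the collapse followed by inclusion as the slice
  over i. If i is not in B, the only coface of B on which the cone is nonzero adds i. If B is
  \<open>{i}\<close>, the cofaces \<open>{i, v}\<close> produce all of the collapse except its term
  at i. Otherwise the boundary of the cone cancels the boundary at \<open>B - {i}\<close> up to the
  single term that puts i back. By the hypothesis \<open>x0\<close>, i precedes every vertex that
  matters, so its own sign is 1.\<close>

lemma cone_homotopy:
  fixes x :: "cell \<Rightarrow> 'k::comm_ring_1"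
  assumes U: "finite U" "i \<in> U"
    and x0: "\<And>B \<tau>. x (B # \<tau>) \<noteq> 0 \<Longrightarrow> \<forall>u\<in>B. i \<le> u"
    and B: "finite B" "B \<noteq> {}"
  shows "bd U (B # \<tau>) (cone i x) + cone i (\<lambda>\<sigma>. bd U \<sigma> x) (B # \<tau>) =
    x (B # \<tau>) - (if B = {i} then collapse U x \<tau> else 0)"
proof (cases "i \<in> B")
  case False
  have c0: "(\<lambda>\<rho>. cone i x (B # \<rho>)) = (\<lambda>\<rho>. 0)" using False by (simp add: cone_def)
  have "bd U (B # \<tau>) (cone i x) = (\<Sum>v\<in>U - B. sg v B * cone i x (insert v B # \<tau>))"
    using B c0 by simp
  also have "\<dots> = (\<Sum>v\<in>{i}. sg v B * cone i x (insert v B # \<tau>))"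
    by (rule sum.mono_neutral_right) (use U False in \<open>auto simp: cone_def\<close>)
  also have "\<dots> = sg i B * x (B # \<tau>)"
    using False B by (auto simp: cone_def)
  also have "\<dots> = x (B # \<tau>)"
  proof (cases "x (B # \<tau>) = 0")
    case False
    then have "{u \<in> B. u < i} = {}" using x0 by fastforce
    then show ?thesis by (simp add: sg_def del: Collect_empty_eq)
  qed auto
  finally show ?thesis using False by (auto simp: cone_def)
next
  case True
  define D where "D = B - {i}"
  have D: "finite D" "i \<notin> D" "B = insert i D" using B True by (auto simp: D_def)
  have sum1: "(\<Sum>v\<in>U - B. sg v B * cone i x (insert v B # \<tau>)) =
      - (\<Sum>v\<in>U - B. sg v D * x (insert v D # \<tau>))"
    unfolding sum_negf[symmetric]
  proof (rule sum.cong[OF refl])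
    fix v assume v: "v \<in> U - B"
    have "insert v B - {i} = insert v D" using v D by auto
    moreover have "insert v B \<noteq> {i}" using v D by auto
    ultimately have c: "cone i x (insert v B # \<tau>) = x (insert v D # \<tau>)" using D by (simp add: cone_def)
    \<comment> \<open>Only v with a nonzero coefficient matter; these exceed i, so the additional
      element i of B shifts their position by one.\<close>
    show "sg v B * cone i x (insert v B # \<tau>) = - (sg v D * x (insert v D # \<tau>))"
    proof (cases "x (insert v D # \<tau>) = 0")
      case False
      then have "i < v" using x0[OF False] v D by force
      then show ?thesis using c D by (simp add: sg_insert)
    qed (use c in auto)
  qed
  show ?thesis
  proof (cases "D = {}")
    case True
    have c0: "(\<lambda>\<rho>. cone i x (B # \<rho>)) = (\<lambda>\<rho>. 0)" using True D by (simp add: cone_def)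
    have "collapse U x \<tau> = x ({i} # \<tau>) + (\<Sum>v\<in>U - B. x ({v} # \<tau>))"
      unfolding collapse_def using U True D by (simp add: sum.remove)
    moreover have "bd U (B # \<tau>) (cone i x) = - (\<Sum>v\<in>U - B. x ({v} # \<tau>))"
      using B c0 sum1 True by (simp add: sg_def)
    ultimately show ?thesis using True D by (simp add: cone_def)
  next
    case False
    then have cD: "card D > 0" using D by (simp add: card_gt_0_iff)
    have BD: "B \<noteq> {i}" "B - {i} = D" using False by (auto simp: D_def)
    have c: "(\<lambda>\<rho>. cone i x (B # \<rho>)) = (\<lambda>\<rho>. x (D # \<rho>))" using BD True by (simp add: cone_def)
    have cB: "(-1) ^ (card B - 1) = - ((-1) ^ (card D - 1) :: 'k)"
      using D cD by (cases "card D") auto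
    have "bd U (B # \<tau>) (cone i x) = - (\<Sum>v\<in>U - B. sg v D * x (insert v D # \<tau>)) -
        (-1) ^ (card D - 1) * bd U \<tau> (\<lambda>\<rho>. x (D # \<rho>))"
      using B c sum1 cB by simp
    moreover have "cone i (\<lambda>\<sigma>. bd U \<sigma> x) (B # \<tau>) = bd U (D # \<tau>) x"
      using BD True by (simp add: cone_def)
    moreover have "bd U (D # \<tau>) x = sg i D * x (B # \<tau>) + (\<Sum>v\<in>U - B. sg v D * x (insert v D # \<tau>)) +
        (-1) ^ (card D - 1) * bd U \<tau> (\<lambda>\<rho>. x (D # \<rho>))"
    proof -
      \<comment> \<open>Among the cofaces of D in the first factor, the one adding i is B itself;
        the others cancel against \<open>sum1\<close>.\<close>
      have W: "U - D = insert i (U - B)" "i \<notin> U - B" using D U by auto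
      have "(\<Sum>v\<in>U - D. f v) = f i + (\<Sum>v\<in>U - B. f v)" for f :: "int \<Rightarrow> 'k"
        unfolding W(1) using W(2) U(1) by simp
      from this[of "\<lambda>v. sg v D * x (insert v D # \<tau>)"] show ?thesis
        using D(1) False by (simp add: D(3)[symmetric])
    qed
    moreover have "sg i D * x (B # \<tau>) = x (B # \<tau>)"
    proof (cases "x (B # \<tau>) = 0")
      case False
      then have "{u \<in> D. u < i} = {}" using x0 D by fastforce
      then show ?thesis by (simp add: sg_def del: Collect_empty_eq)
    qed auto
    ultimately show ?thesis using BD(1) by (simp del: bd.simps)
  qed
qed

text \<open>Let y be the collapse of the cycle x and z a filling of y over the layer of i, found by
  induction. The homotopy formula says that the cone of x has boundary x minus the copy of y over
  \<open>{i}\<close>, so adding the copy of z over \<open>{i}\<close> gives a filling of x. Reduced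
  homology is meant, hence the augmentation condition for j = 0. With no factors left, the complex
  is at most one point and the augmentation detects its 0-chains.\<close>

theorem product_cells_acyclic:
  fixes x :: "cell \<Rightarrow> 'k::comm_ring_1"
  assumes "finite U"
  shows "E \<subseteq> Pow U \<Longrightarrow> nested_layers n E \<Longrightarrow>
    supp x \<subseteq> product_cells n E \<inter> {\<sigma>. cell_dim \<sigma> = j} \<Longrightarrow>
    (\<And>\<sigma>. bd U \<sigma> x = 0) \<Longrightarrow> (j = 0 \<Longrightarrow> aug U n x = 0) \<Longrightarrow>
    \<exists>z. supp z \<subseteq> product_cells n E \<inter> {\<sigma>. cell_dim \<sigma> = Suc j} \<and> (\<forall>\<sigma>. bd U \<sigma> z = x \<sigma>)"
proof (induction n arbitrary: E x j)
  case 0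
  have "x \<sigma> = 0" for \<sigma>
  proof (rule ccontr)
    assume "x \<sigma> \<noteq> 0"
    then have "\<sigma> = []" "j = 0" using 0 by (auto simp: supp_def cell_dim_def)
    then show False using 0 \<open>x \<sigma> \<noteq> 0\<close> by simp
  qed
  then show ?case by (intro exI[of _ "\<lambda>_. 0"]) (auto simp: supp_def)
next
  case (Suc n)
  have x: "x \<rho> \<noteq> 0 \<Longrightarrow> \<rho> \<in> product_cells (Suc n) E \<and> cell_dim \<rho> = j" for \<rho>
    using Suc.prems(3) by (auto simp: supp_def)
  define L where "L = {v. lay v E \<noteq> {}}"
  have LU: "L \<subseteq> U" using lay_nonempty_mem[OF Suc.prems(1)] by (auto simp: L_def)
  then have finL: "finite L" using assms finite_subset by blast
  show ?case
  proof (cases "L = {}")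
    case True
    then have "\<And>v. lay v E = {}" by (auto simp: L_def)
    then have "product_cells (Suc n) E = {}" by auto
    then have "x \<sigma> = 0" for \<sigma> using x[of \<sigma>] by blast
    then show ?thesis by (intro exI[of _ "\<lambda>_. 0"]) (auto simp: supp_def)
  next
    case False
    define i where "i = Min L"
    have i: "i \<in> L" "i \<in> U" using Min_in[OF finL False] LU by (auto simp: i_def)
    have sub: "lay v E \<subseteq> lay i E" for v
    proof (cases "v \<in> L")
      case True
      then have "v = i \<or> i < v" using finL unfolding i_def
        using Min_le order_le_less by metis
      then show ?thesis using Suc.prems(2) i by (auto simp: L_def)
    qed (auto simp: L_def)
    have ge: "i \<le> u" if "A # \<tau> \<in> product_cells (Suc n) E" "u \<in> A" for A \<tau> u
    proof -
      have "lay u E \<noteq> {}" using that by auto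
      then show ?thesis using finL by (auto simp: i_def L_def)
    qed
    have in_i: "\<tau> \<in> product_cells n (lay i E)" if "A # \<tau> \<in> product_cells (Suc n) E" for A \<tau>
      using that subsetD[OF product_cells_mono[OF sub]] by auto
    define y where "y = collapse U x"
    have bdy: "bd U \<tau> y = 0" for \<tau>
      unfolding y_def bd_collapse[OF assms] using Suc.prems(4) by (simp add: collapse_def)
    have sy: "supp y \<subseteq> product_cells n (lay i E) \<inter> {\<sigma>. cell_dim \<sigma> = j}"
    proof
      fix \<tau> assume "\<tau> \<in> supp y"
      then have "(\<Sum>v\<in>U. x ({v} # \<tau>)) \<noteq> 0" by (simp add: supp_def y_def collapse_def)
      then obtain v where "x ({v} # \<tau>) \<noteq> 0"
        by (rule sum.not_neutral_contains_not_neutral)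
      from x[OF this] show "\<tau> \<in> product_cells n (lay i E) \<inter> {\<sigma>. cell_dim \<sigma> = j}"
        using in_i[of "{v}" \<tau>] by (auto simp: cell_dim_Cons)
    qed
    have ny: "nested_layers n (lay i E)" using Suc.prems(2) by simp
    have ay: "j = 0 \<Longrightarrow> aug U n y = 0" using Suc.prems(5) by (simp add: y_def)
    obtain z where z: "supp z \<subseteq> product_cells n (lay i E) \<inter> {\<sigma>. cell_dim \<sigma> = Suc j}"
        "\<And>\<tau>. bd U \<tau> z = y \<tau>"
      using Suc.IH[OF lay_subset_Pow[OF Suc.prems(1)] ny sy bdy ay] by blast
    define w where "w = (\<lambda>\<sigma>. case \<sigma> of [] \<Rightarrow> 0 | B # \<tau> \<Rightarrow> if B = {i} then z \<tau> else 0)"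
    have bdw: "bd U (B # \<tau>) w = (if B = {i} then y \<tau> else 0)" if "finite B" "B \<noteq> {}" for B \<tau>
    proof -
      \<comment> \<open>Adding a new vertex to a nonempty set never gives a singleton, so w has no
        boundary across its first factor.\<close>
      have "insert v B \<noteq> {i}" if "v \<in> U - B" for v using that \<open>B \<noteq> {}\<close> by auto
      then have "(\<Sum>v\<in>U - B. sg v B * w (insert v B # \<tau>)) = 0"
        by (intro sum.neutral ballI) (simp add: w_def del: singleton_insert_inj_eq')
      moreover have "(\<lambda>\<rho>. w (B # \<rho>)) = (if B = {i} then z else (\<lambda>\<rho>. 0))" by (auto simp: w_def)
      ultimately show ?thesis using that z(2) by auto
    qed
    have cx: "cone i (\<lambda>\<sigma>. bd U \<sigma> x) = (\<lambda>\<sigma>. 0)" using Suc.prems(4) by (auto simp: cone_def split: list.splits)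
    have "bd U \<sigma> (\<lambda>\<rho>. cone i x \<rho> + w \<rho>) = x \<sigma>" for \<sigma>
    proof (cases \<sigma>)
      case Nil
      then show ?thesis using x[of "[]"] by auto
    next
      case (Cons B \<tau>)
      show ?thesis
      proof (cases "finite B \<and> B \<noteq> {}")
        case True
        have "bd U (B # \<tau>) (cone i x) = x (B # \<tau>) - (if B = {i} then y \<tau> else 0)"
        proof -
          have x0: "\<And>A \<rho>. x (A # \<rho>) \<noteq> 0 \<Longrightarrow> \<forall>u\<in>A. i \<le> u"
            using x ge by blast
          show ?thesis
            using cone_homotopy[of U i x B \<tau>, OF assms i(2) x0] True by (simp add: cx y_def del: bd.simps)
        qed
        then show ?thesis using bdw True by (simp add: Cons bd_add del: bd.simps)
      next
        case False
        then have "x \<sigma> = 0" using x[of \<sigma>] Cons by auto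
        then show ?thesis using False Cons by auto
      qed
    qed
    moreover have "\<sigma> \<in> product_cells (Suc n) E \<inter> {\<sigma>. cell_dim \<sigma> = Suc j}" if "cone i x \<sigma> + w \<sigma> \<noteq> 0" for \<sigma>
    proof -
      have "cone i x \<sigma> \<noteq> 0 \<or> w \<sigma> \<noteq> 0" using that by auto
      then show ?thesis
      proof
        assume "cone i x \<sigma> \<noteq> 0"
        then obtain B \<tau> where \<sigma>: "\<sigma> = B # \<tau>" "i \<in> B" "B \<noteq> {i}" "x ((B - {i}) # \<tau>) \<noteq> 0"
          by (auto simp: cone_def split: list.splits if_splits)
        note xx = x[OF \<sigma>(4)]
        have "finite B" "B - {i} \<noteq> {}" using xx \<sigma> by auto
        then have "card B - 1 = Suc (card (B - {i}) - 1)" using \<sigma>(2)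
          by (metis card_Diff_singleton card_gt_0_iff finite_Diff Suc_pred' )
        moreover have "\<tau> \<in> product_cells n (lay i E)" using xx in_i by blast
        ultimately show ?thesis using xx \<sigma> by (auto simp: cell_dim_Cons)
      next
        assume "w \<sigma> \<noteq> 0"
        then obtain \<tau> where "\<sigma> = {i} # \<tau>" "z \<tau> \<noteq> 0" by (auto simp: w_def split: list.splits if_splits)
        then show ?thesis using z(1) by (auto simp: supp_def cell_dim_Cons)
      qed
    qed
    ultimately show ?thesis
      by (intro exI[of _ "\<lambda>\<rho>. cone i x \<rho> + w \<rho>"]) (auto simp: supp_def)
  qed
qed

section \<open>Cells of \<open>X\<^sub>H\<close> and their product signs\<close>

lemma edges_layer: "edges (layer v H) = lay v (edges H)"
  by (simp add: layer_def lay_def)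

lemma verts_layer: "verts (layer v H) = verts H - {v}"
  by (simp add: layer_def)

lemma d_graph_layer:
  assumes "d_graph (Suc n) H" shows "d_graph n (layer v H)"
proof -
  have "f \<subseteq> verts H - {v} \<and> card f = n" if "f \<in> lay v (edges H)" for f
  proof -
    have f: "insert v f \<in> edges H" "v \<notin> f" using that by (auto simp: lay_def)
    then have "insert v f \<subseteq> verts H" "card (insert v f) = Suc n" "finite (verts H)"
      using assms by (auto simp: d_graph_def)
    then show ?thesis using f(2) by (metis card_insert_disjoint finite_subset insert_subset
          nat.inject subset_Diff_insert Diff_empty)
  qed
  then show ?thesis using assms by (auto simp: d_graph_def edges_layer verts_layer)
qed

lemma d_graph_edges: "d_graph n H \<Longrightarrow> edges H \<subseteq> Pow (verts H)"
  by (auto simp: d_graph_def)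

text \<open>For d = 1 a layer can contain nothing but the empty edge, so a nonempty one contains
  every other. For larger d, integers outside \<open>verts H\<close> have empty layers and cannot
  violate the nesting.\<close>

lemma nested_layers_of_cointerval:
  "d_graph d H \<Longrightarrow> cointerval d H \<Longrightarrow> nested_layers d (edges H)"
proof (induction d H rule: cointerval.induct)
  case (2 H)
  have "lay i (edges H) \<subseteq> {{}}" for i
  proof
    fix f assume "f \<in> lay i (edges H)"
    then have "f \<subseteq> verts (layer i H)" "card f = 0" "finite (verts (layer i H))"
      using d_graph_layer[OF 2(1), of i] by (auto simp: d_graph_def edges_layer)
    then show "f \<in> {{}}" using finite_subset by fastforce
  qed
  then have "lay i (edges H) \<noteq> {} \<Longrightarrow> lay j (edges H) \<subseteq> lay i (edges H)" for i j by blast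
  then show ?case by simp
next
  case (3 n H)
  note sub = d_graph_edges[OF 3(2)]
  have "nested_layers (Suc n) (lay v (edges H))" for v
  proof (cases "v \<in> verts H")
    case True
    then show ?thesis using 3(1)[OF True d_graph_layer[OF 3(2)]] 3(3) by (simp add: edges_layer)
  next
    case False
    then have "lay v (edges H) = {}" using lay_nonempty_mem[OF sub] by blast
    moreover have "nested_layers m {}" for m by (induction m) auto
    ultimately show ?thesis by metis
  qed
  moreover have "lay j (edges H) \<subseteq> lay i (edges H)" if "i < j" "lay i (edges H) \<noteq> {}" for i j
  proof (cases "j \<in> verts H")
    case True
    then show ?thesis using 3(3) that lay_nonempty_mem[OF sub that(2)] by (simp add: edges_layer)
  next
    case False
    then show ?thesis using lay_nonempty_mem[OF sub, of j] by blast
  qed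
  ultimately show ?case unfolding nested_layers.simps(2)[of "Suc n"] by blast
qed auto

lemma cells_alt:
  "cells d H = {\<sigma>. length \<sigma> = d \<and> (\<forall>A\<in>set \<sigma>. A \<noteq> {} \<and> A \<subseteq> verts H) \<and>
     sorted_wrt (\<lambda>A B. \<forall>s\<in>A. \<forall>t\<in>B. s < t) \<sigma> \<and>
     (\<forall>vs. list_all2 (\<in>) vs \<sigma> \<longrightarrow> set vs \<in> edges H)}"
  unfolding cells_def list_all2_conv_all_nth all_set_conv_all_nth by auto

lemma transversal_exists:
  assumes "\<forall>A\<in>set \<sigma>. A \<noteq> {}" shows "\<exists>vs. list_all2 (\<in>) vs \<sigma>"
  using assms
proof (induction \<sigma>)
  case (Cons A \<sigma>)
  then obtain v vs where "v \<in> A" "list_all2 (\<in>) vs \<sigma>" by auto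
  then have "list_all2 (\<in>) (v # vs) (A # \<sigma>)" by simp
  then show ?case by blast
qed auto

text \<open>Lets facts about a single vertex be read off from one edge:
  \<open>Cons_mem_cells\<close> recovers the order of the factors this way,
  \<open>lcm_labeled\<close> the exponent of one variable.\<close>

lemma transversal_through:
  assumes "\<forall>A\<in>set \<sigma>. A \<noteq> {}" "B \<in> set \<sigma>" "t \<in> B"
  shows "\<exists>vs. list_all2 (\<in>) vs \<sigma> \<and> t \<in> set vs"
  using assms
proof (induction \<sigma>)
  case (Cons A \<sigma>)
  obtain v where v: "v \<in> A" using Cons.prems by auto
  show ?case
  proof (cases "B = A")
    case True
    obtain vs where "list_all2 (\<in>) vs \<sigma>" using transversal_exists Cons.prems by (metis list.set_intros(2))
    then have "list_all2 (\<in>) (t # vs) (A # \<sigma>)" using True Cons.prems by simp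
    then show ?thesis by (metis list.set_intros(1))
  next
    case False
    then obtain vs where "list_all2 (\<in>) vs \<sigma>" "t \<in> set vs" using Cons by auto
    then have "list_all2 (\<in>) (v # vs) (A # \<sigma>) \<and> t \<in> set (v # vs)" using v by simp
    then show ?thesis by blast
  qed
qed auto

text \<open>From right to left, the order between A and the tail as well as
  \<open>A \<subseteq> verts H\<close> have to be recovered. Both follow from edges obtained as
  transversals, because a layer only contains vertices beyond its own.\<close>

lemma Cons_mem_cells:
  assumes H: "d_graph (Suc n) H"
  shows "A # \<tau> \<in> cells (Suc n) H \<longleftrightarrow>
    finite A \<and> A \<noteq> {} \<and> (\<forall>v\<in>A. \<tau> \<in> cells n (layer v H))" (is "?L \<longleftrightarrow> ?R")
proof
  assume L: ?L
  then have A: "A \<noteq> {}" "A \<subseteq> verts H" and \<tau>: "length \<tau> = n" "\<And>B. B \<in> set \<tau> \<Longrightarrow> B \<noteq> {} \<and> B \<subseteq> verts H"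
    and lt: "\<And>B s t. B \<in> set \<tau> \<Longrightarrow> s \<in> A \<Longrightarrow> t \<in> B \<Longrightarrow> s < t"
    and sorted: "sorted_wrt (\<lambda>A B. \<forall>s\<in>A. \<forall>t\<in>B. s < t) \<tau>"
    and E: "\<And>vs. list_all2 (\<in>) vs (A # \<tau>) \<Longrightarrow> set vs \<in> edges H"
    unfolding cells_alt by auto
  have "finite A" using A H finite_subset by (auto simp: d_graph_def)
  moreover have "\<tau> \<in> cells n (layer v H)" if v: "v \<in> A" for v
  proof -
    have "set vs \<in> lay v (edges H)" if vs: "list_all2 (\<in>) vs \<tau>" for vs
    proof -
      have "list_all2 (\<in>) (v # vs) (A # \<tau>)" using vs v by simp
      from E[OF this] have "insert v (set vs) \<in> edges H" by simp
      moreover have "v < w" if w: "w \<in> set vs" for w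
      proof -
        obtain i where i: "i < length vs" "vs ! i = w" using w by (auto simp: in_set_conv_nth)
        then have "w \<in> \<tau> ! i" "\<tau> ! i \<in> set \<tau>" using vs by (auto simp: list_all2_conv_all_nth)
        then show ?thesis using lt v by blast
      qed
      ultimately show ?thesis by (simp add: lay_def)
    qed
    moreover have "B \<subseteq> verts H - {v}" if "B \<in> set \<tau>" for B
      using \<tau>(2)[OF that] lt[OF that v] by blast
    ultimately show ?thesis unfolding cells_alt using \<tau> sorted by (auto simp: edges_layer verts_layer)
  qed
  ultimately show ?R using A by blast
next
  assume R: ?R
  then obtain v0 where v0: "v0 \<in> A" by blast
  have \<tau>: "length \<tau> = n" "\<And>B. B \<in> set \<tau> \<Longrightarrow> B \<noteq> {} \<and> B \<subseteq> verts H"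
      "sorted_wrt (\<lambda>A B. \<forall>s\<in>A. \<forall>t\<in>B. s < t) \<tau>"
    using R v0 unfolding cells_alt by (auto simp: verts_layer)
  have E: "set vs \<in> lay v (edges H)" if "v \<in> A" "list_all2 (\<in>) vs \<tau>" for v vs
    using R that unfolding cells_alt by (auto simp: edges_layer)
  have "s < t" if s: "s \<in> A" and t: "B \<in> set \<tau>" "t \<in> B" for s t B
  proof -
    obtain vs where "list_all2 (\<in>) vs \<tau>" "t \<in> set vs" using transversal_through[of \<tau> B t] t \<tau>(2) by blast
    then show ?thesis using E[OF s] by (auto simp: lay_def)
  qed
  moreover have "A \<subseteq> verts H"
  proof
    fix v assume v: "v \<in> A"
    obtain vs where "list_all2 (\<in>) vs \<tau>" using transversal_exists \<tau>(2) by blast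
    from E[OF v this] show "v \<in> verts H" using d_graph_edges[OF H] by (auto simp: lay_def)
  qed
  moreover have "set vs \<in> edges H" if vs: "list_all2 (\<in>) vs (A # \<tau>)" for vs
  proof -
    obtain v ws where "vs = v # ws" "v \<in> A" "list_all2 (\<in>) ws \<tau>"
      using vs by (auto simp: list_all2_Cons2)
    then show ?thesis using E by (auto simp: lay_def)
  qed
  ultimately show ?L unfolding cells_alt using R \<tau> by auto
qed

lemma cells_eq_product_cells: "d_graph d H \<Longrightarrow> cells d H = product_cells d (edges H)"
proof (induction d arbitrary: H)
  case 0
  show ?case by (auto simp: cells_alt)
next
  case (Suc n)
  have IH: "cells n (layer v H) = product_cells n (lay v (edges H))" for v
    using Suc.IH[OF d_graph_layer[OF Suc.prems]] by (simp add: edges_layer)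
  show ?case
  proof (rule Set.set_eqI)
    fix \<sigma>
    show "\<sigma> \<in> cells (Suc n) H \<longleftrightarrow> \<sigma> \<in> product_cells (Suc n) (edges H)"
    proof (cases \<sigma>)
      case Nil
      then show ?thesis by (auto simp: cells_def)
    next
      case (Cons A \<tau>)
      then show ?thesis using Cons_mem_cells[OF Suc.prems, of A \<tau>] IH by simp
    qed
  qed
qed

lemma product_sign_Nil [simp]: "product_sign [] \<tau> = 0"
  by (simp add: product_sign_def)

text \<open>The Leibniz rule for a product of cells, split at the first factor: a facet either
  changes that factor and keeps the tail, or keeps it and contributes the sign of its
  dimension.\<close>

lemma product_sign_Cons:
  "product_sign (A # \<rho>) (B # \<tau>) =
     (if \<rho> = \<tau> then \<Sum>v\<in>A. if B = A - {v} then (-1) ^ card {u \<in> A. u < v} else 0 else 0) +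
     (if A = B then (-1) ^ (card A - 1) * product_sign \<rho> \<tau> else 0)"
proof -
  have 1: "(\<Sum>v\<in>A. if B # \<tau> = (A - {v}) # \<rho> then (-1) ^ card {u \<in> A. u < v} else 0) =
     (if \<rho> = \<tau> then \<Sum>v\<in>A. if B = A - {v} then (-1) ^ card {u \<in> A. u < v} else 0 else (0::int))"
    by auto
  have 2: "(\<Sum>i<length \<rho>. \<Sum>v\<in>\<rho> ! i. if B # \<tau> = A # \<rho>[i := \<rho> ! i - {v}]
        then (-1) ^ (card A - 1 + cell_dim (take i \<rho>) + card {u \<in> \<rho> ! i. u < v}) else 0) =
     (if A = B then (-1) ^ (card A - 1) * product_sign \<rho> \<tau> else (0::int))"
    unfolding product_sign_def sum_distrib_left
    by (auto intro!: sum.cong simp: power_add mult.assoc)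
  show ?thesis unfolding 1[symmetric] 2[symmetric] product_sign_def[of "A # \<rho>"]
    by (simp add: sum.lessThan_Suc_shift cell_dim_Cons cell_dim_def del: sum.lessThan_Suc cong: if_cong)
qed

text \<open>Connects the recursion over cofaces in \<open>bd\<close> with the pairwise signs of the
  cell complex. Summing over all lists of subsets rather than over cells lets the sum split along
  its first entry. The factors of \<tau> are nonempty because \<open>bd\<close> vanishes otherwise,
  whereas \<open>product_sign\<close> also counts the removal of the last vertex of a
  factor.\<close>

lemma bd_eq_sum_product_sign:
  fixes x :: "cell \<Rightarrow> 'k::comm_ring_1"
  assumes "finite U"
  shows "\<forall>B\<in>set \<tau>. B \<noteq> {} \<and> B \<subseteq> U \<Longrightarrow>
    (\<Sum>\<sigma> | set \<sigma> \<subseteq> Pow U \<and> length \<sigma> = length \<tau>. x \<sigma> * of_int (product_sign \<sigma> \<tau>)) = bd U \<tau> x"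
proof (induction \<tau> arbitrary: x)
  case Nil
  then show ?case by (simp cong: conj_cong)
next
  case (Cons B \<tau>)
  let ?L = "{\<sigma>. set \<sigma> \<subseteq> Pow U \<and> length \<sigma> = length \<tau>}"
  have finL: "finite ?L" using assms by (intro finite_lists_length_eq) auto
  have B: "finite B" "B \<noteq> {}" "B \<subseteq> U" using Cons.prems assms finite_subset by auto
  have \<tau>: "\<tau> \<in> ?L" using Cons.prems by auto
  have L: "{\<sigma>. set \<sigma> \<subseteq> Pow U \<and> length \<sigma> = length (B # \<tau>)} = (\<lambda>(A, \<rho>). A # \<rho>) ` (Pow U \<times> ?L)"
    by (auto simp: length_Suc_conv image_iff subset_iff)
  have inj: "inj_on (\<lambda>(A, \<rho>). A # \<rho>) (Pow U \<times> ?L)" by (auto simp: inj_on_def)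
  define t where "t A = (\<Sum>v\<in>A. if B = A - {v} then (-1) ^ card {u \<in> A. u < v} else (0::int))" for A
  have "(\<Sum>\<sigma> | set \<sigma> \<subseteq> Pow U \<and> length \<sigma> = length (B # \<tau>). x \<sigma> * of_int (product_sign \<sigma> (B # \<tau>))) =
      (\<Sum>A\<in>Pow U. \<Sum>\<rho>\<in>?L. x (A # \<rho>) * of_int (product_sign (A # \<rho>) (B # \<tau>)))"
    unfolding L by (subst sum.reindex[OF inj]) (simp add: sum.cartesian_product split_def)
  also have "\<dots> = (\<Sum>A\<in>Pow U. \<Sum>\<rho>\<in>?L. (if \<rho> = \<tau> then x (A # \<rho>) * of_int (t A) else 0)) +
      (\<Sum>A\<in>Pow U. if A = B then (\<Sum>\<rho>\<in>?L. (-1) ^ (card A - 1) * (x (A # \<rho>) * of_int (product_sign \<rho> \<tau>))) else 0)"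
  proof -
    have "x (A # \<rho>) * of_int (product_sign (A # \<rho>) (B # \<tau>)) =
        (if \<rho> = \<tau> then x (A # \<rho>) * of_int (t A) else 0) +
        (if A = B then (-1) ^ (card A - 1) * (x (A # \<rho>) * of_int (product_sign \<rho> \<tau>)) else 0)" for A \<rho>
      by (cases "\<rho> = \<tau>"; cases "A = B")
         (simp_all only: product_sign_Cons t_def if_True if_False simp_thms, simp_all add: algebra_simps)
    moreover have "(\<Sum>\<rho>\<in>?L. (if A = B then f \<rho> else 0)) = (if A = B then sum f ?L else 0)"
      for A and f :: "cell \<Rightarrow> 'k" by simp
    ultimately show ?thesis by (simp only: sum.distrib)
  qed
  also have "(\<Sum>A\<in>Pow U. \<Sum>\<rho>\<in>?L. (if \<rho> = \<tau> then x (A # \<rho>) * of_int (t A) else 0)) =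
      (\<Sum>A\<in>Pow U. x (A # \<tau>) * of_int (t A))"
    using finL \<tau> by (simp add: sum.delta)
  also have "\<dots> = (\<Sum>A\<in>Pow U. \<Sum>v\<in>U. if v \<in> A \<and> B = A - {v} then x (A # \<tau>) * (-1) ^ card {u \<in> A. u < v} else 0)"
  proof (rule sum.cong[OF refl])
    fix A assume A: "A \<in> Pow U"
    have "t A = (\<Sum>v\<in>U. if v \<in> A \<and> B = A - {v} then (-1) ^ card {u \<in> A. u < v} else 0)"
      unfolding t_def using A assms by (intro sum.mono_neutral_cong_left) auto
    then show "x (A # \<tau>) * of_int (t A) =
        (\<Sum>v\<in>U. if v \<in> A \<and> B = A - {v} then x (A # \<tau>) * (-1) ^ card {u \<in> A. u < v} else 0)"
      by (simp add: sum_distrib_left) (intro sum.cong, auto)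
  qed
  \<comment> \<open>Once v is fixed, the only possible A is \<open>insert v B\<close>, and only if v
    is not in B.\<close>
  also have "\<dots> = (\<Sum>v\<in>U. \<Sum>A\<in>Pow U. if v \<in> A \<and> B = A - {v} then x (A # \<tau>) * (-1) ^ card {u \<in> A. u < v} else 0)"
    by (rule sum.swap)
  also have "\<dots> = (\<Sum>v\<in>U. if v \<in> B then 0 else sg v B * x (insert v B # \<tau>))"
  proof (rule sum.cong[OF refl])
    fix v assume v: "v \<in> U"
    have eq: "v \<in> A \<and> B = A - {v} \<longleftrightarrow> v \<notin> B \<and> A = insert v B" for A by auto
    have c: "{u \<in> insert v B. u < v} = {u \<in> B. u < v}" by auto
    show "(\<Sum>A\<in>Pow U. if v \<in> A \<and> B = A - {v} then x (A # \<tau>) * (-1) ^ card {u \<in> A. u < v} else 0) =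
        (if v \<in> B then 0 else sg v B * x (insert v B # \<tau>))"
    proof (cases "v \<in> B")
      case False
      have "(\<Sum>A\<in>Pow U. if v \<in> A \<and> B = A - {v} then x (A # \<tau>) * (-1) ^ card {u \<in> A. u < v} else 0) =
          (\<Sum>A\<in>Pow U. if A = insert v B then x (A # \<tau>) * (-1) ^ card {u \<in> A. u < v} else 0)"
        unfolding eq using False by simp
      also have "\<dots> = sg v B * x (insert v B # \<tau>)"
        using assms v B by (simp add: sum.delta c sg_def mult.commute del: insert_iff)
      finally show ?thesis using False by simp
    qed (simp add: eq)
  qed
  also have "\<dots> = (\<Sum>v\<in>U - B. sg v B * x (insert v B # \<tau>))"
    using assms by (intro sum.mono_neutral_cong_right) auto
  also have "(\<Sum>A\<in>Pow U. if A = B then (\<Sum>\<rho>\<in>?L. (-1) ^ (card A - 1) * (x (A # \<rho>) * of_int (product_sign \<rho> \<tau>))) else 0) =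
      (-1) ^ (card B - 1) * bd U \<tau> (\<lambda>\<rho>. x (B # \<rho>))"
    using assms B Cons.IH[of "\<lambda>\<rho>. x (B # \<rho>)"] Cons.prems
    by (simp add: sum.delta sum_distrib_left[symmetric])
  finally show ?case using B by simp
qed

section \<open>Multigraded resolutions of monomial ideals\<close>

definition expo_le :: "expo \<Rightarrow> expo \<Rightarrow> bool" where
  "expo_le m m' \<longleftrightarrow> (\<forall>v. lookup m v \<le> lookup m' v)"

text \<open>Membership is a condition on each monomial separately, so it can be tested one
  multidegree at a time. \<open>genideal_monomials\<close> shows that this is the ideal generated by
  the monomials in M.\<close>

definition monomial_ideal :: "int set \<Rightarrow> expo set \<Rightarrow> 'k::field mpoly set" where
  "monomial_ideal V M =
     {p \<in> carrier (poly_ring V). \<forall>m\<in>keys p. \<exists>e\<in>M. expo_le e m}"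

lemma expo_add_diff: "expo_le m m' \<Longrightarrow> m + (m' - m) = m'"
  by (rule poly_mapping_eqI) (simp add: expo_le_def lookup_add lookup_minus)

lemma expo_le_refl [simp]: "expo_le m m"
  by (simp add: expo_le_def)

lemma expo_le_trans: "expo_le a b \<Longrightarrow> expo_le b c \<Longrightarrow> expo_le a c"
  unfolding expo_le_def using order_trans by blast

lemma expo_le_add [simp]: "expo_le m (k + m)" "expo_le m (m + k)"
  by (simp_all add: expo_le_def lookup_add)

lemma keys_expo_add: "keys (a + b :: expo) = keys a \<union> keys b"
  by (auto simp: in_keys_iff lookup_add)

lemma keys_expo_le: "expo_le a b \<Longrightarrow> keys a \<subseteq> keys b"
  unfolding expo_le_def in_keys_iff subset_iff by (metis le_zero_eq)

lemma poly_ring_carrier: "p \<in> carrier (poly_ring V) \<longleftrightarrow> (\<forall>m\<in>keys p. keys m \<subseteq> V)"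
  by (simp add: poly_ring_def)

lemma poly_ring_ops [simp]:
  "x \<oplus>\<^bsub>poly_ring V\<^esub> y = x + y" "x \<otimes>\<^bsub>poly_ring V\<^esub> y = x * y"
  "\<zero>\<^bsub>poly_ring V\<^esub> = 0" "\<one>\<^bsub>poly_ring V\<^esub> = 1"
  by (simp_all add: poly_ring_def)

lemma poly_ring_zero: "0 \<in> carrier (poly_ring V)"
  by (simp add: poly_ring_carrier)

lemma poly_ring_one: "1 \<in> carrier (poly_ring V)"
  by (simp add: poly_ring_carrier)

lemma poly_ring_add: "p \<in> carrier (poly_ring V) \<Longrightarrow> q \<in> carrier (poly_ring V) \<Longrightarrow> p + q \<in> carrier (poly_ring V)"
  unfolding poly_ring_carrier using keys_add[of p q] by blast

lemma poly_ring_uminus: "p \<in> carrier (poly_ring V) \<Longrightarrow> - p \<in> carrier (poly_ring V)"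
  by (simp add: poly_ring_carrier)

lemma poly_ring_mult:
  assumes "p \<in> carrier (poly_ring V)" "q \<in> carrier (poly_ring V)" shows "p * q \<in> carrier (poly_ring V)"
  unfolding poly_ring_carrier
proof
  fix m assume "m \<in> keys (p * q)"
  then obtain a b where "m = a + b" "a \<in> keys p" "b \<in> keys q"
    using keys_mult[of p q] by auto
  then show "keys m \<subseteq> V" using assms by (auto simp: poly_ring_carrier keys_expo_add)
qed

lemma poly_ring_sum: "(\<And>i. i \<in> I \<Longrightarrow> p i \<in> carrier (poly_ring V)) \<Longrightarrow> sum p I \<in> carrier (poly_ring V)"
  by (induction I rule: infinite_finite_induct) (auto intro: poly_ring_zero poly_ring_add)

lemma poly_ring_single: "keys m \<subseteq> V \<Longrightarrow> single m c \<in> carrier (poly_ring V)"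
  by (simp add: poly_ring_carrier)

lemma ring_poly_ring: "ring (poly_ring V :: 'k::field mpoly ring)"
proof (rule ringI)
  show "abelian_group (poly_ring V :: 'k mpoly ring)"
  proof (rule abelian_groupI)
    fix x :: "'k mpoly" assume x: "x \<in> carrier (poly_ring V)"
    then show "\<exists>y\<in>carrier (poly_ring V). y \<oplus>\<^bsub>poly_ring V\<^esub> x = \<zero>\<^bsub>poly_ring V\<^esub>"
      using poly_ring_uminus[OF x] by (intro bexI[of _ "- x"]) auto
  qed (auto intro: poly_ring_add poly_ring_zero simp: add.assoc add.commute)
  show "monoid (poly_ring V :: 'k mpoly ring)"
    by (rule monoidI) (auto intro: poly_ring_mult poly_ring_one simp: mult.assoc)
qed (auto simp: algebra_simps)

lemma sum_singles:
  "(\<Sum>m\<in>keys p. single m (lookup p m)) = (p :: 'k::field mpoly)"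
proof (rule poly_mapping_eqI)
  fix k
  have "lookup (\<Sum>m\<in>keys p. single m (lookup p m)) k =
      (\<Sum>m\<in>keys p. if m = k then lookup p m else 0)"
    unfolding lookup_sum by (rule sum.cong) (auto simp: lookup_single when_def)
  also have "\<dots> = lookup p k"
    by (simp add: sum.delta in_keys_iff)
  finally show "lookup (\<Sum>m\<in>keys p. single m (lookup p m)) k
      = lookup p k" .
qed

lemma monomial_ideal_add:
  "p \<in> monomial_ideal V M \<Longrightarrow> q \<in> monomial_ideal V M \<Longrightarrow> p + q \<in> monomial_ideal V M"
  using poly_ring_add[of p V q] keys_add[of p q] unfolding monomial_ideal_def by blast

lemma ideal_monomial_ideal: "ideal (monomial_ideal V M :: 'k::field mpoly set) (poly_ring V)"
proof (rule idealI[OF ring_poly_ring])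
  have uminus: "\<ominus>\<^bsub>poly_ring V\<^esub> a = - a" if "a \<in> carrier (poly_ring V)" for a :: "'k mpoly"
  proof -
    interpret ring "poly_ring V :: 'k mpoly ring" by (rule ring_poly_ring)
    have "- a \<in> carrier (poly_ring V)" "- a \<oplus>\<^bsub>poly_ring V\<^esub> a = \<zero>\<^bsub>poly_ring V\<^esub>"
      using poly_ring_uminus[OF that] by auto
    then show ?thesis using that minus_equality by metis
  qed
  show "subgroup (monomial_ideal V M) (add_monoid (poly_ring V :: 'k mpoly ring))"
  proof (unfold_locales)
    show "monomial_ideal V M \<subseteq> carrier (add_monoid (poly_ring V :: 'k mpoly ring))"
      by (auto simp: monomial_ideal_def)
    show "x \<otimes>\<^bsub>add_monoid (poly_ring V)\<^esub> y \<in> monomial_ideal V M"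
      if "x \<in> monomial_ideal V M" "y \<in> monomial_ideal V M" for x y :: "'k mpoly"
      using monomial_ideal_add[OF that] by simp
    show "\<one>\<^bsub>add_monoid (poly_ring V)\<^esub> \<in> (monomial_ideal V M :: 'k mpoly set)"
      by (simp add: monomial_ideal_def poly_ring_zero)
    show "inv\<^bsub>add_monoid (poly_ring V)\<^esub> x \<in> monomial_ideal V M" if "x \<in> monomial_ideal V M" for x :: "'k mpoly"
      unfolding a_inv_def[symmetric] using that uminus[of x] poly_ring_uminus[of x V]
      by (simp add: monomial_ideal_def)
  qed
  have mult: "x * a \<in> monomial_ideal V M"
    if a: "a \<in> monomial_ideal V M" and x: "x \<in> carrier (poly_ring V)" for a x :: "'k mpoly"
  proof -
    have "\<exists>e\<in>M. expo_le e m" if m: "m \<in> keys (x * a)" for m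
    proof -
      obtain k l where "m = k + l" "l \<in> keys a" using m keys_mult[of x a] by auto
      moreover from this obtain e where "e \<in> M" "expo_le e l" using a by (auto simp: monomial_ideal_def)
      ultimately show ?thesis using expo_le_trans expo_le_add(1)[of l k] by blast
    qed
    then show ?thesis using poly_ring_mult[of x V a] a x by (simp add: monomial_ideal_def)
  qed
  show "x \<otimes>\<^bsub>poly_ring V\<^esub> a \<in> monomial_ideal V M"
    if "a \<in> monomial_ideal V M" "x \<in> carrier (poly_ring V)" for a x :: "'k mpoly"
    using mult[OF that] by simp
  show "a \<otimes>\<^bsub>poly_ring V\<^esub> x \<in> monomial_ideal V M"
    if "a \<in> monomial_ideal V M" "x \<in> carrier (poly_ring V)" for a x :: "'k mpoly"
    using mult[OF that] by (simp add: mult.commute)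
qed

lemma genideal_monomials:
  assumes "\<And>m. m \<in> M \<Longrightarrow> keys m \<subseteq> V"
  shows "genideal (poly_ring V) ((\<lambda>m. single m 1) ` M) = (monomial_ideal V M :: 'k::field mpoly set)"
    (is "genideal _ ?G = _")
proof
  interpret ring "poly_ring V :: 'k mpoly ring" by (rule ring_poly_ring)
  have G: "?G \<subseteq> carrier (poly_ring V)" using assms by (auto intro!: poly_ring_single)
  show "genideal (poly_ring V) ?G \<subseteq> monomial_ideal V M"
  proof (rule genideal_minimal[OF ideal_monomial_ideal], rule image_subsetI)
    fix m assume "m \<in> M"
    moreover from this have "\<exists>e\<in>M. expo_le e m" using expo_le_refl by blast
    ultimately show "single m 1 \<in> (monomial_ideal V M :: 'k mpoly set)"
      using poly_ring_single[OF assms] by (auto simp: monomial_ideal_def)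
  qed
  show "monomial_ideal V M \<subseteq> genideal (poly_ring V) ?G"
  proof
    fix p :: "'k mpoly" assume p: "p \<in> monomial_ideal V M"
    interpret I: ideal "genideal (poly_ring V) ?G" "poly_ring V" by (rule genideal_ideal[OF G])
    have add: "a + b \<in> genideal (poly_ring V) ?G"
      if "a \<in> genideal (poly_ring V) ?G" "b \<in> genideal (poly_ring V) ?G" for a b
      using I.a_closed[OF that] by simp
    have zero: "0 \<in> genideal (poly_ring V) ?G" using I.zero_closed by simp
    have mon: "single m (lookup p m) \<in> genideal (poly_ring V) ?G"
      if m: "m \<in> keys p" for m
    proof -
      obtain e where e: "e \<in> M" "expo_le e m" using p m by (auto simp: monomial_ideal_def)
      have "keys m \<subseteq> V" using p m by (auto simp: monomial_ideal_def poly_ring_carrier)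
      moreover have "expo_le (m - e) m" by (simp add: expo_le_def lookup_minus)
      ultimately have c: "single (m - e) (lookup p m) \<in> carrier (poly_ring V)"
        using keys_expo_le poly_ring_single by blast
      have "single e 1 \<in> genideal (poly_ring V) ?G"
        using genideal_self[OF G] e by blast
      from I.I_l_closed[OF this c] show ?thesis
        using expo_add_diff[OF e(2)] by (simp add: mult_single add.commute)
    qed
    have "sum f K \<in> genideal (poly_ring V) ?G" if "\<And>m. m \<in> K \<Longrightarrow> f m \<in> genideal (poly_ring V) ?G"
      for f :: "expo \<Rightarrow> 'k mpoly" and K
      using that by (induction K rule: infinite_finite_induct) (auto intro: zero add)
    from this[of "keys p" "\<lambda>m. single m (lookup p m)"] mon
    show "p \<in> genideal (poly_ring V) ?G" by (simp add: sum_singles)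
  qed
qed

lemma irrelevant_ideal_eq:
  "irrelevant_ideal V = (monomial_ideal V ((\<lambda>v. single v 1) ` V) :: 'k::field mpoly set)"
proof -
  have "var ` V = (\<lambda>m. single m (1::'k)) ` ((\<lambda>v. single v 1) ` V)"
    by (auto simp: var_def)
  then show ?thesis unfolding irrelevant_ideal_def by (simp only:) (rule genideal_monomials, auto)
qed

lemma prod_var: "(\<Prod>v\<in>e. var v) = single (squarefree_expo e) 1"
proof (induction e rule: infinite_finite_induct)
  case (insert v e)
  then show ?case by (simp add: squarefree_expo_def var_def mult_single)
qed (auto simp: squarefree_expo_def)

lemma lookup_squarefree_expo:
  "finite A \<Longrightarrow> lookup (squarefree_expo A) v = (if v \<in> A then 1 else 0)"
  by (auto simp: squarefree_expo_def lookup_sum lookup_single when_def sum.delta)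

lemma keys_squarefree_expo: "finite A \<Longrightarrow> keys (squarefree_expo A) = A"
  by (auto simp: in_keys_iff lookup_squarefree_expo split: if_splits)

lemma edge_ideal_eq:
  assumes "finite (verts H)" "edges H \<subseteq> Pow (verts H)"
  shows "edge_ideal H = (monomial_ideal (verts H) (squarefree_expo ` edges H) :: 'k::field mpoly set)"
proof -
  have fin: "e \<in> edges H \<Longrightarrow> finite e" for e using assms finite_subset by blast
  have "{\<Prod>v\<in>e. var v | e. e \<in> edges H} =
      (\<lambda>m. single m (1::'k)) ` (squarefree_expo ` edges H)"
    by (auto simp: prod_var)
  then show ?thesis unfolding edge_ideal_def
    by (simp only:) (rule genideal_monomials, use fin assms(2) in \<open>auto simp: keys_squarefree_expo subset_iff\<close>)
qed

text \<open>Exponents subtract with truncation, so divisibility has to be tested explicitly.\<close>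

lemma lookup_times_single:
  "lookup (p * single t a :: 'k::field mpoly) k =
     (if expo_le t k then lookup p (k - t) * a else 0)"
proof -
  have "p * single t a =
      (\<Sum>m\<in>keys p. single (m + t) (lookup p m * a))"
    by (subst (1) sum_singles[symmetric]) (simp only: sum_distrib_right mult_single)
  then have "lookup (p * single t a) k =
      (\<Sum>m\<in>keys p. if m + t = k then lookup p m * a else 0)"
    by (simp only: lookup_sum) (auto simp: lookup_single when_def intro!: sum.cong)
  also have "\<dots> = (if expo_le t k then \<Sum>m\<in>keys p. if m = k - t then lookup p m * a else 0 else 0)"
  proof (cases "expo_le t k")
    case True
    have "m + t = k \<longleftrightarrow> m = k - t" for m using expo_add_diff[OF True] by (auto simp: add.commute)
    then show ?thesis using True by simp
  next
    case False
    then have "m + t \<noteq> k" for m using expo_le_add(1) by blast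
    then show ?thesis using False by simp
  qed
  also have "\<dots> = (if expo_le t k then lookup p (k - t) * a else 0)"
    by (simp add: sum.delta in_keys_iff)
  finally show ?thesis .
qed

section \<open>Complexes given by monomial matrices, and their strands\<close>

definition monomial_complex ::
  "(nat \<Rightarrow> 'b set) \<Rightarrow> ('b \<Rightarrow> expo) \<Rightarrow> ('b \<Rightarrow> 'b \<Rightarrow> 'k::field) \<Rightarrow> ('b, 'k mpoly) graded_complex" where
  "monomial_complex B lab s =
     \<lparr>gens = B, gdeg = (\<lambda>i b v. int (lookup (lab b) v)),
      bdry = (\<lambda>i x c. \<Sum>b\<in>B (Suc i). x b * single (lab b - lab c) (s b c)),
      augm = (\<lambda>x. \<Sum>b\<in>B 0. x b * single (lab b) 1)\<rparr>"

text \<open>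
  The monomial \<open>m\<close> picks out of each coefficient \<open>y b\<close> the scalar at \<open>m / lab b\<close>; this is the
  part of a chain in multidegree \<open>m\<close>.
\<close>

definition strand :: "('b \<Rightarrow> expo) \<Rightarrow> expo \<Rightarrow> ('b \<Rightarrow> 'k::field mpoly) \<Rightarrow> 'b \<Rightarrow> 'k" where
  "strand lab m y b = (if expo_le (lab b) m then lookup (y b) (m - lab b) else 0)"

lemma strand_eqI:
  assumes "\<And>m. strand lab m x = strand lab m y" shows "x = y"
proof
  fix b
  show "x b = y b"
  proof (rule poly_mapping_eqI)
    fix k
    have "strand lab (k + lab b) x b = strand lab (k + lab b) y b" using assms by simp
    then show "lookup (x b) k = lookup (y b) k" by (simp add: strand_def)
  qed
qed

lemma strand_zero [simp]: "strand lab m (\<lambda>b. 0) = (\<lambda>b. 0)"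
  by (auto simp: strand_def)

lemma finite_strands:
  assumes "finite K" "\<And>b. b \<notin> K \<Longrightarrow> x b = 0"
  shows "finite {m. strand lab m x \<noteq> (\<lambda>b. 0)}"
proof (rule finite_subset)
  show "{m. strand lab m x \<noteq> (\<lambda>b. 0)} \<subseteq> (\<Union>b\<in>K. (\<lambda>k. k + lab b) ` keys (x b))"
  proof
    fix m assume "m \<in> {m. strand lab m x \<noteq> (\<lambda>b. 0)}"
    then obtain b where b: "strand lab m x b \<noteq> 0" by auto
    then have le: "expo_le (lab b) m" and nz: "lookup (x b) (m - lab b) \<noteq> 0"
      by (auto simp: strand_def split: if_splits)
    have "b \<in> K" using nz assms(2)[of b] by (metis lookup_zero)
    moreover have "m = (m - lab b) + lab b" using expo_add_diff[OF le] by (simp add: add.commute)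
    moreover have "m - lab b \<in> keys (x b)" using nz by (simp add: in_keys_iff)
    ultimately show "m \<in> (\<Union>b\<in>K. (\<lambda>k. k + lab b) ` keys (x b))" by blast
  qed
qed (use assms in auto)

text \<open>Strands can be prescribed freely, as long as b only occurs in multidegrees divisible by
  its label. Finiteness of F makes each coefficient a polynomial.\<close>

lemma strands_realizable:
  fixes w :: "expo \<Rightarrow> 'b \<Rightarrow> 'k::field"
  assumes "finite F" "\<And>m b. w m b \<noteq> 0 \<Longrightarrow> m \<in> F \<and> expo_le (lab b) m"
  obtains y where "\<And>m. strand lab m y = w m"
proof -
  define y where "y b = Abs_poly_mapping (\<lambda>k. w (k + lab b) b)" for b
  have look: "lookup (y b) k = w (k + lab b) b" for b k
  proof -
    have "{k. w (k + lab b) b \<noteq> 0} \<subseteq> (\<lambda>k. k + lab b) -` F" using assms(2) by auto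
    moreover have "finite ((\<lambda>k. k + lab b) -` F)"
      by (rule finite_vimageI) (use assms in \<open>auto simp: inj_on_def\<close>)
    ultimately have "finite {k. w (k + lab b) b \<noteq> 0}" by (rule finite_subset)
    then show ?thesis by (simp add: y_def)
  qed
  have "strand lab m y b = w m b" for m b
  proof (cases "expo_le (lab b) m")
    case True
    then show ?thesis using expo_add_diff[OF True] by (simp add: strand_def look add.commute)
  next
    case False
    then have "w m b = 0" using assms(2) by blast
    then show ?thesis using False by (simp add: strand_def)
  qed
  then show ?thesis using that by blast
qed

lemma strand_nonzeroD:
  "strand lab m x b \<noteq> 0 \<Longrightarrow> expo_le (lab b) m \<and> m - lab b \<in> keys (x b)"
  by (auto simp: strand_def in_keys_iff split: if_splits)

lemma free_module_carrier:
  "finite B \<Longrightarrow> x \<in> carrier (free_module (poly_ring V) B) \<longleftrightarrow>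
    (\<forall>b\<in>B. x b \<in> carrier (poly_ring V)) \<and> (\<forall>b. b \<notin> B \<longrightarrow> x b = 0)"
  unfolding free_module_def by (auto intro: rev_finite_subset)

text \<open>Exactness is required of the scalar complexes on the generators whose label divides m,
  one for each m. The condition that labels of a nonzero entry differ is what makes the resolution
  minimal.\<close>

locale monomial_resolution =
  fixes V :: "int set" and B :: "nat \<Rightarrow> 'b set" and lab :: "'b \<Rightarrow> expo" and s :: "'b \<Rightarrow> 'b \<Rightarrow> 'k::field"
  assumes finite_gens: "\<And>i. finite (B i)"
    and keys_lab: "\<And>i b. b \<in> B i \<Longrightarrow> keys (lab b) \<subseteq> V"
    and s_nonzero: "\<And>i b c. b \<in> B (Suc i) \<Longrightarrow> s b c \<noteq> 0 \<Longrightarrow>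
      c \<in> B i \<and> expo_le (lab c) (lab b) \<and> lab c \<noteq> lab b"
    and ss: "\<And>i b e. b \<in> B (Suc (Suc i)) \<Longrightarrow> (\<Sum>c\<in>B (Suc i). s b c * s c e) = 0"
    and s1: "\<And>b. b \<in> B 1 \<Longrightarrow> (\<Sum>c\<in>B 0. s b c) = 0"
    and exact0: "\<And>m x. supp x \<subseteq> {b \<in> B 0. expo_le (lab b) m} \<Longrightarrow> (\<Sum>b\<in>B 0. x b) = 0 \<Longrightarrow>
      \<exists>z. supp z \<subseteq> {b \<in> B 1. expo_le (lab b) m} \<and> (\<forall>c. (\<Sum>b\<in>B 1. z b * s b c) = x c)"
    and exact: "\<And>i m x. supp x \<subseteq> {b \<in> B (Suc i). expo_le (lab b) m} \<Longrightarrow>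
      (\<And>c. (\<Sum>b\<in>B (Suc i). x b * s b c) = 0) \<Longrightarrow>
      \<exists>z. supp z \<subseteq> {b \<in> B (Suc (Suc i)). expo_le (lab b) m} \<and>
        (\<forall>c. (\<Sum>b\<in>B (Suc (Suc i)). z b * s b c) = x c)"
begin

abbreviation C :: "('b, 'k mpoly) graded_complex" where
  "C \<equiv> monomial_complex B lab s"

abbreviation chains :: "nat \<Rightarrow> ('b \<Rightarrow> 'k mpoly) set" where
  "chains i \<equiv> carrier (chain_module V C i)"

lemma C_simps [simp]:
  "gens C = B"
  "gdeg C i b v = int (lookup (lab b) v)"
  "bdry C i x c = (\<Sum>b\<in>B (Suc i). x b * single (lab b - lab c) (s b c))"
  "augm C x = (\<Sum>b\<in>B 0. x b * single (lab b) 1)"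
  by (simp_all add: monomial_complex_def)

lemma chain_carrier:
  "x \<in> chains i \<longleftrightarrow>
    (\<forall>b\<in>B i. x b \<in> carrier (poly_ring V)) \<and> (\<forall>b. b \<notin> B i \<longrightarrow> x b = 0)"
  unfolding chain_module_def by (simp add: free_module_carrier finite_gens)

text \<open>Multiplication by the monomial \<open>lab b - lab c\<close> exactly compensates the
  change of label, so in a fixed multidegree the differential is the matrix s.\<close>

lemma strand_bdry:
  "strand lab m (bdry C i x) = (\<lambda>c. \<Sum>b\<in>B (Suc i). strand lab m x b * s b c)"
proof
  fix c
  have "(if expo_le (lab c) m then lookup
      (x b * single (lab b - lab c) (s b c)) (m - lab c) else 0) = strand lab m x b * s b c"
    if b: "b \<in> B (Suc i)" for b
  proof (cases "s b c = 0")
    case False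
    then have le: "expo_le (lab c) (lab b)" using s_nonzero[OF b] by blast
    show ?thesis
    proof (cases "expo_le (lab c) m")
      case True
      have "expo_le (lab b - lab c) (m - lab c) \<longleftrightarrow> expo_le (lab b) m"
        using le True unfolding expo_le_def lookup_minus
        by (metis diff_le_mono le_add_diff_inverse2 add_le_mono1 le_diff_iff)
      moreover have "m - lab c - (lab b - lab c) = m - lab b"
        using le by (intro poly_mapping_eqI) (simp add: expo_le_def lookup_minus)
      ultimately show ?thesis using True by (simp add: lookup_times_single strand_def)
    next
      case False
      then have "\<not> expo_le (lab b) m" using le expo_le_trans by blast
      then show ?thesis using False by (simp add: strand_def)
    qed
  qed auto
  then show "strand lab m (bdry C i x) c = (\<Sum>b\<in>B (Suc i). strand lab m x b * s b c)"
    unfolding strand_def[of lab m "bdry C i x"] C_simps lookup_sum if_distrib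
    by (auto intro!: sum.cong sum.neutral simp del: mult_eq_0_iff)
qed

lemma lookup_augm: "lookup (augm C x) m = (\<Sum>b\<in>B 0. strand lab m x b)"
  by (auto simp: lookup_sum lookup_times_single strand_def intro!: sum.cong)

lemma strand_keys:
  assumes "x \<in> chains i" "strand lab m x b \<noteq> 0"
  shows "b \<in> B i \<and> expo_le (lab b) m \<and> keys m \<subseteq> V"
proof -
  have le: "expo_le (lab b) m" and k: "m - lab b \<in> keys (x b)"
    using strand_nonzeroD[OF assms(2)] by auto
  then have b: "b \<in> B i" using assms(1) unfolding chain_carrier by (metis empty_iff keys_zero)
  then have "keys (m - lab b) \<subseteq> V"
    using assms(1) k by (auto simp: chain_carrier poly_ring_carrier)
  moreover have "keys m = keys (lab b) \<union> keys (m - lab b)"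
    using expo_add_diff[OF le] keys_expo_add by metis
  ultimately show ?thesis using le b keys_lab by blast
qed

lemma supp_strand:
  "x \<in> chains i \<Longrightarrow> supp (strand lab m x) \<subseteq> {b \<in> B i. expo_le (lab b) m}"
  using strand_keys by (auto simp: supp_def)

lemma chain_of_strands:
  fixes w :: "expo \<Rightarrow> 'b \<Rightarrow> 'k"
  assumes "finite F" "\<And>m b. w m b \<noteq> 0 \<Longrightarrow> m \<in> F \<and> keys m \<subseteq> V \<and> b \<in> B i \<and> expo_le (lab b) m"
  shows "\<exists>y\<in>chains i. \<forall>m. strand lab m y = w m"
proof -
  obtain y where y: "\<And>m. strand lab m y = w m"
    using strands_realizable[of F w lab] assms by blast
  have look: "lookup (y b) k = w (k + lab b) b" for b k
    using arg_cong[OF y[of "k + lab b"], of "\<lambda>f. f b"] by (simp add: strand_def)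
  have "y b = 0" if "b \<notin> B i" for b
    by (rule poly_mapping_eqI) (use look[of b] assms(2) that in auto)
  moreover have "keys k \<subseteq> V" if "k \<in> keys (y b)" for b k
  proof -
    have "w (k + lab b) b \<noteq> 0" using that look by (simp add: in_keys_iff)
    then show ?thesis using assms(2) keys_expo_add by blast
  qed
  ultimately have "y \<in> chains i" by (simp add: chain_carrier poly_ring_carrier)
  then show ?thesis using y by blast
qed

lemma chain_finite_strands:
  "x \<in> chains i \<Longrightarrow> finite {m. strand lab m x \<noteq> (\<lambda>b. 0)}"
  by (rule finite_strands[OF finite_gens[of i]]) (simp add: chain_carrier)

lemma lift_strands:
  assumes x: "x \<in> chains i"
    and ex: "\<And>m. \<exists>z. supp z \<subseteq> {b \<in> B (Suc i). expo_le (lab b) m} \<and>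
      (\<forall>c. (\<Sum>b\<in>B (Suc i). z b * s b c) = strand lab m x c)"
  shows "x \<in> bdry C i ` chains (Suc i)"
proof -
  obtain z where z: "\<And>m. supp (z m) \<subseteq> {b \<in> B (Suc i). expo_le (lab b) m}"
    "\<And>m c. (\<Sum>b\<in>B (Suc i). z m b * s b c) = strand lab m x c"
    using ex by metis
  \<comment> \<open>The chosen fillings might be nonzero in infinitely many multidegrees, or involve
    variables outside V. Resetting them to 0 where x has no part avoids both.\<close>
  define w where "w m = (if strand lab m x = (\<lambda>b. 0) then (\<lambda>b. 0) else z m)" for m
  have w: "(\<Sum>b\<in>B (Suc i). w m b * s b c) = strand lab m x c" for m c
    using z(2) by (auto simp: w_def)
  have wF: "m \<in> {m. strand lab m x \<noteq> (\<lambda>b. 0)} \<and> keys m \<subseteq> V \<and> b \<in> B (Suc i) \<and> expo_le (lab b) m"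
    if "w m b \<noteq> 0" for m b
  proof -
    have nz: "strand lab m x \<noteq> (\<lambda>b. 0)" "z m b \<noteq> 0" using that by (auto simp: w_def split: if_splits)
    then obtain b' where "strand lab m x b' \<noteq> 0" by auto
    then have "keys m \<subseteq> V" using strand_keys[OF x] by blast
    then show ?thesis using nz z(1)[of m] by (auto simp: supp_def)
  qed
  obtain y where y: "y \<in> chains (Suc i)" "\<And>m. strand lab m y = w m"
    using chain_of_strands[of _ w, OF chain_finite_strands[OF x] wF] by blast
  have "x = bdry C i y"
    by (rule strand_eqI[of lab]) (simp add: strand_bdry y w del: C_simps)
  then show ?thesis using y by blast
qed

lemma bdry_carrier:
  assumes "x \<in> chains (Suc i)" shows "bdry C i x \<in> chains i"
  unfolding chain_carrier
proof (intro conjI ballI allI impI)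
  fix c assume "c \<in> B i"
  have "keys (lab b - lab c) \<subseteq> V" if "b \<in> B (Suc i)" for b
    using keys_lab[OF that] keys_expo_le[of "lab b - lab c" "lab b"] by (auto simp: expo_le_def lookup_minus)
  then show "bdry C i x c \<in> carrier (poly_ring V)"
    using assms unfolding C_simps chain_carrier
    by (intro poly_ring_sum poly_ring_mult poly_ring_single) auto
next
  fix c assume "c \<notin> B i"
  then have "s b c = 0" if "b \<in> B (Suc i)" for b using s_nonzero[OF that] by blast
  then show "bdry C i x c = 0" by simp
qed

lemma bdry_linear: "bdry C i \<in> linear_maps (poly_ring V) (chain_module V C (Suc i)) (chain_module V C i)"
  unfolding linear_maps_def using bdry_carrier
  by (auto simp: chain_module_def free_module_def fun_eq_iff sum.distrib distrib_right
      sum_distrib_left mult.assoc simp del: C_simps(1))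

lemma augm_carrier:
  assumes "x \<in> chains 0" shows "augm C x \<in> monomial_ideal V (lab ` B 0)"
proof -
  have "\<exists>e\<in>lab ` B 0. expo_le e m \<and> keys m \<subseteq> V" if "m \<in> keys (augm C x)" for m
  proof -
    have "(\<Sum>b\<in>B 0. strand lab m x b) \<noteq> 0" using that by (simp add: in_keys_iff lookup_augm del: C_simps)
    then obtain b where "b \<in> B 0" "strand lab m x b \<noteq> 0" by (rule sum.not_neutral_contains_not_neutral)
    then show ?thesis using strand_keys[OF assms] by blast
  qed
  then show ?thesis by (auto simp: monomial_ideal_def poly_ring_carrier simp del: C_simps)
qed

lemma augm_linear:
  "augm C \<in> linear_maps (poly_ring V) (chain_module V C 0)
     (ideal_module (poly_ring V) (monomial_ideal V (lab ` B 0)))"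
  unfolding linear_maps_def using augm_carrier
  by (auto simp: chain_module_def free_module_def ideal_module_def sum.distrib distrib_right
      sum_distrib_left mult.assoc simp del: C_simps(1))

lemma augm_image: "augm C ` chains 0 = monomial_ideal V (lab ` B 0)"
proof
  show "augm C ` chains 0 \<subseteq> monomial_ideal V (lab ` B 0)"
    using augm_carrier by blast
  show "monomial_ideal V (lab ` B 0) \<subseteq> augm C ` chains 0"
  proof
    fix p :: "'k mpoly" assume p: "p \<in> monomial_ideal V (lab ` B 0)"
    then have "\<forall>m\<in>keys p. \<exists>b\<in>B 0. expo_le (lab b) m" by (auto simp: monomial_ideal_def)
    then obtain \<beta> where \<beta>: "\<And>m. m \<in> keys p \<Longrightarrow> \<beta> m \<in> B 0 \<and> expo_le (lab (\<beta> m)) m"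
      by metis
    define w where "w m b = (if m \<in> keys p \<and> b = \<beta> m then lookup p m else 0)" for m b
    have wF: "m \<in> keys p \<and> keys m \<subseteq> V \<and> b \<in> B 0 \<and> expo_le (lab b) m"
      if "w m b \<noteq> 0" for m b
      using that p \<beta> by (auto simp: w_def monomial_ideal_def poly_ring_carrier split: if_splits)
    obtain y where y: "y \<in> chains 0" "\<And>m. strand lab m y = w m"
      using chain_of_strands[of _ w, OF finite_keys[of p] wF] by blast
    have "augm C y = p"
    proof (rule poly_mapping_eqI)
      fix m
      show "lookup (augm C y) m = lookup p m"
      proof (cases "m \<in> keys p")
        case True
        then show ?thesis unfolding lookup_augm y(2) using \<beta>[OF True] finite_gens
          by (simp add: w_def sum.delta)
      next
        case False
        then show ?thesis unfolding lookup_augm y(2) by (simp add: w_def in_keys_iff)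
      qed
    qed
    then show "p \<in> augm C ` chains 0" using y by blast
  qed
qed

text \<open>A chain is determined by its strands, on which the boundary acts through s and the
  augmentation by summation. Both inclusions of exactness can therefore be checked in one
  multidegree at a time.\<close>

lemma free_resolution_C: "free_resolution V C (monomial_ideal V (lab ` B 0))"
  unfolding free_resolution_def
proof (intro conjI allI)
  show "{x \<in> chains 0. augm C x = 0} = bdry C 0 ` chains 1"
  proof (intro equalityI subsetI)
    fix x assume "x \<in> {x \<in> chains 0. augm C x = 0}"
    then have x: "x \<in> chains 0" "augm C x = 0" by auto
    have "(\<Sum>b\<in>B 0. strand lab m x b) = 0" for m
      using lookup_augm[of x m] x(2) by simp
    then show "x \<in> bdry C 0 ` chains 1"
      using exact0[OF supp_strand[OF x(1)]] lift_strands[OF x(1)] by auto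
  next
    fix x assume "x \<in> bdry C 0 ` chains 1"
    then obtain y where y: "y \<in> chains (Suc 0)" "x = bdry C 0 y" by auto
    have "lookup (augm C x) m = 0" for m
    proof -
      have "lookup (augm C x) m = (\<Sum>b\<in>B (Suc 0). strand lab m y b * (\<Sum>c\<in>B 0. s b c))"
        unfolding lookup_augm y(2) strand_bdry sum_distrib_left by (rule sum.swap)
      then show ?thesis using s1 by simp
    qed
    then have "augm C x = 0" by (intro poly_mapping_eqI) simp
    then show "x \<in> {x \<in> chains 0. augm C x = 0}" using bdry_carrier[OF y(1)] y(2) by simp
  qed
  show "{x \<in> chains (Suc i). bdry C i x = (\<lambda>b. 0)} =
      bdry C (Suc i) ` chains (Suc (Suc i))" for i
  proof (intro equalityI subsetI)
    fix x assume "x \<in> {x \<in> chains (Suc i). bdry C i x = (\<lambda>b. 0)}"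
    then have x: "x \<in> chains (Suc i)" "bdry C i x = (\<lambda>b. 0)" by auto
    have "(\<Sum>b\<in>B (Suc i). strand lab m x b * s b c) = 0" for m c
      using fun_cong[OF strand_bdry[of m i x], of c] x(2) by (simp del: C_simps)
    then show "x \<in> bdry C (Suc i) ` chains (Suc (Suc i))"
      using exact[OF supp_strand[OF x(1)]] lift_strands[OF x(1)] by blast
  next
    fix x assume "x \<in> bdry C (Suc i) ` chains (Suc (Suc i))"
    then obtain y where y: "y \<in> chains (Suc (Suc i))" "x = bdry C (Suc i) y" by auto
    have "bdry C i x = (\<lambda>b. 0)"
    proof (rule strand_eqI[of lab])
      fix m
      have "(\<Sum>c\<in>B (Suc i). (\<Sum>b\<in>B (Suc (Suc i)). strand lab m y b * s b c) * s c e) =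
          (\<Sum>b\<in>B (Suc (Suc i)). strand lab m y b * (\<Sum>c\<in>B (Suc i). s b c * s c e))" for e
        unfolding sum_distrib_left sum_distrib_right mult.assoc by (rule sum.swap)
      then show "strand lab m (bdry C i x) = strand lab m (\<lambda>b. 0)"
        unfolding strand_bdry y(2) using ss by simp
    qed
    then show "x \<in> {x \<in> chains (Suc i). bdry C i x = (\<lambda>b. 0)}"
      using bdry_carrier[OF y(1)] y(2) by simp
  qed
qed (use bdry_linear augm_linear augm_image in auto)

lemma keys_sum_times_single:
  assumes "k \<in> keys (\<Sum>b\<in>I. x b * single (t b) (a b :: 'k))"
  obtains b k' where "b \<in> I" "a b \<noteq> 0" "k' \<in> keys (x b)" "k = k' + t b"
proof -
  obtain b where b: "b \<in> I" "k \<in> keys (x b * single (t b) (a b))"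
    using subsetD[OF keys_sum assms] by auto
  then obtain k' l where "k = k' + l" "k' \<in> keys (x b)"
      "l \<in> keys (single (t b) (a b))"
    using subsetD[OF keys_mult b(2)] by auto
  then show ?thesis using that b(1) by (auto split: if_splits)
qed

theorem minimal_resolution:
  "minimal_graded_free_resolution V C (monomial_ideal V (lab ` B 0))"
  unfolding minimal_graded_free_resolution_def graded_free_resolution_def
proof (intro conjI allI ballI impI)
  show "gdeg C i b v = 0" if "b \<in> gens C i" "v \<notin> V" for i b v
    using keys_lab[of b i] that by (auto simp: in_keys_iff)
  show "homogeneous_chain C i \<gamma> (bdry C i x)" if "homogeneous_chain C (Suc i) \<gamma> x" for i \<gamma> x
    unfolding homogeneous_chain_def homogeneous_def
  proof (intro ballI allI)
    fix c k v assume "k \<in> keys (bdry C i x c)"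
    then obtain b k' where b: "b \<in> B (Suc i)" "s b c \<noteq> 0" "k' \<in> keys (x b)"
        "k = k' + (lab b - lab c)"
      unfolding C_simps by (rule keys_sum_times_single)
    have "int (lookup k' v) = \<gamma> v - int (lookup (lab b) v)"
      using that b by (simp add: homogeneous_chain_def homogeneous_def)
    moreover have "lookup (lab c) v \<le> lookup (lab b) v"
      using s_nonzero[OF b(1,2)] by (simp add: expo_le_def)
    ultimately show "int (lookup k v) = \<gamma> v - gdeg C i c v"
      unfolding b(4) C_simps lookup_add lookup_minus by linarith
  qed
  show "homogeneous \<gamma> (augm C x)" if "homogeneous_chain C 0 \<gamma> x" for \<gamma> x
    unfolding homogeneous_def
  proof (intro ballI allI)
    fix k v assume "k \<in> keys (augm C x)"
    then obtain b k' where b: "b \<in> B 0" "k' \<in> keys (x b)" "k = k' + lab b"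
      unfolding C_simps by (rule keys_sum_times_single)
    then show "int (lookup k v) = \<gamma> v"
      using that by (simp add: homogeneous_chain_def homogeneous_def lookup_add)
  qed
  show "minimal_complex V C"
    unfolding minimal_complex_def irrelevant_ideal_eq
  proof (intro allI ballI)
    fix i x c assume x: "x \<in> chains (Suc i)" and c: "c \<in> gens C i"
    have "\<exists>e\<in>(\<lambda>v. single v 1) ` V. expo_le e k"
      if k: "k \<in> keys (bdry C i x c)" for k
    proof -
      obtain b k' where b: "b \<in> B (Suc i)" "s b c \<noteq> 0" "k' \<in> keys (x b)"
          "k = k' + (lab b - lab c)"
        using k unfolding C_simps by (rule keys_sum_times_single)
      \<comment> \<open>The labels differ and one divides the other, so some variable divides their
        quotient.\<close>
      obtain v where v: "lookup (lab c) v \<noteq> lookup (lab b) v"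
        using s_nonzero[OF b(1,2)] poly_mapping_eqI by metis
      then have lt: "lookup (lab c) v < lookup (lab b) v"
        using s_nonzero[OF b(1,2)] by (simp add: expo_le_def le_neq_implies_less)
      then have "v \<in> V" using keys_lab[OF b(1)] by (auto simp: in_keys_iff)
      moreover have "expo_le (single v 1) k"
        using lt b(4) by (auto simp: expo_le_def lookup_add lookup_minus lookup_single when_def)
      ultimately show ?thesis by blast
    qed
    moreover have "bdry C i x c \<in> carrier (poly_ring V)"
      using bdry_carrier[OF x] c unfolding chain_carrier by simp
    ultimately show "bdry C i x c \<in> monomial_ideal V ((\<lambda>v. single v 1) ` V)"
      by (simp add: monomial_ideal_def del: C_simps)
  qed
qed (use free_resolution_C finite_gens in auto)

end

section \<open>Uniqueness of multigraded Betti numbers\<close>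

text \<open>More vectors than coordinates are linearly dependent, by Gaussian elimination: a vector
  b0 with nonzero coordinate e clears that coordinate from the others, which leaves one vector and
  one coordinate less.\<close>

lemma nontrivial_relation:
  fixes F :: "'b \<Rightarrow> 'c \<Rightarrow> 'k::field"
  assumes "finite A'" shows "finite A \<Longrightarrow> card A' < card A \<Longrightarrow>
    \<exists>x. (\<exists>b\<in>A. x b \<noteq> 0) \<and> (\<forall>e\<in>A'. (\<Sum>b\<in>A. x b * F b e) = 0)"
  using assms
proof (induction A' arbitrary: A F rule: finite_induct)
  case empty
  then have "\<exists>b\<in>A. (1::'k) \<noteq> 0" by (auto simp: card_gt_0_iff)
  then show ?case by (intro exI[of _ "\<lambda>b. 1"]) auto
next
  case (insert e A')
  show ?case
  proof (cases "\<forall>b\<in>A. F b e = 0")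
    case True
    have "card A' < card A" using insert by simp
    then obtain x where x: "\<exists>b\<in>A. x b \<noteq> 0" "\<forall>e\<in>A'. (\<Sum>b\<in>A. x b * F b e) = 0"
      using insert.IH[OF insert.prems(1)] by blast
    then show ?thesis using True by (intro exI[of _ x]) auto
  next
    case False
    then obtain b0 where b0: "b0 \<in> A" "F b0 e \<noteq> 0" by blast
    define A1 where "A1 = A - {b0}"
    define F1 where "F1 b e' = F b e' - F b e / F b0 e * F b0 e'" for b e'
    have A1: "finite A1" "card A' < card A1" using insert b0 by (auto simp: A1_def)
    obtain x where x: "\<exists>b\<in>A1. x b \<noteq> 0" "\<forall>e\<in>A'. (\<Sum>b\<in>A1. x b * F1 b e) = 0"
      using insert.IH[OF A1] by blast
    \<comment> \<open>The coefficient of b0 is chosen so that coordinate e vanishes; in the other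
      coordinates the combination is then the relation among the cleared vectors F1.\<close>
    define t where "t = - (\<Sum>b\<in>A1. x b * F b e) / F b0 e"
    define y where "y b = (if b = b0 then t else x b)" for b
    have split: "(\<Sum>b\<in>A. y b * F b e') = t * F b0 e' + (\<Sum>b\<in>A1. x b * F b e')" for e'
    proof -
      have "(\<Sum>b\<in>A. y b * F b e') = y b0 * F b0 e' + (\<Sum>b\<in>A1. y b * F b e')"
        unfolding A1_def using insert.prems b0 by (simp add: sum.remove)
      moreover have "(\<Sum>b\<in>A1. y b * F b e') = (\<Sum>b\<in>A1. x b * F b e')"
        by (rule sum.cong) (auto simp: y_def A1_def)
      ultimately show ?thesis by (simp add: y_def)
    qed
    have "(\<Sum>b\<in>A. y b * F b e') = 0" if "e' \<in> insert e A'" for e'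
    proof (cases "e' = e")
      case True
      then show ?thesis using b0 by (simp add: split t_def)
    next
      case False
      then have "(\<Sum>b\<in>A1. x b * F1 b e') = 0" using that x by auto
      moreover have "(\<Sum>b\<in>A1. x b * F1 b e') = (\<Sum>b\<in>A1. x b * F b e') + t * F b0 e'"
        by (simp add: F1_def t_def right_diff_distrib sum_subtractf sum_distrib_right sum_divide_distrib
            mult.assoc)
      ultimately show ?thesis by (simp add: split add.commute)
    qed
    moreover have "\<exists>b\<in>A. y b \<noteq> 0" using x(1) by (auto simp: y_def A1_def)
    ultimately show ?thesis by blast
  qed
qed

text \<open>A row vector x with x F = 0 satisfies x = x F G = 0, so the rows of F are
  independent.\<close>

lemma card_le_of_left_inverse:
  fixes F :: "'b \<Rightarrow> 'c \<Rightarrow> 'k::field"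
  assumes fin: "finite A" "finite A'"
    and inv: "\<And>b b'. b \<in> A \<Longrightarrow> b' \<in> A \<Longrightarrow> (\<Sum>e\<in>A'. F b e * G e b') = (if b = b' then 1 else 0)"
  shows "card A \<le> card A'"
proof (rule ccontr)
  assume "\<not> ?thesis"
  then obtain x where x: "\<exists>b\<in>A. x b \<noteq> 0" "\<forall>e\<in>A'. (\<Sum>b\<in>A. x b * F b e) = 0"
    using nontrivial_relation[OF fin(2,1), of F] by (meson not_le)
  then obtain b' where b': "b' \<in> A" "x b' \<noteq> 0" by blast
  have "x b' = (\<Sum>b\<in>A. x b * (if b = b' then 1 else 0))"
    using b' fin by (simp add: sum.delta if_distrib cong: if_cong)
  also have "\<dots> = (\<Sum>b\<in>A. x b * (\<Sum>e\<in>A'. F b e * G e b'))"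
    using inv b' by (intro sum.cong) auto
  also have "\<dots> = (\<Sum>e\<in>A'. (\<Sum>b\<in>A. x b * F b e) * G e b')"
    unfolding sum_distrib_left sum_distrib_right mult.assoc by (rule sum.swap)
  also have "\<dots> = 0" using x(2) by (intro sum.neutral) auto
  finally show False using b' by simp
qed

text \<open>
  The matrices of a graded resolution over the field: a homogeneous map between graded free modules
  of rank one is a scalar times a monomial, so the maps are determined by the scalars \<open>a i b c\<close> and
  \<open>w b\<close>. The set \<open>D\<close> contains the relevant multidegrees, \<open>J\<close> those in which the resolved ideal is
  nonzero.
\<close>

definition gens_le :: "(nat \<Rightarrow> 'b set) \<Rightarrow> (nat \<Rightarrow> 'b \<Rightarrow> int \<Rightarrow> int) \<Rightarrow> nat \<Rightarrow> (int \<Rightarrow> int) \<Rightarrow> 'b set" where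
  "gens_le B deg i \<gamma> = {b \<in> B i. deg i b \<le> \<gamma>}"

definition scalar_cycle ::
  "(nat \<Rightarrow> 'b set) \<Rightarrow> (nat \<Rightarrow> 'b \<Rightarrow> 'b \<Rightarrow> 'k::field) \<Rightarrow> ('b \<Rightarrow> 'k) \<Rightarrow> nat \<Rightarrow> ('b \<Rightarrow> 'k) \<Rightarrow> bool" where
  "scalar_cycle B a w i x \<longleftrightarrow> (case i of 0 \<Rightarrow> (\<Sum>b\<in>B 0. x b * w b) = 0
     | Suc j \<Rightarrow> (\<forall>c\<in>B j. (\<Sum>b\<in>B (Suc j). x b * a j b c) = 0))"

text \<open>The strict inequality in \<open>a_nonzero\<close> is minimality: no entry is a unit.
  Since the ideal has dimension at most 1 in each multidegree, the augmentation is a single scalar w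
  per generator and surjectivity in degree \<gamma> means reaching 1.\<close>

locale scalar_resolution =
  fixes B :: "nat \<Rightarrow> 'b set" and deg :: "nat \<Rightarrow> 'b \<Rightarrow> int \<Rightarrow> int"
    and a :: "nat \<Rightarrow> 'b \<Rightarrow> 'b \<Rightarrow> 'k::field" and w :: "'b \<Rightarrow> 'k"
    and D :: "(int \<Rightarrow> int) set" and J :: "(int \<Rightarrow> int) set"
  assumes fin: "\<And>i. finite (B i)"
    and degD: "\<And>i b. b \<in> B i \<Longrightarrow> deg i b \<in> D"
    and a_nonzero: "\<And>i b c. b \<in> B (Suc i) \<Longrightarrow> c \<in> B i \<Longrightarrow> a i b c \<noteq> 0 \<Longrightarrow> deg i c < deg (Suc i) b"
    and wJ: "\<And>b. b \<in> B 0 \<Longrightarrow> w b \<noteq> 0 \<Longrightarrow> deg 0 b \<in> J"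
    and cyc_a: "\<And>i b. b \<in> B (Suc i) \<Longrightarrow> scalar_cycle B a w i (a i b)"
    and surj: "\<And>\<gamma>. \<gamma> \<in> J \<Longrightarrow> \<exists>x. supp x \<subseteq> gens_le B deg 0 \<gamma> \<and> (\<Sum>b\<in>B 0. x b * w b) = 1"
    and exact: "\<And>i \<gamma> x. \<gamma> \<in> D \<Longrightarrow> supp x \<subseteq> gens_le B deg i \<gamma> \<Longrightarrow> scalar_cycle B a w i x \<Longrightarrow>
      \<exists>z. supp z \<subseteq> gens_le B deg (Suc i) \<gamma> \<and> (\<forall>c\<in>B i. (\<Sum>b\<in>B (Suc i). z b * a i b c) = x c)"
begin

abbreviation span where "span \<equiv> gens_le B deg"
abbreviation cyc where "cyc \<equiv> scalar_cycle B a w"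

lemma aa:
  assumes "b \<in> B (Suc (Suc i))" "e \<in> B i"
  shows "(\<Sum>c\<in>B (Suc i). a (Suc i) b c * a i c e) = 0"
  using cyc_a[OF assms(1)] assms(2) by (simp add: scalar_cycle_def)

lemma aw: "b \<in> B (Suc 0) \<Longrightarrow> (\<Sum>c\<in>B 0. a 0 b c * w c) = 0"
  using cyc_a[of b 0] by (simp add: scalar_cycle_def)

text \<open>The standard construction for a chain map \<psi> that is zero after augmentation, done
  degree by degree with \<open>exact\<close>. Matrices act on row vectors:
  \<open>\<psi> i b c\<close> is the coefficient of c in the image of b. The support conditions say
  that all maps preserve the multidegree.\<close>

lemma null_homotopy:
  assumes supp: "\<And>i b. b \<in> B i \<Longrightarrow> supp (\<psi> i b) \<subseteq> span i (deg i b)"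
    and aug: "\<And>b. b \<in> B 0 \<Longrightarrow> (\<Sum>c\<in>B 0. \<psi> 0 b c * w c) = 0"
    and chain: "\<And>i b e. b \<in> B (Suc i) \<Longrightarrow> e \<in> B i \<Longrightarrow>
      (\<Sum>c\<in>B (Suc i). \<psi> (Suc i) b c * a i c e) = (\<Sum>c\<in>B i. a i b c * \<psi> i c e)"
  shows "\<exists>h. (\<forall>i. \<forall>b\<in>B i. supp (h i b) \<subseteq> span (Suc i) (deg i b)) \<and>
    (\<forall>i. \<forall>b\<in>B i. \<forall>c\<in>B i. \<psi> i b c = (\<Sum>e\<in>B (Suc i). h i b e * a i e c) +
       (case i of 0 \<Rightarrow> 0 | Suc j \<Rightarrow> (\<Sum>e\<in>B j. a j b e * h j e c)))"
proof -
  \<comment> \<open>The second half of P is the cycle condition under which \<open>exact\<close>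
    yields the next component; Q is the homotopy equation that links two consecutive components. The
    equation in degree 0 has another form, which is why the choice below keeps track of
    \<open>h0\<close>.\<close>
  define P where "P i h \<longleftrightarrow> (\<forall>b\<in>B i. supp (h b) \<subseteq> span (Suc i) (deg i b)) \<and>
     (\<forall>b\<in>B (Suc i). cyc (Suc i) (\<lambda>c. \<psi> (Suc i) b c - (\<Sum>e\<in>B i. a i b e * h e c)))" for i h
  define Q where "Q i h h' \<longleftrightarrow> (\<forall>b\<in>B (Suc i). \<forall>c\<in>B (Suc i). \<psi> (Suc i) b c =
     (\<Sum>e\<in>B (Suc (Suc i)). h' b e * a (Suc i) e c) + (\<Sum>e\<in>B i. a i b e * h e c))" for i h h'
  have base: "\<exists>h. P 0 h \<and> (\<forall>b\<in>B 0. \<forall>c\<in>B 0. \<psi> 0 b c = (\<Sum>e\<in>B (Suc 0). h b e * a 0 e c))"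
  proof -
    have "\<forall>b\<in>B 0. \<exists>z. supp z \<subseteq> span (Suc 0) (deg 0 b) \<and>
        (\<forall>c\<in>B 0. (\<Sum>e\<in>B (Suc 0). z e * a 0 e c) = \<psi> 0 b c)"
      using exact[OF degD supp] aug by (auto simp: scalar_cycle_def)
    then have "\<exists>h. \<forall>b\<in>B 0. supp (h b) \<subseteq> span (Suc 0) (deg 0 b) \<and>
        (\<forall>c\<in>B 0. (\<Sum>e\<in>B (Suc 0). h b e * a 0 e c) = \<psi> 0 b c)"
      by (rule bchoice)
    then obtain h where h: "\<And>b. b \<in> B 0 \<Longrightarrow> supp (h b) \<subseteq> span (Suc 0) (deg 0 b)"
        "\<And>b c. b \<in> B 0 \<Longrightarrow> c \<in> B 0 \<Longrightarrow> (\<Sum>e\<in>B (Suc 0). h b e * a 0 e c) = \<psi> 0 b c"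
      by auto
    have "(\<Sum>e\<in>B (Suc 0). (\<psi> (Suc 0) b e - (\<Sum>c\<in>B 0. a 0 b c * h c e)) * a 0 e g) = 0"
      if b: "b \<in> B (Suc 0)" and g: "g \<in> B 0" for b g
    proof -
      have "(\<Sum>e\<in>B (Suc 0). (\<Sum>c\<in>B 0. a 0 b c * h c e) * a 0 e g) =
          (\<Sum>c\<in>B 0. a 0 b c * (\<Sum>e\<in>B (Suc 0). h c e * a 0 e g))"
        unfolding sum_distrib_left sum_distrib_right mult.assoc by (rule sum.swap)
      also have "\<dots> = (\<Sum>c\<in>B 0. a 0 b c * \<psi> 0 c g)" using h(2) g by (intro sum.cong) auto
      finally show ?thesis using chain[OF b g] by (simp add: left_diff_distrib sum_subtractf)
    qed
    then have "P 0 h" using h(1) by (auto simp: P_def scalar_cycle_def)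
    then show ?thesis using h(2) by (intro exI[of _ h]) auto
  qed
  then obtain h0 where h0: "P 0 h0" "\<forall>b\<in>B 0. \<forall>c\<in>B 0. \<psi> 0 b c = (\<Sum>e\<in>B (Suc 0). h0 b e * a 0 e c)"
    by blast
  have step: "\<exists>h'. P (Suc i) h' \<and> Q i h h'" if P: "P i h" for i h
  proof -
    let ?r = "\<lambda>b c. \<psi> (Suc i) b c - (\<Sum>e\<in>B i. a i b e * h e c)"
    have "\<exists>z. supp z \<subseteq> span (Suc (Suc i)) (deg (Suc i) b) \<and>
        (\<forall>c\<in>B (Suc i). (\<Sum>e\<in>B (Suc (Suc i)). z e * a (Suc i) e c) = ?r b c)"
      if b: "b \<in> B (Suc i)" for b
    proof (rule exact[OF degD[OF b]])
      show "cyc (Suc i) (?r b)" using P b by (simp add: P_def)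
      show "supp (?r b) \<subseteq> span (Suc i) (deg (Suc i) b)"
      proof
        fix c assume "c \<in> supp (?r b)"
        then have "\<psi> (Suc i) b c \<noteq> 0 \<or> (\<Sum>e\<in>B i. a i b e * h e c) \<noteq> 0" by (auto simp: supp_def)
        then show "c \<in> span (Suc i) (deg (Suc i) b)"
        proof
          assume "\<psi> (Suc i) b c \<noteq> 0"
          then show ?thesis using supp[OF b] by (auto simp: supp_def)
        next
          assume "(\<Sum>e\<in>B i. a i b e * h e c) \<noteq> 0"
          then obtain e where e: "e \<in> B i" "a i b e * h e c \<noteq> 0"
            by (rule sum.not_neutral_contains_not_neutral)
          then have "deg i e \<le> deg (Suc i) b" using a_nonzero[OF b e(1)] by auto
          moreover have "c \<in> span (Suc i) (deg i e)" using P e by (auto simp: P_def supp_def)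
          ultimately show ?thesis unfolding gens_le_def using order_trans by blast
        qed
      qed
    qed
    then have "\<forall>b\<in>B (Suc i). \<exists>z. supp z \<subseteq> span (Suc (Suc i)) (deg (Suc i) b) \<and>
        (\<forall>c\<in>B (Suc i). (\<Sum>e\<in>B (Suc (Suc i)). z e * a (Suc i) e c) = ?r b c)"
      by blast
    then have "\<exists>h'. \<forall>b\<in>B (Suc i). supp (h' b) \<subseteq> span (Suc (Suc i)) (deg (Suc i) b) \<and>
        (\<forall>c\<in>B (Suc i). (\<Sum>e\<in>B (Suc (Suc i)). h' b e * a (Suc i) e c) = ?r b c)"
      by (rule bchoice)
    then obtain h' where h': "\<And>b. b \<in> B (Suc i) \<Longrightarrow> supp (h' b) \<subseteq> span (Suc (Suc i)) (deg (Suc i) b)"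
        "\<And>b c. b \<in> B (Suc i) \<Longrightarrow> c \<in> B (Suc i) \<Longrightarrow> (\<Sum>e\<in>B (Suc (Suc i)). h' b e * a (Suc i) e c) = ?r b c"
      by auto
    have "(\<Sum>e\<in>B (Suc (Suc i)). (\<psi> (Suc (Suc i)) b e - (\<Sum>c\<in>B (Suc i). a (Suc i) b c * h' c e)) * a (Suc i) e g) = 0"
      if b: "b \<in> B (Suc (Suc i))" and g: "g \<in> B (Suc i)" for b g
    proof -
      have "(\<Sum>e\<in>B (Suc (Suc i)). (\<Sum>c\<in>B (Suc i). a (Suc i) b c * h' c e) * a (Suc i) e g) =
          (\<Sum>c\<in>B (Suc i). a (Suc i) b c * (\<Sum>e\<in>B (Suc (Suc i)). h' c e * a (Suc i) e g))"
        unfolding sum_distrib_left sum_distrib_right mult.assoc by (rule sum.swap)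
      also have "\<dots> = (\<Sum>c\<in>B (Suc i). a (Suc i) b c * ?r c g)" using h'(2) g by (intro sum.cong) auto
      also have "\<dots> = (\<Sum>c\<in>B (Suc i). a (Suc i) b c * \<psi> (Suc i) c g) -
          (\<Sum>c\<in>B (Suc i). a (Suc i) b c * (\<Sum>e\<in>B i. a i c e * h e g))"
        by (simp add: right_diff_distrib sum_subtractf)
      also have "(\<Sum>c\<in>B (Suc i). a (Suc i) b c * (\<Sum>e\<in>B i. a i c e * h e g)) =
          (\<Sum>e\<in>B i. (\<Sum>c\<in>B (Suc i). a (Suc i) b c * a i c e) * h e g)"
        unfolding sum_distrib_left sum_distrib_right mult.assoc by (rule sum.swap)
      also have "\<dots> = 0" using aa[OF b] by simp
      finally show ?thesis using chain[OF b g] by (simp add: left_diff_distrib sum_subtractf)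
    qed
    then have "P (Suc i) h'" using h'(1) by (auto simp: P_def scalar_cycle_def)
    moreover have "Q i h h'" using h'(2) by (simp add: Q_def)
    ultimately show ?thesis by blast
  qed
  have "\<exists>h. \<forall>i. (P i (h i) \<and> (i = 0 \<longrightarrow> h i = h0)) \<and> Q i (h i) (h (Suc i))"
    by (rule dependent_nat_choice) (use h0 step in auto)
  then obtain h where h: "\<And>i. P i (h i)" "h 0 = h0" "\<And>i. Q i (h i) (h (Suc i))" by blast
  have "\<psi> i b c = (\<Sum>e\<in>B (Suc i). h i b e * a i e c) +
       (case i of 0 \<Rightarrow> 0 | Suc j \<Rightarrow> (\<Sum>e\<in>B j. a j b e * h j e c))" if "b \<in> B i" "c \<in> B i" for i b c
  proof (cases i)
    case 0
    then show ?thesis using h0(2) h(2) that by simp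
  next
    case (Suc j)
    then show ?thesis using h(3)[of j] that by (simp add: Q_def)
  qed
  moreover have "\<forall>i. \<forall>b\<in>B i. supp (h i b) \<subseteq> span (Suc i) (deg i b)" using h(1) by (simp add: P_def)
  ultimately show ?thesis by blast
qed

text \<open>The differential strictly lowers degrees, so no homotopy reaches the block of equal degrees.\<close>

lemma null_homotopic_diagonal_zero:
  assumes supp: "\<And>i b. b \<in> B i \<Longrightarrow> supp (\<psi> i b) \<subseteq> span i (deg i b)"
    and aug: "\<And>b. b \<in> B 0 \<Longrightarrow> (\<Sum>c\<in>B 0. \<psi> 0 b c * w c) = 0"
    and chain: "\<And>i b e. b \<in> B (Suc i) \<Longrightarrow> e \<in> B i \<Longrightarrow>
      (\<Sum>c\<in>B (Suc i). \<psi> (Suc i) b c * a i c e) = (\<Sum>c\<in>B i. a i b c * \<psi> i c e)"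
    and bc: "b \<in> B i" "c \<in> B i" "deg i b = deg i c"
  shows "\<psi> i b c = 0"
proof -
  obtain h where h: "\<And>i b. b \<in> B i \<Longrightarrow> supp (h i b) \<subseteq> span (Suc i) (deg i b)"
    "\<And>i b c. b \<in> B i \<Longrightarrow> c \<in> B i \<Longrightarrow> \<psi> i b c = (\<Sum>e\<in>B (Suc i). h i b e * a i e c) +
       (case i of 0 \<Rightarrow> 0 | Suc j \<Rightarrow> (\<Sum>e\<in>B j. a j b e * h j e c))"
    using null_homotopy[of \<psi>, OF supp aug chain] by blast
  have "h i b e * a i e c = 0" if "e \<in> B (Suc i)" for e
  proof (rule ccontr)
    assume "h i b e * a i e c \<noteq> 0"
    then have "deg (Suc i) e \<le> deg i b" "deg i c < deg (Suc i) e"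
      using h(1)[OF bc(1)] a_nonzero[OF that bc(2)] by (auto simp: supp_def gens_le_def)
    then show False using bc(3) by simp
  qed
  moreover have "a j b e * h j e c = 0" if "i = Suc j" "e \<in> B j" for j e
  proof (rule ccontr)
    assume "a j b e * h j e c \<noteq> 0"
    then have "deg (Suc j) c \<le> deg j e" "deg j e < deg (Suc j) b"
      using h(1)[OF that(2)] a_nonzero[of b j e] bc that by (auto simp: supp_def gens_le_def)
    then show False using bc(3) that by simp
  qed
  ultimately show ?thesis using h(2)[OF bc(1,2)] by (simp split: nat.splits del: mult_eq_0_iff)
qed

end

locale scalar_resolution_pair =
  S: scalar_resolution B deg a w D J + T: scalar_resolution B' deg' a' w' D J
  for B :: "nat \<Rightarrow> 'b set" and deg and a :: "nat \<Rightarrow> 'b \<Rightarrow> 'b \<Rightarrow> 'k::field" and w and D J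
    and B' :: "nat \<Rightarrow> 'c set" and deg' and a' :: "nat \<Rightarrow> 'c \<Rightarrow> 'c \<Rightarrow> 'k" and w'
begin

definition comparison :: "(nat \<Rightarrow> 'b \<Rightarrow> 'c \<Rightarrow> 'k) \<Rightarrow> bool" where
  "comparison f \<longleftrightarrow> (\<forall>i. \<forall>b\<in>B i. supp (f i b) \<subseteq> T.span i (deg i b)) \<and>
     (\<forall>b\<in>B 0. (\<Sum>c\<in>B' 0. f 0 b c * w' c) = w b) \<and>
     (\<forall>i. \<forall>b\<in>B (Suc i). \<forall>e\<in>B' i.
        (\<Sum>c\<in>B' (Suc i). f (Suc i) b c * a' i c e) = (\<Sum>c\<in>B i. a i b c * f i c e))"

text \<open>Lifting the identity of the resolved ideal: the differential of the first resolution
  followed by the map built so far is a cycle in the second, hence a boundary there, and a preimage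
  serves as the next component.\<close>

lemma comparison_exists: "\<exists>f. comparison f"
proof -
  define P where "P i f \<longleftrightarrow> (\<forall>b\<in>B i. supp (f b) \<subseteq> T.span i (deg i b)) \<and>
     (\<forall>b\<in>B (Suc i). T.cyc i (\<lambda>e. \<Sum>c\<in>B i. a i b c * f c e))" for i f
  define Q where "Q i f f' \<longleftrightarrow> (\<forall>b\<in>B (Suc i). \<forall>e\<in>B' i.
     (\<Sum>c\<in>B' (Suc i). f' b c * a' i c e) = (\<Sum>c\<in>B i. a i b c * f c e))" for i f f'
  \<comment> \<open>Only w b \<noteq> 0 guarantees that the degree of b lies in J, where 1 can be
    reached and then scaled; for w b = 0 the zero vector does.\<close>
  have "\<exists>x. supp x \<subseteq> T.span 0 (deg 0 b) \<and> (\<Sum>c\<in>B' 0. x c * w' c) = w b" if b: "b \<in> B 0" for b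
  proof (cases "w b = 0")
    case True
    then show ?thesis by (intro exI[of _ "\<lambda>c. 0"]) (auto simp: supp_def)
  next
    case False
    then obtain x where x: "supp x \<subseteq> T.span 0 (deg 0 b)" "(\<Sum>c\<in>B' 0. x c * w' c) = 1"
      using T.surj[OF S.wJ[OF b]] by blast
    have "(\<Sum>c\<in>B' 0. (w b * x c) * w' c) = w b"
      using x(2) by (simp add: mult.assoc sum_distrib_left[symmetric])
    moreover have "supp (\<lambda>c. w b * x c) \<subseteq> T.span 0 (deg 0 b)" using x(1) by (auto simp: supp_def)
    ultimately show ?thesis by blast
  qed
  then have "\<forall>b\<in>B 0. \<exists>x. supp x \<subseteq> T.span 0 (deg 0 b) \<and> (\<Sum>c\<in>B' 0. x c * w' c) = w b"
    by blast
  then have "\<exists>f0. \<forall>b\<in>B 0. supp (f0 b) \<subseteq> T.span 0 (deg 0 b) \<and> (\<Sum>c\<in>B' 0. f0 b c * w' c) = w b"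
    by (rule bchoice)
  then obtain f0 where f0: "\<And>b. b \<in> B 0 \<Longrightarrow> supp (f0 b) \<subseteq> T.span 0 (deg 0 b)"
      "\<And>b. b \<in> B 0 \<Longrightarrow> (\<Sum>c\<in>B' 0. f0 b c * w' c) = w b"
    by auto
  have "(\<Sum>e\<in>B' 0. (\<Sum>c\<in>B 0. a 0 b c * f0 c e) * w' e) = 0" if "b \<in> B (Suc 0)" for b
  proof -
    have "(\<Sum>e\<in>B' 0. (\<Sum>c\<in>B 0. a 0 b c * f0 c e) * w' e) =
        (\<Sum>c\<in>B 0. a 0 b c * (\<Sum>e\<in>B' 0. f0 c e * w' e))"
      unfolding sum_distrib_left sum_distrib_right mult.assoc by (rule sum.swap)
    also have "\<dots> = (\<Sum>c\<in>B 0. a 0 b c * w c)" using f0(2) by (intro sum.cong) auto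
    finally show ?thesis using S.aw[OF that] by simp
  qed
  then have P0: "P 0 f0" using f0(1) by (auto simp: P_def scalar_cycle_def)
  have step: "\<exists>f'. P (Suc i) f' \<and> Q i f f'" if P: "P i f" for i f
  proof -
    have "\<exists>z. supp z \<subseteq> T.span (Suc i) (deg (Suc i) b) \<and>
        (\<forall>e\<in>B' i. (\<Sum>c\<in>B' (Suc i). z c * a' i c e) = (\<Sum>c\<in>B i. a i b c * f c e))"
      if b: "b \<in> B (Suc i)" for b
    proof (rule T.exact[OF S.degD[OF b]])
      show "T.cyc i (\<lambda>e. \<Sum>c\<in>B i. a i b c * f c e)" using P b by (simp add: P_def)
      show "supp (\<lambda>e. \<Sum>c\<in>B i. a i b c * f c e) \<subseteq> T.span i (deg (Suc i) b)"
      proof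
        fix e assume "e \<in> supp (\<lambda>e. \<Sum>c\<in>B i. a i b c * f c e)"
        then have "(\<Sum>c\<in>B i. a i b c * f c e) \<noteq> 0" by (simp add: supp_def)
        then obtain c where c: "c \<in> B i" "a i b c * f c e \<noteq> 0"
          by (rule sum.not_neutral_contains_not_neutral)
        then have "deg i c \<le> deg (Suc i) b" using S.a_nonzero[OF b c(1)] by auto
        moreover have "e \<in> T.span i (deg i c)" using P c by (auto simp: P_def supp_def)
        ultimately show "e \<in> T.span i (deg (Suc i) b)" unfolding gens_le_def using order_trans by blast
      qed
    qed
    then have "\<forall>b\<in>B (Suc i). \<exists>z. supp z \<subseteq> T.span (Suc i) (deg (Suc i) b) \<and>
        (\<forall>e\<in>B' i. (\<Sum>c\<in>B' (Suc i). z c * a' i c e) = (\<Sum>c\<in>B i. a i b c * f c e))"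
      by blast
    then have "\<exists>f'. \<forall>b\<in>B (Suc i). supp (f' b) \<subseteq> T.span (Suc i) (deg (Suc i) b) \<and>
        (\<forall>e\<in>B' i. (\<Sum>c\<in>B' (Suc i). f' b c * a' i c e) = (\<Sum>c\<in>B i. a i b c * f c e))"
      by (rule bchoice)
    then obtain f' where f': "\<And>b. b \<in> B (Suc i) \<Longrightarrow> supp (f' b) \<subseteq> T.span (Suc i) (deg (Suc i) b)"
        "\<And>b e. b \<in> B (Suc i) \<Longrightarrow> e \<in> B' i \<Longrightarrow>
          (\<Sum>c\<in>B' (Suc i). f' b c * a' i c e) = (\<Sum>c\<in>B i. a i b c * f c e)"
      by auto
    have "(\<Sum>e\<in>B' (Suc i). (\<Sum>c\<in>B (Suc i). a (Suc i) b c * f' c e) * a' i e g) = 0"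
      if b: "b \<in> B (Suc (Suc i))" and g: "g \<in> B' i" for b g
    proof -
      have "(\<Sum>e\<in>B' (Suc i). (\<Sum>c\<in>B (Suc i). a (Suc i) b c * f' c e) * a' i e g) =
          (\<Sum>c\<in>B (Suc i). a (Suc i) b c * (\<Sum>e\<in>B' (Suc i). f' c e * a' i e g))"
        unfolding sum_distrib_left sum_distrib_right mult.assoc by (rule sum.swap)
      also have "\<dots> = (\<Sum>c\<in>B (Suc i). a (Suc i) b c * (\<Sum>e\<in>B i. a i c e * f e g))"
        using f'(2) g by (intro sum.cong) auto
      also have "\<dots> = (\<Sum>e\<in>B i. (\<Sum>c\<in>B (Suc i). a (Suc i) b c * a i c e) * f e g)"
        unfolding sum_distrib_left sum_distrib_right mult.assoc by (rule sum.swap)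
      finally show ?thesis using S.aa[OF b] by simp
    qed
    then have "P (Suc i) f'" using f'(1) by (auto simp: P_def scalar_cycle_def)
    moreover have "Q i f f'" using f'(2) by (simp add: Q_def)
    ultimately show ?thesis by blast
  qed
  have "\<exists>f. \<forall>i. (P i (f i) \<and> (i = 0 \<longrightarrow> f i = f0)) \<and> Q i (f i) (f (Suc i))"
    by (rule dependent_nat_choice) (use P0 step in auto)
  then obtain f where "\<And>i. P i (f i)" "f 0 = f0" "\<And>i. Q i (f i) (f (Suc i))" by blast
  then have "comparison f" using f0 by (simp add: comparison_def P_def Q_def)
  then show ?thesis by blast
qed

end

context scalar_resolution_pair
begin

text \<open>With f and g comparison maps in the two directions, the identity minus their composite
  \<phi> is a chain map that vanishes after augmentation. It is therefore zero between generators of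
  equal degree, so \<phi> is the identity on the block of degree \<alpha>, and f and g restrict to
  matrices whose product is the identity.\<close>

lemma card_le: "card {b \<in> B i. deg i b = \<alpha>} \<le> card {b \<in> B' i. deg' i b = \<alpha>}"
proof -
  interpret R: scalar_resolution_pair B' deg' a' w' D J B deg a w ..
  obtain f where f: "comparison f" using comparison_exists by blast
  obtain g where g: "R.comparison g" using R.comparison_exists by blast
  have f_supp: "\<And>i b. b \<in> B i \<Longrightarrow> supp (f i b) \<subseteq> T.span i (deg i b)"
    and f_aug: "\<And>b. b \<in> B 0 \<Longrightarrow> (\<Sum>c\<in>B' 0. f 0 b c * w' c) = w b"
    and f_chain: "\<And>i b e. b \<in> B (Suc i) \<Longrightarrow> e \<in> B' i \<Longrightarrow>
      (\<Sum>c\<in>B' (Suc i). f (Suc i) b c * a' i c e) = (\<Sum>c\<in>B i. a i b c * f i c e)"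
    using f by (auto simp: comparison_def)
  have g_supp: "\<And>i b. b \<in> B' i \<Longrightarrow> supp (g i b) \<subseteq> S.span i (deg' i b)"
    and g_aug: "\<And>b. b \<in> B' 0 \<Longrightarrow> (\<Sum>c\<in>B 0. g 0 b c * w c) = w' b"
    and g_chain: "\<And>i b e. b \<in> B' (Suc i) \<Longrightarrow> e \<in> B i \<Longrightarrow>
      (\<Sum>c\<in>B (Suc i). g (Suc i) b c * a i c e) = (\<Sum>c\<in>B' i. a' i b c * g i c e)"
    using g by (auto simp: R.comparison_def)
  define \<phi> where "\<phi> i b c = (\<Sum>e\<in>B' i. f i b e * g i e c)" for i b c
  define \<psi> where "\<psi> i b c = (if b = c then 1 else 0) - \<phi> i b c" for i b c
  have \<phi>_supp: "c \<in> S.span i (deg i b)" if b: "b \<in> B i" and nz: "\<phi> i b c \<noteq> 0" for i b c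
  proof -
    obtain e where e: "e \<in> B' i" "f i b e * g i e c \<noteq> 0"
      using nz unfolding \<phi>_def by (rule sum.not_neutral_contains_not_neutral)
    then have "e \<in> T.span i (deg i b)" "c \<in> S.span i (deg' i e)"
      using f_supp[OF b] g_supp[OF e(1)] by (auto simp: supp_def)
    then show ?thesis unfolding gens_le_def using order_trans by blast
  qed
  have diag: "\<psi> i b c = 0" if "b \<in> B i" "c \<in> B i" "deg i b = deg i c" for b c
  proof (rule S.null_homotopic_diagonal_zero[OF _ _ _ that])
    fix i b assume b: "b \<in> B i"
    show "supp (\<psi> i b) \<subseteq> S.span i (deg i b)"
    proof
      fix c assume "c \<in> supp (\<psi> i b)"
      then have "c = b \<or> \<phi> i b c \<noteq> 0" by (auto simp: supp_def \<psi>_def)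
      then show "c \<in> S.span i (deg i b)" using b \<phi>_supp by (auto simp: gens_le_def)
    qed
  next
    fix b assume b: "b \<in> B 0"
    have "(\<Sum>c\<in>B 0. \<phi> 0 b c * w c) = (\<Sum>e\<in>B' 0. f 0 b e * (\<Sum>c\<in>B 0. g 0 e c * w c))"
      unfolding \<phi>_def sum_distrib_left sum_distrib_right mult.assoc by (rule sum.swap)
    also have "\<dots> = (\<Sum>e\<in>B' 0. f 0 b e * w' e)" using g_aug by (intro sum.cong) auto
    also have "\<dots> = w b" using f_aug[OF b] .
    finally have "(\<Sum>c\<in>B 0. \<phi> 0 b c * w c) = w b" .
    moreover have "(\<Sum>c\<in>B 0. (if b = c then 1 else 0) * w c) = w b"
      using b S.fin by (simp add: if_distrib[of "\<lambda>t. t * _"] sum.delta' cong: if_cong)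
    ultimately show "(\<Sum>c\<in>B 0. \<psi> 0 b c * w c) = 0"
      unfolding \<psi>_def left_diff_distrib sum_subtractf by simp
  next
    fix i b e assume b: "b \<in> B (Suc i)" and e: "e \<in> B i"
    have "(\<Sum>c\<in>B (Suc i). \<phi> (Suc i) b c * a i c e) =
        (\<Sum>u\<in>B' (Suc i). f (Suc i) b u * (\<Sum>c\<in>B (Suc i). g (Suc i) u c * a i c e))"
      unfolding \<phi>_def sum_distrib_left sum_distrib_right mult.assoc by (rule sum.swap)
    also have "\<dots> = (\<Sum>u\<in>B' (Suc i). f (Suc i) b u * (\<Sum>c\<in>B' i. a' i u c * g i c e))"
      using g_chain e by (intro sum.cong) auto
    also have "\<dots> = (\<Sum>c\<in>B' i. (\<Sum>u\<in>B' (Suc i). f (Suc i) b u * a' i u c) * g i c e)"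
      unfolding sum_distrib_left sum_distrib_right mult.assoc by (rule sum.swap)
    also have "\<dots> = (\<Sum>c\<in>B' i. (\<Sum>u\<in>B i. a i b u * f i u c) * g i c e)"
      using f_chain b by (intro sum.cong) auto
    also have "\<dots> = (\<Sum>u\<in>B i. a i b u * \<phi> i u e)"
      unfolding \<phi>_def sum_distrib_left sum_distrib_right mult.assoc by (rule sum.swap)
    finally have 1: "(\<Sum>c\<in>B (Suc i). \<phi> (Suc i) b c * a i c e) = (\<Sum>u\<in>B i. a i b u * \<phi> i u e)" .
    have 2: "(\<Sum>c\<in>B (Suc i). (if b = c then 1 else 0) * a i c e) = a i b e"
      using b S.fin by (simp add: if_distrib[of "\<lambda>t. t * _"] sum.delta' cong: if_cong)
    have 3: "(\<Sum>u\<in>B i. a i b u * (if u = e then 1 else 0)) = a i b e"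
      using e S.fin by (simp add: if_distrib sum.delta cong: if_cong)
    show "(\<Sum>c\<in>B (Suc i). \<psi> (Suc i) b c * a i c e) = (\<Sum>c\<in>B i. a i b c * \<psi> i c e)"
      unfolding \<psi>_def left_diff_distrib right_diff_distrib sum_subtractf 1 2 3 ..
  qed
  show ?thesis
  proof (rule card_le_of_left_inverse[of _ _ "f i" "g i"])
    fix b b' assume b: "b \<in> {b \<in> B i. deg i b = \<alpha>}" "b' \<in> {b \<in> B i. deg i b = \<alpha>}"
    \<comment> \<open>A path from b to b' through e can only go down in degree, and both ends have
      degree \<alpha>, so e has degree \<alpha> as well.\<close>
    have "(\<Sum>e | e \<in> B' i \<and> deg' i e = \<alpha>. f i b e * g i e b') = \<phi> i b b'"
      unfolding \<phi>_def
    proof (rule sum.mono_neutral_left)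
      show "\<forall>e\<in>B' i - {e \<in> B' i. deg' i e = \<alpha>}. f i b e * g i e b' = 0"
      proof (rule ballI, rule ccontr)
        fix e assume e: "e \<in> B' i - {e \<in> B' i. deg' i e = \<alpha>}" "f i b e * g i e b' \<noteq> 0"
        then have "e \<in> T.span i (deg i b)" "b' \<in> S.span i (deg' i e)"
          using f_supp[of b i] g_supp[of e i] b by (auto simp: supp_def)
        then have "deg' i e = \<alpha>" using b by (auto simp: gens_le_def)
        then show False using e by simp
      qed
    qed (use T.fin in auto)
    also have "\<dots> = (if b = b' then 1 else 0)"
      using diag[of b b'] b by (simp add: \<psi>_def)
    finally show "(\<Sum>e\<in>{b \<in> B' i. deg' i b = \<alpha>}. f i b e * g i e b') = (if b = b' then 1 else 0)" by simp
  qed (use S.fin T.fin in auto)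
qed

end

lemma scalar_resolution_card_eq:
  fixes a :: "nat \<Rightarrow> 'b \<Rightarrow> 'b \<Rightarrow> 'k::field" and a' :: "nat \<Rightarrow> 'c \<Rightarrow> 'c \<Rightarrow> 'k"
  assumes S: "scalar_resolution B deg a w D J" and T: "scalar_resolution B' deg' a' w' D J"
  shows "card {b \<in> B i. deg i b = \<alpha>} = card {b \<in> B' i. deg' i b = \<alpha>}"
  using scalar_resolution_pair.card_le[OF scalar_resolution_pair.intro[OF S T]]
    scalar_resolution_pair.card_le[OF scalar_resolution_pair.intro[OF T S]] by (rule antisym)

section \<open>From arbitrary minimal graded resolutions to scalar matrices\<close>

definition expo_diff :: "(int \<Rightarrow> int) \<Rightarrow> (int \<Rightarrow> int) \<Rightarrow> expo" where
  "expo_diff \<gamma> \<delta> = Abs_poly_mapping (\<lambda>v. nat (\<gamma> v - \<delta> v))"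

definition multidegrees :: "int set \<Rightarrow> (int \<Rightarrow> int) set" where
  "multidegrees V = {\<gamma>. \<forall>v. v \<notin> V \<longrightarrow> \<gamma> v = 0}"

definition unit_vec :: "'b \<Rightarrow> 'b \<Rightarrow> 'k::field mpoly" where
  "unit_vec b = (\<lambda>c. if c = b then 1 else 0)"

lemma single_eq_0_iff [simp]: "single k v = 0 \<longleftrightarrow> v = 0"
  by (metis lookup_single_eq lookup_zero single_zero)

text \<open>A multigraded piece of the polynomial ring is spanned by at most one monomial, and it is
  zero if the degree has a negative entry.\<close>

lemma homogeneous_eq_single:
  assumes "homogeneous (\<lambda>v. \<gamma> v - \<delta> v) p"
  shows "p = single (expo_diff \<gamma> \<delta>) (lookup p (expo_diff \<gamma> \<delta>))"
    and "p \<noteq> 0 \<Longrightarrow> \<delta> \<le> \<gamma>"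
proof -
  have key: "m = expo_diff \<gamma> \<delta> \<and> \<delta> \<le> \<gamma>" if "m \<in> keys p" for m
  proof -
    have m: "int (lookup m v) = \<gamma> v - \<delta> v" for v
      using assms that by (simp add: homogeneous_def)
    have "(\<lambda>v. nat (\<gamma> v - \<delta> v)) = lookup m" by (rule ext) (simp add: m[symmetric])
    then have "m = expo_diff \<gamma> \<delta>" by (simp add: expo_diff_def lookup_inverse)
    moreover have "\<delta> v \<le> \<gamma> v" for v using m[of v] by linarith
    ultimately show ?thesis by (simp add: le_fun_def)
  qed
  show "p = single (expo_diff \<gamma> \<delta>) (lookup p (expo_diff \<gamma> \<delta>))"
    by (rule poly_mapping_eqI) (use key in \<open>auto simp: lookup_single when_def in_keys_iff\<close>)
  show "\<delta> \<le> \<gamma>" if nz: "p \<noteq> 0"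
  proof -
    have "keys p \<noteq> {}" using nz by simp
    then obtain m where "m \<in> keys p" by blast
    then show ?thesis using key by blast
  qed
qed

lemma lookup_expo_diff:
  assumes "finite V" "\<gamma> \<in> multidegrees V" "\<delta> \<in> multidegrees V"
  shows "lookup (expo_diff \<gamma> \<delta>) v = nat (\<gamma> v - \<delta> v)"
proof -
  have "{v. nat (\<gamma> v - \<delta> v) \<noteq> 0} \<subseteq> V"
  proof (rule subsetI, rule ccontr)
    fix v assume "v \<in> {v. nat (\<gamma> v - \<delta> v) \<noteq> 0}" "v \<notin> V"
    then show False using assms by (simp add: multidegrees_def)
  qed
  then have "finite {v. nat (\<gamma> v - \<delta> v) \<noteq> 0}" using assms(1) finite_subset by blast
  then show ?thesis by (simp add: expo_diff_def)
qed

lemma keys_expo_diff: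
  assumes "finite V" "\<gamma> \<in> multidegrees V" "\<delta> \<in> multidegrees V"
  shows "keys (expo_diff \<gamma> \<delta>) \<subseteq> V"
proof (rule subsetI, rule ccontr)
  fix v assume "v \<in> keys (expo_diff \<gamma> \<delta>)" "v \<notin> V"
  then show False using assms by (simp add: in_keys_iff lookup_expo_diff[OF assms] multidegrees_def)
qed

lemma expo_diff_add:
  assumes "finite V" "\<epsilon> \<in> multidegrees V" "\<gamma> \<in> multidegrees V" "\<delta> \<in> multidegrees V" "\<delta> \<le> \<gamma>" "\<gamma> \<le> \<epsilon>"
  shows "expo_diff \<epsilon> \<gamma> + expo_diff \<gamma> \<delta> = expo_diff \<epsilon> \<delta>"
proof (rule poly_mapping_eqI)
  fix v
  have "\<delta> v \<le> \<gamma> v" "\<gamma> v \<le> \<epsilon> v" using assms by (auto simp: le_fun_def)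
  then show "lookup (expo_diff \<epsilon> \<gamma> + expo_diff \<gamma> \<delta>) v = lookup (expo_diff \<epsilon> \<delta>) v"
    using assms by (simp add: lookup_add lookup_expo_diff)
qed

lemma expo_le_expo_diff:
  assumes "finite V" "\<epsilon> \<in> multidegrees V" "\<gamma> \<in> multidegrees V" "\<delta> \<in> multidegrees V" "\<delta> \<le> \<gamma>" "\<delta> \<le> \<epsilon>"
  shows "expo_le (expo_diff \<gamma> \<delta>) (expo_diff \<epsilon> \<delta>) \<longleftrightarrow> \<gamma> \<le> \<epsilon>"
proof -
  have "nat (\<gamma> v - \<delta> v) \<le> nat (\<epsilon> v - \<delta> v) \<longleftrightarrow> \<gamma> v \<le> \<epsilon> v" for v
    using le_funD[OF assms(5), of v] le_funD[OF assms(6), of v] by linarith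
  then show ?thesis using assms by (simp add: expo_le_def le_fun_def lookup_expo_diff)
qed

text \<open>Monomials of consecutive degree differences multiply to the monomial of the total
  difference, so only the scalars are summed. As \<open>expo_diff\<close> truncates, the
  inequalities are required wherever a coefficient is nonzero.\<close>

lemma sum_single_times:
  fixes t :: "'b \<Rightarrow> 'k::field"
  assumes V: "finite V" and \<gamma>: "\<gamma> \<in> multidegrees V" and \<delta>: "\<delta> \<in> multidegrees V"
    and deg: "\<And>b. b \<in> G \<Longrightarrow> deg b \<in> multidegrees V"
    and t: "\<And>b. b \<in> G \<Longrightarrow> t b \<noteq> 0 \<Longrightarrow> \<delta> \<le> deg b"
    and x: "\<And>b. b \<in> G \<Longrightarrow> x b \<noteq> 0 \<Longrightarrow> deg b \<le> \<gamma>"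
  shows "(\<Sum>b\<in>G. single (expo_diff \<gamma> (deg b)) (x b) *
      single (expo_diff (deg b) \<delta>) (t b)) =
    single (expo_diff \<gamma> \<delta>) (\<Sum>b\<in>G. x b * t b)"
proof -
  have "single (expo_diff \<gamma> (deg b)) (x b) * single (expo_diff (deg b) \<delta>) (t b) =
      single (expo_diff \<gamma> \<delta>) (x b * t b)" if b: "b \<in> G" for b
  proof (cases "x b * t b = 0")
    case False
    then show ?thesis using expo_diff_add[OF V \<gamma> deg[OF b] \<delta> t[OF b] x[OF b]] by (simp add: mult_single)
  qed (auto simp: mult_single)
  moreover have "single e (\<Sum>b\<in>K. f b) = (\<Sum>b\<in>K. single e (f b))"
    for e :: expo and f :: "'b \<Rightarrow> 'k" and K
    by (induction K rule: infinite_finite_induct) (auto simp: single_add)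
  ultimately show ?thesis by simp
qed

text \<open>Companion of \<open>sum_single_times\<close> for coefficients Y that need not be
  homogeneous: each of them contributes only through its component in degree \<gamma>.\<close>

lemma lookup_sum_times_single:
  fixes t :: "'b \<Rightarrow> 'k::field"
  assumes V: "finite V" and \<gamma>: "\<gamma> \<in> multidegrees V" and \<delta>: "\<delta> \<in> multidegrees V"
    and deg: "\<And>b. b \<in> G \<Longrightarrow> deg b \<in> multidegrees V"
    and t: "\<And>b. b \<in> G \<Longrightarrow> t b \<noteq> 0 \<Longrightarrow> \<delta> \<le> deg b"
    and le: "\<delta> \<le> \<gamma>"
  shows "lookup (\<Sum>b\<in>G. Y b * single (expo_diff (deg b) \<delta>) (t b)) (expo_diff \<gamma> \<delta>) =
    (\<Sum>b\<in>G. (if deg b \<le> \<gamma> then lookup (Y b) (expo_diff \<gamma> (deg b)) else 0) * t b)"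
  unfolding lookup_sum
proof (rule sum.cong[OF refl])
  fix b assume b: "b \<in> G"
  show "lookup (Y b * single (expo_diff (deg b) \<delta>) (t b)) (expo_diff \<gamma> \<delta>) =
      (if deg b \<le> \<gamma> then lookup (Y b) (expo_diff \<gamma> (deg b)) else 0) * t b"
  proof (cases "t b = 0")
    case False
    note tb = t[OF b False]
    have "expo_diff \<gamma> \<delta> - expo_diff (deg b) \<delta> = expo_diff \<gamma> (deg b)" if "deg b \<le> \<gamma>"
      using expo_diff_add[OF V \<gamma> deg[OF b] \<delta> tb that] by (metis add_diff_cancel_right')
    then show ?thesis
      using expo_le_expo_diff[OF V \<gamma> deg[OF b] \<delta> tb le] by (simp add: lookup_times_single)
  qed simp
qed

text \<open>The maps of an abstract resolution are only known to be linear on the carrier. This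
  turns them into matrices; the unit vectors are added one at a time so that every intermediate
  vector stays in the carrier.\<close>

lemma linear_functional_expansion:
  fixes g :: "('b \<Rightarrow> 'k::field mpoly) \<Rightarrow> 'k mpoly"
  assumes fin: "finite G"
    and add: "\<And>x y. x \<in> carrier (free_module (poly_ring V) G) \<Longrightarrow>
      y \<in> carrier (free_module (poly_ring V) G) \<Longrightarrow> g (\<lambda>b. x b + y b) = g x + g y"
    and scale: "\<And>p x. p \<in> carrier (poly_ring V) \<Longrightarrow>
      x \<in> carrier (free_module (poly_ring V) G) \<Longrightarrow> g (\<lambda>b. p * x b) = p * g x"
    and X: "X \<in> carrier (free_module (poly_ring V) G)"
  shows "g X = (\<Sum>b\<in>G. X b * g (unit_vec b))"
proof -
  have zero: "(\<lambda>b. 0) \<in> carrier (free_module (poly_ring V) G)"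
    by (simp add: free_module_carrier fin poly_ring_zero)
  have g0: "g (\<lambda>b. 0) = 0" using scale[OF poly_ring_zero zero] by simp
  have unit: "unit_vec b \<in> carrier (free_module (poly_ring V) G)" if "b \<in> G" for b
    using that by (auto simp: free_module_carrier fin unit_vec_def poly_ring_zero poly_ring_one)
  have "g (\<lambda>b. if b \<in> K then X b else 0) = (\<Sum>b\<in>K. X b * g (unit_vec b))" if "finite K" "K \<subseteq> G" for K
    using that
  proof (induction K rule: finite_induct)
    case empty
    then show ?case by (simp add: g0)
  next
    case (insert b0 K)
    have b0: "b0 \<in> G" and Xb0: "X b0 \<in> carrier (poly_ring V)"
      using insert X by (auto simp: free_module_carrier fin)
    have 1: "(\<lambda>b. if b \<in> K then X b else 0) \<in> carrier (free_module (poly_ring V) G)"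
      using X insert by (auto simp: free_module_carrier fin poly_ring_zero)
    have 2: "(\<lambda>b. X b0 * unit_vec b0 b) \<in> carrier (free_module (poly_ring V) G)"
      using Xb0 b0 by (auto simp: free_module_carrier fin unit_vec_def poly_ring_zero)
    have "(\<lambda>b. if b \<in> insert b0 K then X b else 0) =
        (\<lambda>b. (if b \<in> K then X b else 0) + X b0 * unit_vec b0 b)"
      using insert by (auto simp: unit_vec_def)
    then have "g (\<lambda>b. if b \<in> insert b0 K then X b else 0) =
        g (\<lambda>b. if b \<in> K then X b else 0) + X b0 * g (unit_vec b0)"
      using add[OF 1 2] scale[OF Xb0 unit[OF b0]] by simp
    then show ?case using insert by (simp add: add.commute)
  qed
  from this[OF fin subset_refl] have "g (\<lambda>b. if b \<in> G then X b else 0) = (\<Sum>b\<in>G. X b * g (unit_vec b))" .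
  moreover have "(\<lambda>b. if b \<in> G then X b else 0) = X" using X by (auto simp: free_module_carrier fin)
  ultimately show ?thesis by simp
qed

locale minimal_monomial_resolution =
  fixes V :: "int set" and C :: "('b, 'k::field mpoly) graded_complex" and M :: "expo set"
  assumes finite_V: "finite V"
    and minimal: "minimal_graded_free_resolution V C (monomial_ideal V M)"
begin

abbreviation R :: "'k mpoly ring" where "R \<equiv> poly_ring V"
abbreviation G where "G \<equiv> gens C"
abbreviation deg where "deg \<equiv> gdeg C"

abbreviation chains :: "nat \<Rightarrow> ('b \<Rightarrow> 'k mpoly) set" where
  "chains i \<equiv> carrier (chain_module V C i)"

lemma res: "free_resolution V C (monomial_ideal V M)" and finite_G: "\<And>i. finite (G i)"
  and deg_V: "\<And>i b v. b \<in> G i \<Longrightarrow> v \<notin> V \<Longrightarrow> deg i b v = 0"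
  and graded: "\<And>i \<gamma> x. x \<in> chains (Suc i) \<Longrightarrow>
        homogeneous_chain C (Suc i) \<gamma> x \<Longrightarrow> homogeneous_chain C i \<gamma> (bdry C i x)"
  and graded_augm: "\<And>\<gamma> x. x \<in> chains 0 \<Longrightarrow>
        homogeneous_chain C 0 \<gamma> x \<Longrightarrow> homogeneous \<gamma> (augm C x)"
  and min: "\<And>i x b. x \<in> chains (Suc i) \<Longrightarrow> b \<in> G i \<Longrightarrow>
        bdry C i x b \<in> irrelevant_ideal V"
  using minimal unfolding minimal_graded_free_resolution_def graded_free_resolution_def minimal_complex_def
  by auto

lemma chain_carrier:
  "x \<in> chains i \<longleftrightarrow> (\<forall>b\<in>G i. x b \<in> carrier R) \<and> (\<forall>b. b \<notin> G i \<longrightarrow> x b = 0)"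
  unfolding chain_module_def by (rule free_module_carrier[OF finite_G])

lemma degD: "b \<in> G i \<Longrightarrow> deg i b \<in> multidegrees V"
  using deg_V by (auto simp: multidegrees_def)

lemma zeroD: "(\<lambda>v. 0) \<in> multidegrees V"
  by (simp add: multidegrees_def)

lemma bdry_lin: "bdry C i \<in> linear_maps R (chain_module V C (Suc i)) (chain_module V C i)"
  and augm_lin: "augm C \<in> linear_maps R (chain_module V C 0) (ideal_module R (monomial_ideal V M))"
  and augm_surj: "augm C ` chains 0 = monomial_ideal V M"
  and exact0: "{x \<in> chains 0. augm C x = 0} = bdry C 0 ` chains (Suc 0)"
  and exactS: "{x \<in> chains (Suc i). bdry C i x = (\<lambda>b. 0)} =
            bdry C (Suc i) ` chains (Suc (Suc i))"
  using res unfolding free_resolution_def One_nat_def by blast+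

lemma bdry_carrier:
  "x \<in> chains (Suc i) \<Longrightarrow> bdry C i x \<in> chains i"
  using bdry_lin[of i] by (auto simp: linear_maps_def)

lemma unit_carrier: "b \<in> G i \<Longrightarrow> unit_vec b \<in> chains i"
  by (auto simp: chain_carrier unit_vec_def poly_ring_zero poly_ring_one)

lemma unit_homogeneous: "homogeneous_chain C i (deg i b) (unit_vec b)"
  by (auto simp: homogeneous_chain_def homogeneous_def unit_vec_def)

lemma bdry_expansion:
  assumes "x \<in> chains (Suc i)"
  shows "bdry C i x c = (\<Sum>b\<in>G (Suc i). x b * bdry C i (unit_vec b) c)"
proof (rule linear_functional_expansion[where g = "\<lambda>x. bdry C i x c" and V = V, OF finite_G])
  show "x \<in> carrier (free_module R (G (Suc i)))" using assms by (simp add: chain_module_def)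
qed (use bdry_lin[of i] in \<open>auto simp: linear_maps_def chain_module_def free_module_def\<close>)

lemma augm_expansion:
  assumes "x \<in> chains 0"
  shows "augm C x = (\<Sum>b\<in>G 0. x b * augm C (unit_vec b))"
proof (rule linear_functional_expansion[where g = "augm C" and V = V, OF finite_G])
  show "x \<in> carrier (free_module R (G 0))" using assms by (simp add: chain_module_def)
qed (use augm_lin in \<open>auto simp: linear_maps_def chain_module_def free_module_def ideal_module_def\<close>)

definition a :: "nat \<Rightarrow> 'b \<Rightarrow> 'b \<Rightarrow> 'k" where
  "a i b c = lookup (bdry C i (unit_vec b) c) (expo_diff (deg (Suc i) b) (deg i c))"

definition w :: "'b \<Rightarrow> 'k" where
  "w b = lookup (augm C (unit_vec b)) (expo_diff (deg 0 b) (\<lambda>v. 0))"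

text \<open>Depends on the ideal alone and not on C, so two resolutions of the same ideal share it,
  as \<open>scalar_resolution_card_eq\<close> demands.\<close>

definition J :: "(int \<Rightarrow> int) set" where
  "J = {\<gamma> \<in> multidegrees V. (\<lambda>v. 0) \<le> \<gamma> \<and>
     single (expo_diff \<gamma> (\<lambda>v. 0)) 1 \<in> (monomial_ideal V M :: 'k mpoly set)}"

lemma bdry_unit:
  assumes "b \<in> G (Suc i)" "c \<in> G i"
  shows "bdry C i (unit_vec b) c = single (expo_diff (deg (Suc i) b) (deg i c)) (a i b c)"
    and "a i b c \<noteq> 0 \<Longrightarrow> deg i c \<le> deg (Suc i) b"
proof -
  have h: "homogeneous (\<lambda>v. deg (Suc i) b v - deg i c v) (bdry C i (unit_vec b) c)"
    using graded[OF unit_carrier[OF assms(1)] unit_homogeneous] assms(2) by (simp add: homogeneous_chain_def)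
  show "bdry C i (unit_vec b) c = single (expo_diff (deg (Suc i) b) (deg i c)) (a i b c)"
    unfolding a_def by (rule homogeneous_eq_single(1)[OF h])
  show "deg i c \<le> deg (Suc i) b" if "a i b c \<noteq> 0"
    using homogeneous_eq_single(2)[OF h] that unfolding a_def by (metis lookup_zero)
qed

lemma augm_unit:
  assumes "b \<in> G 0"
  shows "augm C (unit_vec b) = single (expo_diff (deg 0 b) (\<lambda>v. 0)) (w b)"
    and "w b \<noteq> 0 \<Longrightarrow> (\<lambda>v. 0) \<le> deg 0 b"
proof -
  have h: "homogeneous (\<lambda>v. deg 0 b v - (\<lambda>v. 0) v) (augm C (unit_vec b))"
    using graded_augm[OF unit_carrier[OF assms] unit_homogeneous] by simp
  show "augm C (unit_vec b) = single (expo_diff (deg 0 b) (\<lambda>v. 0)) (w b)"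
    unfolding w_def by (rule homogeneous_eq_single(1)[OF h])
  show "(\<lambda>v. 0) \<le> deg 0 b" if "w b \<noteq> 0"
    using homogeneous_eq_single(2)[OF h] that unfolding w_def by (metis lookup_zero)
qed

text \<open>Between generators of equal degree the matrix entry is a constant, and a nonzero
  constant does not lie in the irrelevant ideal.\<close>

lemma a_less:
  assumes "b \<in> G (Suc i)" "c \<in> G i" "a i b c \<noteq> 0"
  shows "deg i c < deg (Suc i) b"
proof -
  have "deg i c \<noteq> deg (Suc i) b"
  proof
    assume eq: "deg i c = deg (Suc i) b"
    have "expo_diff (deg (Suc i) b) (deg i c) = 0" by (simp add: expo_diff_def eq)
    then have "0 \<in> keys (bdry C i (unit_vec b) c)"
      using bdry_unit(1)[OF assms(1,2)] assms(3) by simp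
    moreover have "bdry C i (unit_vec b) c \<in> monomial_ideal V ((\<lambda>v. single v 1) ` V)"
      using min[OF unit_carrier[OF assms(1)] assms(2)] by (simp add: irrelevant_ideal_eq)
    ultimately obtain v where "expo_le (single v 1) 0" by (auto simp: monomial_ideal_def)
    then show False by (auto simp: expo_le_def dest: spec[of _ v])
  qed
  then show ?thesis using bdry_unit(2)[OF assms] by simp
qed

text \<open>The homogeneous chain of degree \<gamma> with scalar coordinates x. It is meaningful for
  x supported on generators of degree at most \<gamma>, where \<open>expo_diff\<close> does not
  truncate; \<open>part\<close> recovers x from it.\<close>

definition homog :: "nat \<Rightarrow> (int \<Rightarrow> int) \<Rightarrow> ('b \<Rightarrow> 'k) \<Rightarrow> 'b \<Rightarrow> 'k mpoly" where
  "homog i \<gamma> x b = (if b \<in> G i then single (expo_diff \<gamma> (deg i b)) (x b) else 0)"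

lemma homog_carrier: "\<gamma> \<in> multidegrees V \<Longrightarrow> homog i \<gamma> x \<in> chains i"
  unfolding chain_carrier homog_def
  using keys_expo_diff[OF finite_V] degD by (auto intro!: poly_ring_single)

lemma bdry_homog:
  assumes "\<gamma> \<in> multidegrees V" "supp x \<subseteq> gens_le G deg (Suc i) \<gamma>" "c \<in> G i"
  shows "bdry C i (homog (Suc i) \<gamma> x) c =
    single (expo_diff \<gamma> (deg i c)) (\<Sum>b\<in>G (Suc i). x b * a i b c)"
proof -
  have "bdry C i (homog (Suc i) \<gamma> x) c = (\<Sum>b\<in>G (Suc i).
      single (expo_diff \<gamma> (deg (Suc i) b)) (x b) *
      single (expo_diff (deg (Suc i) b) (deg i c)) (a i b c))"
    unfolding bdry_expansion[OF homog_carrier[OF assms(1)]]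
    by (intro sum.cong refl) (simp add: homog_def bdry_unit(1) assms(3))
  also have "\<dots> = single (expo_diff \<gamma> (deg i c)) (\<Sum>b\<in>G (Suc i). x b * a i b c)"
    by (rule sum_single_times[OF finite_V assms(1) degD[OF assms(3)]])
       (use assms bdry_unit(2) degD in \<open>auto simp: supp_def gens_le_def\<close>)
  finally show ?thesis .
qed

lemma augm_homog:
  assumes "\<gamma> \<in> multidegrees V" "supp x \<subseteq> gens_le G deg 0 \<gamma>"
  shows "augm C (homog 0 \<gamma> x) = single (expo_diff \<gamma> (\<lambda>v. 0)) (\<Sum>b\<in>G 0. x b * w b)"
proof -
  have "augm C (homog 0 \<gamma> x) = (\<Sum>b\<in>G 0.
      single (expo_diff \<gamma> (deg 0 b)) (x b) *
      single (expo_diff (deg 0 b) (\<lambda>v. 0)) (w b))"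
    unfolding augm_expansion[OF homog_carrier[OF assms(1)]]
    by (intro sum.cong refl) (simp add: homog_def augm_unit(1))
  also have "\<dots> = single (expo_diff \<gamma> (\<lambda>v. 0)) (\<Sum>b\<in>G 0. x b * w b)"
    by (rule sum_single_times[OF finite_V assms(1) zeroD])
       (use assms augm_unit(2) degD in \<open>auto simp: supp_def gens_le_def\<close>)
  finally show ?thesis .
qed

lemma homog_unit: "b \<in> G (Suc i) \<Longrightarrow> bdry C i (unit_vec b) = homog i (deg (Suc i) b) (a i b)"
  using bdry_unit(1) bdry_carrier[OF unit_carrier] by (auto simp: homog_def fun_eq_iff chain_carrier)

text \<open>Exactness of C turns being a boundary into being a cycle, and on homogeneous chains the
  latter is a condition on scalars. Both directions are used: one for \<open>cyc_a\<close>, the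
  other for \<open>exact\<close>.\<close>

lemma homog_cycle_iff:
  assumes "\<gamma> \<in> multidegrees V" "supp x \<subseteq> gens_le G deg i \<gamma>"
  shows "homog i \<gamma> x \<in> bdry C i ` chains (Suc i) \<longleftrightarrow> scalar_cycle G a w i x"
proof (cases i)
  case 0
  have "homog 0 \<gamma> x \<in> bdry C 0 ` chains (Suc 0) \<longleftrightarrow> augm C (homog 0 \<gamma> x) = 0"
    unfolding exact0[symmetric] using homog_carrier[OF assms(1), of 0 x] by simp
  also have "\<dots> \<longleftrightarrow> (\<Sum>b\<in>G 0. x b * w b) = 0"
    using augm_homog[of \<gamma> x] assms 0 by simp
  finally show ?thesis by (simp add: scalar_cycle_def 0)
next
  case (Suc j)
  have "homog (Suc j) \<gamma> x \<in> bdry C (Suc j) ` chains (Suc (Suc j)) \<longleftrightarrow>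
      bdry C j (homog (Suc j) \<gamma> x) = (\<lambda>b. 0)"
    unfolding exactS[symmetric] using homog_carrier[OF assms(1), of "Suc j" x] by simp
  also have "\<dots> \<longleftrightarrow> (\<forall>c\<in>G j. bdry C j (homog (Suc j) \<gamma> x) c = 0)"
    using bdry_carrier[OF homog_carrier[OF assms(1)], of j x] by (auto simp: fun_eq_iff chain_carrier)
  also have "\<dots> \<longleftrightarrow> (\<forall>c\<in>G j. (\<Sum>b\<in>G (Suc j). x b * a j b c) = 0)"
    using bdry_homog[of \<gamma> x j] assms Suc by simp
  finally show ?thesis by (simp add: scalar_cycle_def Suc)
qed

definition part :: "nat \<Rightarrow> (int \<Rightarrow> int) \<Rightarrow> ('b \<Rightarrow> 'k mpoly) \<Rightarrow> 'b \<Rightarrow> 'k" where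
  "part i \<gamma> Y b = (if b \<in> G i \<and> deg i b \<le> \<gamma> then lookup (Y b) (expo_diff \<gamma> (deg i b)) else 0)"

lemma supp_part: "supp (part i \<gamma> Y) \<subseteq> gens_le G deg i \<gamma>"
  by (auto simp: supp_def part_def gens_le_def)

lemma part_bdry:
  assumes \<gamma>: "\<gamma> \<in> multidegrees V" and Y: "Y \<in> chains (Suc i)"
    and c: "c \<in> G i"
  shows "(\<Sum>b\<in>G (Suc i). part (Suc i) \<gamma> Y b * a i b c) = part i \<gamma> (bdry C i Y) c"
proof (cases "deg i c \<le> \<gamma>")
  case True
  have "bdry C i Y c = (\<Sum>b\<in>G (Suc i). Y b *
      single (expo_diff (deg (Suc i) b) (deg i c)) (a i b c))"
    unfolding bdry_expansion[OF Y] by (intro sum.cong refl) (simp add: bdry_unit(1) c)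
  then have "lookup (bdry C i Y c) (expo_diff \<gamma> (deg i c)) =
      (\<Sum>b\<in>G (Suc i). (if deg (Suc i) b \<le> \<gamma> then
        lookup (Y b) (expo_diff \<gamma> (deg (Suc i) b)) else 0) * a i b c)"
    by (simp only:) (rule lookup_sum_times_single[OF finite_V \<gamma> degD[OF c] _ _ True],
        use bdry_unit(2) c degD in auto)
  then show ?thesis using True c by (simp add: part_def)
next
  case False
  have "part (Suc i) \<gamma> Y b * a i b c = 0" if "b \<in> G (Suc i)" for b
    using bdry_unit(2)[OF that c] False order_trans by (auto simp: part_def)
  then have "(\<Sum>b\<in>G (Suc i). part (Suc i) \<gamma> Y b * a i b c) = 0" by (rule sum.neutral[OF ballI])
  then show ?thesis using False by (simp add: part_def[of i])
qed

lemma part_augm: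
  assumes \<gamma>: "\<gamma> \<in> multidegrees V" and Y: "Y \<in> chains 0" and le: "(\<lambda>v. 0) \<le> \<gamma>"
  shows "(\<Sum>b\<in>G 0. part 0 \<gamma> Y b * w b) = lookup (augm C Y) (expo_diff \<gamma> (\<lambda>v. 0))"
proof -
  have "augm C Y = (\<Sum>b\<in>G 0. Y b * single (expo_diff (deg 0 b) (\<lambda>v. 0)) (w b))"
    unfolding augm_expansion[OF Y] by (intro sum.cong refl) (simp add: augm_unit(1))
  then have "lookup (augm C Y) (expo_diff \<gamma> (\<lambda>v. 0)) =
      (\<Sum>b\<in>G 0. (if deg 0 b \<le> \<gamma> then
        lookup (Y b) (expo_diff \<gamma> (deg 0 b)) else 0) * w b)"
    by (simp only:) (rule lookup_sum_times_single[OF finite_V \<gamma> zeroD _ _ le],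
        use augm_unit(2) degD in auto)
  then show ?thesis by (simp add: part_def)
qed

lemma part_homog:
  assumes "supp x \<subseteq> gens_le G deg i \<gamma>" "c \<in> G i"
  shows "part i \<gamma> (homog i \<gamma> x) c = x c"
  using assms by (auto simp: part_def homog_def supp_def gens_le_def)

theorem scalar_resolution: "scalar_resolution G deg a w (multidegrees V) J"
proof
  show "finite (G i)" for i by (rule finite_G)
  show "deg i b \<in> multidegrees V" if "b \<in> G i" for i b using degD[OF that] .
  show "deg i c < deg (Suc i) b" if "b \<in> G (Suc i)" "c \<in> G i" "a i b c \<noteq> 0" for i b c
    using a_less[OF that] .
  show "deg 0 b \<in> J" if b: "b \<in> G 0" "w b \<noteq> 0" for b
  proof -
    have "single (expo_diff (deg 0 b) (\<lambda>v. 0)) (w b) \<in> (monomial_ideal V M :: 'k mpoly set)"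
      using augm_surj unit_carrier[OF b(1)] augm_unit(1)[OF b(1)] by (metis imageI)
    then have "single (expo_diff (deg 0 b) (\<lambda>v. 0)) 1 \<in> (monomial_ideal V M :: 'k mpoly set)"
      using b(2) by (simp add: monomial_ideal_def poly_ring_carrier)
    then show ?thesis using augm_unit(2)[OF b] degD[OF b(1)] by (simp add: J_def)
  qed
  show "scalar_cycle G a w i (a i b)" if b: "b \<in> G (Suc i)" for i b
  proof -
    define x where "x c = (if c \<in> G i then a i b c else 0)" for c
    have "supp x \<subseteq> gens_le G deg i (deg (Suc i) b)"
      using bdry_unit(2)[OF b] by (auto simp: supp_def x_def gens_le_def)
    moreover have "homog i (deg (Suc i) b) x = bdry C i (unit_vec b)"
      unfolding homog_unit[OF b] by (auto simp: homog_def x_def)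
    ultimately have "scalar_cycle G a w i x"
      using homog_cycle_iff[OF degD[OF b]] unit_carrier[OF b] by (metis imageI)
    then show ?thesis by (simp add: scalar_cycle_def x_def split: nat.splits)
  qed
  show "\<exists>x. supp x \<subseteq> gens_le G deg 0 \<gamma> \<and> (\<Sum>b\<in>G 0. x b * w b) = 1" if \<gamma>: "\<gamma> \<in> J" for \<gamma>
  proof -
    have "single (expo_diff \<gamma> (\<lambda>v. 0)) 1 \<in> augm C ` chains 0"
      using \<gamma> unfolding augm_surj by (simp add: J_def)
    then obtain Y where Y: "Y \<in> chains 0"
        "single (expo_diff \<gamma> (\<lambda>v. 0)) 1 = augm C Y"
      by (rule imageE)
    then have "(\<Sum>b\<in>G 0. part 0 \<gamma> Y b * w b) = 1"
      using part_augm[OF _ Y(1)] \<gamma> by (simp add: J_def Y(2)[symmetric])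
    then show ?thesis using supp_part by blast
  qed
  show "\<exists>z. supp z \<subseteq> gens_le G deg (Suc i) \<gamma> \<and> (\<forall>c\<in>G i. (\<Sum>b\<in>G (Suc i). z b * a i b c) = x c)"
    if x: "\<gamma> \<in> multidegrees V" "supp x \<subseteq> gens_le G deg i \<gamma>" "scalar_cycle G a w i x" for i \<gamma> x
  proof -
    \<comment> \<open>The preimage Y need not be homogeneous; its component in degree \<gamma> is
      already a preimage.\<close>
    obtain Y where Y: "Y \<in> chains (Suc i)" "homog i \<gamma> x = bdry C i Y"
      using homog_cycle_iff[OF x(1,2)] x(3) by blast
    have "(\<Sum>b\<in>G (Suc i). part (Suc i) \<gamma> Y b * a i b c) = x c" if "c \<in> G i" for c
      using part_bdry[OF x(1) Y(1) that] part_homog[OF x(2) that] Y(2) by simp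
    then show ?thesis using supp_part by blast
  qed
qed

end

theorem minimal_resolution_betti_unique:
  fixes C :: "('b, 'k::field mpoly) graded_complex" and C' :: "('c, 'k mpoly) graded_complex"
  assumes "finite V" "minimal_graded_free_resolution V C (monomial_ideal V M)"
    "minimal_graded_free_resolution V C' (monomial_ideal V M)"
  shows "card {b \<in> gens C i. gdeg C i b = \<alpha>} = card {b \<in> gens C' i. gdeg C' i b = \<alpha>}"
proof -
  interpret X: minimal_monomial_resolution V C M by unfold_locales (use assms in auto)
  interpret Y: minimal_monomial_resolution V C' M by unfold_locales (use assms in auto)
  show ?thesis
    by (rule scalar_resolution_card_eq[OF X.scalar_resolution Y.scalar_resolution])
qed

section \<open>Labels, dimensions and facets of cells\<close>

lemma cell_parts:
  assumes "d_graph d H" "\<sigma> \<in> cells d H" "A \<in> set \<sigma>"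
  shows "finite A" "A \<noteq> {}" "A \<subseteq> verts H"
proof -
  have "A \<noteq> {}" "A \<subseteq> verts H" using assms(2,3) unfolding cells_alt by auto
  moreover have "finite (verts H)" using assms(1) by (simp add: d_graph_def)
  ultimately show "finite A" "A \<noteq> {}" "A \<subseteq> verts H" using finite_subset by auto
qed

lemma lookup_cell_label:
  assumes "\<forall>A\<in>set \<sigma>. finite A" "sorted_wrt (\<lambda>A B. \<forall>s\<in>A. \<forall>t\<in>B. s < t) \<sigma>"
  shows "lookup (cell_label \<sigma>) v = (if v \<in> \<Union>(set \<sigma>) then 1 else 0)"
  using assms
proof (induction \<sigma>)
  case (Cons A \<sigma>)
  have "v \<in> A \<Longrightarrow> v \<notin> \<Union>(set \<sigma>)" using Cons.prems(2) by fastforce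
  moreover have "lookup (cell_label (A # \<sigma>)) v =
      (if v \<in> A then 1 else 0) + lookup (cell_label \<sigma>) v"
    using Cons.prems(1) by (simp add: cell_label_def lookup_add lookup_squarefree_expo)
  ultimately show ?case using Cons by auto
qed (simp add: cell_label_def)

text \<open>The order of the factors makes them disjoint, and each factor has one vertex more than
  its dimension. Hence the label of a cell determines its dimension, which confines each multidegree
  to a single homological degree.\<close>

lemma card_Union_cell:
  assumes "\<forall>A\<in>set \<sigma>. finite A \<and> A \<noteq> {}" "sorted_wrt (\<lambda>A B. \<forall>s\<in>A. \<forall>t\<in>B. s < t) \<sigma>"
  shows "card (\<Union>(set \<sigma>)) = cell_dim \<sigma> + length \<sigma>"
  using assms
proof (induction \<sigma>)
  case (Cons A \<sigma>)
  have "A \<inter> \<Union>(set \<sigma>) = {}" using Cons.prems(2) by fastforce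
  then have "card (A \<union> \<Union>(set \<sigma>)) = card A + card (\<Union>(set \<sigma>))"
    using Cons.prems(1) by (intro card_Un_disjoint) auto
  moreover have "card A > 0" using Cons.prems(1) by (auto simp: card_gt_0_iff)
  ultimately show ?case using Cons by (simp add: cell_dim_Cons)
qed (simp add: cell_dim_def)

lemma aug_eq_sum:
  assumes "finite U"
  shows "aug U n x = (\<Sum>vs | set vs \<subseteq> U \<and> length vs = n. x (map (\<lambda>v. {v}) vs))"
proof (induction n arbitrary: x)
  case 0
  have "{vs::int list. set vs \<subseteq> U \<and> length vs = 0} = {[]}" by auto
  then show ?case by simp
next
  case (Suc n)
  let ?L = "{vs. set vs \<subseteq> U \<and> length vs = n}"
  have L: "{vs. set vs \<subseteq> U \<and> length vs = Suc n} = (\<lambda>(vs, v). v # vs) ` (?L \<times> U)"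
    by (auto simp: length_Suc_conv image_iff subset_iff)
  have inj: "inj_on (\<lambda>(vs, v). v # vs) (?L \<times> U)" by (auto simp: inj_on_def)
  show ?case unfolding L
    by (subst sum.reindex[OF inj]) (simp add: Suc.IH collapse_def sum.cartesian_product split_def)
qed

lemma cell_dim_list_update:
  "i < length \<sigma> \<Longrightarrow> finite (\<sigma> ! i) \<Longrightarrow> v \<in> \<sigma> ! i \<Longrightarrow> \<sigma> ! i - {v} \<noteq> {} \<Longrightarrow>
    Suc (cell_dim (\<sigma>[i := \<sigma> ! i - {v}])) = cell_dim \<sigma>"
proof (induction \<sigma> arbitrary: i)
  case (Cons A \<sigma>)
  show ?case
  proof (cases i)
    case 0
    have "finite (A - {v})" "A - {v} \<noteq> {}" using Cons.prems 0 by simp_all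
    then have "card (A - {v}) > 0" unfolding card_gt_0_iff by blast
    moreover have "card A = Suc (card (A - {v}))" using Cons.prems 0 card.remove[of A v] by simp
    ultimately have "Suc (card (A - {v}) - 1 + cell_dim \<sigma>) = card A - 1 + cell_dim \<sigma>" by linarith
    then show ?thesis by (simp only: 0 list_update.simps nth_Cons_0 cell_dim_Cons nat.case)
  next
    case (Suc j)
    then show ?thesis using Cons.IH[of j] Cons.prems by (simp add: cell_dim_Cons)
  qed
qed auto

lemma nonzero_product_sign:
  assumes "product_sign \<sigma> \<tau> \<noteq> 0"
  obtains i v where "i < length \<sigma>" "v \<in> \<sigma> ! i" "\<tau> = \<sigma>[i := \<sigma> ! i - {v}]"
proof -
  obtain i where i: "i < length \<sigma>" "(\<Sum>v\<in>\<sigma> ! i. if \<tau> = \<sigma>[i := \<sigma> ! i - {v}]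
        then (-1) ^ (cell_dim (take i \<sigma>) + card {u \<in> \<sigma> ! i. u < v}) else (0::int)) \<noteq> 0"
    using assms unfolding product_sign_def
    by (rule sum.not_neutral_contains_not_neutral) simp
  from i(2) obtain v where "v \<in> \<sigma> ! i" "(if \<tau> = \<sigma>[i := \<sigma> ! i - {v}]
        then (-1) ^ (cell_dim (take i \<sigma>) + card {u \<in> \<sigma> ! i. u < v}) else (0::int)) \<noteq> 0"
    by (rule sum.not_neutral_contains_not_neutral)
  then have "v \<in> \<sigma> ! i" "\<tau> = \<sigma>[i := \<sigma> ! i - {v}]" by (auto split: if_splits)
  then show ?thesis using that i(1) by blast
qed

text \<open>Needed because \<open>betti\<close> ranges over complexes whose generators are natural
  numbers, whereas the cellular resolution is generated by cells. Chains are moved back and forth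
  along \<phi> by \<open>pull\<close> and \<open>push\<close>.\<close>

lemma monomial_resolution_relabel:
  fixes \<phi> :: "'b \<Rightarrow> 'c" and s :: "'b \<Rightarrow> 'b \<Rightarrow> 'k::field"
  assumes "monomial_resolution V B lab s" and inj: "inj_on \<phi> (\<Union>i. B i)"
  shows "\<exists>B' lab' (s' :: 'c \<Rightarrow> 'c \<Rightarrow> 'k). monomial_resolution V B' lab' s' \<and> lab' ` B' 0 = lab ` B 0"
proof -
  interpret monomial_resolution V B lab s by fact
  let ?K = "\<Union>i. B i"
  define \<theta> where "\<theta> = inv_into ?K \<phi>"
  define lab' where "lab' n = lab (\<theta> n)" for n
  \<comment> \<open>The exactness conditions quantify over all n, and \<theta> takes arbitrary
    values off the image of \<phi>, so entries there are set to 0.\<close>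
  define s' where "s' m n = (if n \<in> \<phi> ` ?K then s (\<theta> m) (\<theta> n) else 0)" for m n
  have \<theta>: "\<theta> (\<phi> b) = b" if "b \<in> B i" for b i
    unfolding \<theta>_def by (rule inv_into_f_f[OF inj]) (use that in blast)
  have injB: "inj_on \<phi> (B i)" for i using inj by (rule inj_on_subset) blast
  have sum_image: "(\<Sum>n\<in>\<phi> ` B i. f n) = (\<Sum>b\<in>B i. f (\<phi> b))" for i and f :: "'c \<Rightarrow> 'k"
    by (simp add: sum.reindex[OF injB])
  have s': "s' (\<phi> b) (\<phi> c) = s b c" if "b \<in> B i" "c \<in> B j" for b c i j
  proof -
    have "\<phi> c \<in> \<phi> ` ?K" using that(2) by blast
    then show ?thesis using \<theta>[OF that(1)] \<theta>[OF that(2)] by (simp add: s'_def)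
  qed
  have s'_out: "s' m n = 0" if "n \<notin> \<phi> ` ?K" for m n using that by (simp add: s'_def)
  have mem: "\<phi> b \<in> \<phi> ` B i \<longleftrightarrow> b \<in> B i" if "b \<in> ?K" for b i
    using inj that by (auto simp: inj_on_def)
  define pull where "pull x b = (if b \<in> ?K then x (\<phi> b) else 0)" for x :: "'c \<Rightarrow> 'k" and b
  define push where "push z n = (if n \<in> \<phi> ` ?K then z (\<theta> n) else 0)" for z :: "'b \<Rightarrow> 'k" and n
  have supp_pull: "supp (pull x) \<subseteq> {b \<in> B i. expo_le (lab b) m}"
    if "supp x \<subseteq> {n \<in> \<phi> ` B i. expo_le (lab' n) m}" for x i m
  proof
    fix b assume "b \<in> supp (pull x)"
    then have b: "b \<in> ?K" "x (\<phi> b) \<noteq> 0" by (auto simp: supp_def pull_def split: if_splits)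
    then have "\<phi> b \<in> \<phi> ` B i" "expo_le (lab' (\<phi> b)) m" using that by (auto simp: supp_def)
    then show "b \<in> {b \<in> B i. expo_le (lab b) m}" using mem[OF b(1)] \<theta> by (auto simp: lab'_def)
  qed
  have supp_push: "supp (push z) \<subseteq> {n \<in> \<phi> ` B i. expo_le (lab' n) m}"
    if "supp z \<subseteq> {b \<in> B i. expo_le (lab b) m}" for z i m
  proof
    fix n assume "n \<in> supp (push z)"
    then obtain b j where b: "b \<in> B j" "n = \<phi> b" "z (\<theta> n) \<noteq> 0"
      by (auto simp: supp_def push_def split: if_splits)
    then have "z b \<noteq> 0" using \<theta> by simp
    then have "b \<in> B i" "expo_le (lab b) m" using that by (auto simp: supp_def)
    then show "n \<in> {n \<in> \<phi> ` B i. expo_le (lab' n) m}" using b \<theta> by (auto simp: lab'_def)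
  qed
  have pull_eq: "pull x b = x (\<phi> b)" if "b \<in> B i" for x b i using that by (auto simp: pull_def)
  have push_eq: "push z (\<phi> b) = z b" if "b \<in> B i" for z b i
  proof -
    have "\<phi> b \<in> \<phi> ` ?K" using that by blast
    then show ?thesis using \<theta>[OF that] by (simp add: push_def)
  qed
  have push_bdry: "(\<Sum>n\<in>\<phi> ` B (Suc i). push z n * s' n c) = x c"
    if x: "supp x \<subseteq> {n \<in> \<phi> ` B i. expo_le (lab' n) m}"
      and z: "\<forall>c. (\<Sum>b\<in>B (Suc i). z b * s b c) = pull x c" for x z c i m
  proof (cases "c \<in> \<phi> ` ?K")
    case True
    then obtain e j where e: "e \<in> B j" "c = \<phi> e" by auto
    have "(\<Sum>n\<in>\<phi> ` B (Suc i). push z n * s' n c) = (\<Sum>b\<in>B (Suc i). z b * s b e)"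
      unfolding sum_image by (rule sum.cong) (auto simp: e push_eq s'[OF _ e(1)])
    then show ?thesis using z e pull_eq by simp
  next
    case False
    have "x c = 0"
    proof (rule ccontr)
      assume "x c \<noteq> 0"
      then have "c \<in> \<phi> ` B i" using x by (auto simp: supp_def)
      then show False using False by blast
    qed
    then show ?thesis using s'_out[OF False] by simp
  qed
  have "monomial_resolution V (\<lambda>i. \<phi> ` B i) lab' s'"
  proof
    show "finite (\<phi> ` B i)" for i using finite_gens by simp
    show "keys (lab' n) \<subseteq> V" if n: "n \<in> \<phi> ` B i" for i n
    proof -
      obtain b where "b \<in> B i" "n = \<phi> b" using n by auto
      then show ?thesis using keys_lab[of b i] \<theta> by (simp add: lab'_def)
    qed
    show "n \<in> \<phi> ` B i \<and> expo_le (lab' n) (lab' m) \<and> lab' n \<noteq> lab' m"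
      if mn: "m \<in> \<phi> ` B (Suc i)" "s' m n \<noteq> 0" for i m n
    proof -
      obtain b where b: "b \<in> B (Suc i)" "m = \<phi> b" using mn by auto
      obtain c j where c: "c \<in> B j" "n = \<phi> c" using mn(2) s'_out by blast
      have "s b c \<noteq> 0" using mn(2) s'[OF b(1) c(1)] b c by simp
      from s_nonzero[OF b(1) this] show ?thesis using b c \<theta> by (auto simp: lab'_def)
    qed
    show "(\<Sum>c\<in>\<phi> ` B (Suc i). s' b c * s' c e) = 0" if b: "b \<in> \<phi> ` B (Suc (Suc i))" for i b e
    proof (cases "e \<in> \<phi> ` ?K")
      case True
      then obtain e' j where e: "e' \<in> B j" "e = \<phi> e'" by auto
      obtain b' where b': "b' \<in> B (Suc (Suc i))" "b = \<phi> b'" using b by auto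
      have "(\<Sum>c\<in>\<phi> ` B (Suc i). s' b c * s' c e) = (\<Sum>c\<in>B (Suc i). s b' c * s c e')"
        unfolding sum_image by (rule sum.cong) (auto simp: e b' s'[OF b'(1)] s'[OF _ e(1)])
      then show ?thesis using ss[OF b'(1)] by simp
    qed (simp add: s'_out)
    show "(\<Sum>c\<in>\<phi> ` B 0. s' b c) = 0" if b: "b \<in> \<phi> ` B 1" for b
    proof -
      obtain b' where b': "b' \<in> B 1" "b = \<phi> b'" using b by auto
      have "(\<Sum>c\<in>\<phi> ` B 0. s' b c) = (\<Sum>c\<in>B 0. s b' c)"
        unfolding sum_image by (rule sum.cong) (auto simp: b' s'[OF b'(1)])
      then show ?thesis using s1[OF b'(1)] by simp
    qed
    show "\<exists>z. supp z \<subseteq> {b \<in> \<phi> ` B 1. expo_le (lab' b) m} \<and> (\<forall>c. (\<Sum>b\<in>\<phi> ` B 1. z b * s' b c) = x c)"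
      if x: "supp x \<subseteq> {b \<in> \<phi> ` B 0. expo_le (lab' b) m}" "(\<Sum>b\<in>\<phi> ` B 0. x b) = 0" for m x
    proof -
      have "(\<Sum>b\<in>B 0. pull x b) = 0" using x(2) pull_eq by (simp add: sum_image)
      then obtain z where z: "supp z \<subseteq> {b \<in> B (Suc 0). expo_le (lab b) m}"
          "\<forall>c. (\<Sum>b\<in>B (Suc 0). z b * s b c) = pull x c"
        using exact0[OF supp_pull[OF x(1)]] by auto
      show ?thesis using supp_push[OF z(1)] push_bdry[OF x(1) z(2)] by auto
    qed
    show "\<exists>z. supp z \<subseteq> {b \<in> \<phi> ` B (Suc (Suc i)). expo_le (lab' b) m} \<and>
        (\<forall>c. (\<Sum>b\<in>\<phi> ` B (Suc (Suc i)). z b * s' b c) = x c)"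
      if x: "supp x \<subseteq> {b \<in> \<phi> ` B (Suc i). expo_le (lab' b) m}"
        "\<And>c. (\<Sum>b\<in>\<phi> ` B (Suc i). x b * s' b c) = 0" for i m x
    proof -
      have "(\<Sum>b\<in>B (Suc i). pull x b * s b c) = 0" for c
      proof (cases "c \<in> ?K")
        case True
        then obtain j where c: "c \<in> B j" by auto
        have "(\<Sum>b\<in>B (Suc i). pull x b * s b c) = (\<Sum>b\<in>\<phi> ` B (Suc i). x b * s' b (\<phi> c))"
          unfolding sum_image by (rule sum.cong) (auto simp: pull_eq s'[OF _ c])
        then show ?thesis using x(2) by simp
      next
        case False
        then have "s b c = 0" if "b \<in> B (Suc i)" for b using s_nonzero[OF that] by blast
        then show ?thesis by simp
      qed
      then obtain z where z: "supp z \<subseteq> {b \<in> B (Suc (Suc i)). expo_le (lab b) m}"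
          "\<forall>c. (\<Sum>b\<in>B (Suc (Suc i)). z b * s b c) = pull x c"
        using exact[OF supp_pull[OF x(1)]] by blast
      show ?thesis using supp_push[OF z(1)] push_bdry[OF x(1) z(2)] by blast
    qed
  qed
  moreover have "lab' ` \<phi> ` B 0 = lab ` B 0" using \<theta> by (force simp: lab'_def image_iff)
  ultimately show ?thesis by (intro exI[of _ "\<lambda>i. \<phi> ` B i"] exI[of _ lab'] exI[of _ s']) simp
qed

context monomial_resolution
begin

text \<open>The definite description in \<open>betti\<close> has a value because a relabelled copy
  is a minimal resolution on natural numbers, and it is unique because every such resolution has as
  many generators of each degree as this one.\<close>

lemma betti_eq_card:
  assumes "finite V" "finite (\<Union>i. B i)" "j \<ge> 0"
  shows "betti V (monomial_ideal V (lab ` B 0) :: 'k mpoly set) j \<alpha> =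
    card {b \<in> B (nat j). (\<lambda>v. int (lookup (lab b) v)) = \<alpha>}"
proof -
  let ?I = "monomial_ideal V (lab ` B 0) :: 'k mpoly set"
  obtain \<phi> :: "'b \<Rightarrow> nat" where \<phi>: "inj_on \<phi> (\<Union>i. B i)"
    using finite_imp_inj_to_nat_seg[OF assms(2)] by blast
  obtain B' lab' and s' :: "nat \<Rightarrow> nat \<Rightarrow> 'k"
    where r: "monomial_resolution V B' lab' s'" "lab' ` B' 0 = lab ` B 0"
    using monomial_resolution_relabel[OF monomial_resolution_axioms \<phi>] by auto
  let ?C' = "monomial_complex B' lab' s'"
  have C': "minimal_graded_free_resolution V ?C' ?I"
    using monomial_resolution.minimal_resolution[OF r(1)] r(2) by simp
  have card: "card {b \<in> gens D (nat j). gdeg D (nat j) b = \<alpha>} =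
      card {b \<in> B (nat j). (\<lambda>v. int (lookup (lab b) v)) = \<alpha>}"
    if "minimal_graded_free_resolution V D ?I" for D :: "(nat, 'k mpoly) graded_complex"
    using minimal_resolution_betti_unique[OF assms(1) that minimal_resolution, of "nat j" \<alpha>]
    by (simp add: monomial_complex_def)
  have "(THE n. \<exists>D :: (nat, 'k mpoly) graded_complex. minimal_graded_free_resolution V D ?I \<and>
      n = card {b \<in> gens D (nat j). gdeg D (nat j) b = \<alpha>}) =
      card {b \<in> B (nat j). (\<lambda>v. int (lookup (lab b) v)) = \<alpha>}"
  proof (rule the_equality)
    show "\<exists>D :: (nat, 'k mpoly) graded_complex. minimal_graded_free_resolution V D ?I \<and>
        card {b \<in> B (nat j). (\<lambda>v. int (lookup (lab b) v)) = \<alpha>} =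
        card {b \<in> gens D (nat j). gdeg D (nat j) b = \<alpha>}"
      by (intro exI[of _ ?C'] conjI C' card[OF C', symmetric])
  qed (use card in blast)
  then show ?thesis unfolding betti_def using assms(3) by simp
qed

end

section \<open>The cellular resolution\<close>

text \<open>Restricted to facets because \<open>product_sign\<close> can be nonzero at lists that
  are not cells, namely when a factor loses its last vertex. Between cells it agrees with the
  oriented product sign, by \<open>facet_of_product_sign\<close>.\<close>

definition cell_sign :: "nat \<Rightarrow> hgraph \<Rightarrow> (cell \<Rightarrow> int) \<Rightarrow> cell \<Rightarrow> cell \<Rightarrow> 'k::field" where
  "cell_sign d H \<epsilon> \<sigma> \<tau> =
     (if \<tau> \<in> facets (X_complex d H \<epsilon>) \<sigma> then of_int (\<epsilon> \<sigma> * product_sign \<sigma> \<tau> * \<epsilon> \<tau>) else 0)"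

locale oriented_cointerval =
  fixes d :: nat and H :: hgraph and \<epsilon> :: "cell \<Rightarrow> int"
  assumes d_graph: "d_graph d H" and cointerval: "cointerval d H" and orientation: "orientation d H \<epsilon>"
begin

abbreviation B :: "nat \<Rightarrow> cell set" where
  "B i \<equiv> {\<sigma> \<in> cells d H. cell_dim \<sigma> = i}"

lemma finite_verts: "finite (verts H)"
  using d_graph by (simp add: d_graph_def)

lemma edges_Pow: "edges H \<subseteq> Pow (verts H)"
  by (rule d_graph_edges[OF d_graph])

lemma cells_product: "cells d H = product_cells d (edges H)"
  by (rule cells_eq_product_cells[OF d_graph])

lemma finite_cells: "finite (cells d H)"
  unfolding cells_product by (rule finite_product_cells[OF finite_verts edges_Pow])

lemma cellD:
  assumes "\<sigma> \<in> cells d H"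
  shows "length \<sigma> = d" "\<And>A. A \<in> set \<sigma> \<Longrightarrow> finite A \<and> A \<noteq> {} \<and> A \<subseteq> verts H"
    "sorted_wrt (\<lambda>A B. \<forall>s\<in>A. \<forall>t\<in>B. s < t) \<sigma>" "\<And>vs. list_all2 (\<in>) vs \<sigma> \<Longrightarrow> set vs \<in> edges H"
proof -
  show "finite A \<and> A \<noteq> {} \<and> A \<subseteq> verts H" if "A \<in> set \<sigma>" for A
    using cell_parts[OF d_graph assms that] by blast
qed (use assms in \<open>auto simp: cells_alt\<close>)

lemma lookup_label:
  "\<sigma> \<in> cells d H \<Longrightarrow> lookup (cell_label \<sigma>) v = (if v \<in> \<Union>(set \<sigma>) then 1 else 0)"
  using lookup_cell_label cellD by blast

lemma mem_Union_iff:
  "\<sigma> \<in> cells d H \<Longrightarrow> v \<in> \<Union>(set \<sigma>) \<longleftrightarrow> lookup (cell_label \<sigma>) v = 1"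
  by (simp add: lookup_label)

lemma card_Union: "\<sigma> \<in> cells d H \<Longrightarrow> card (\<Union>(set \<sigma>)) = cell_dim \<sigma> + d"
  using card_Union_cell[of \<sigma>] cellD[of \<sigma>] by simp

lemma label_le_iff:
  assumes "\<sigma> \<in> cells d H"
  shows "expo_le (cell_label \<sigma>) m \<longleftrightarrow> (\<forall>A\<in>set \<sigma>. A \<subseteq> {v. lookup m v \<ge> 1})"
  by (auto simp: expo_le_def lookup_label[OF assms])

lemma in_facets:
  "\<tau> \<in> facets (X_complex d H \<epsilon>) \<sigma> \<longleftrightarrow>
    \<tau> \<in> cells d H \<and> list_all2 (\<subseteq>) \<tau> \<sigma> \<and> Suc (cell_dim \<tau>) = cell_dim \<sigma>"
  by (simp add: facets_def X_complex_def)

lemma facet_of_product_sign: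
  assumes "\<sigma> \<in> cells d H" "\<tau> \<in> cells d H" "product_sign \<sigma> \<tau> \<noteq> 0"
  shows "\<tau> \<in> facets (X_complex d H \<epsilon>) \<sigma>"
proof -
  obtain i v where iv: "i < length \<sigma>" "v \<in> \<sigma> ! i" "\<tau> = \<sigma>[i := \<sigma> ! i - {v}]"
    using nonzero_product_sign[OF assms(3)] .
  have "\<tau> ! i \<in> set \<tau>" using iv by (simp add: set_update_memI)
  then have "\<sigma> ! i - {v} \<noteq> {}" using cellD(2)[OF assms(2)] iv by auto
  moreover have "finite (\<sigma> ! i)" using cellD(2)[OF assms(1)] iv by simp
  ultimately have "Suc (cell_dim \<tau>) = cell_dim \<sigma>" using cell_dim_list_update iv by blast
  moreover have "list_all2 (\<subseteq>) \<tau> \<sigma>" unfolding iv(3) list_all2_conv_all_nth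
    using iv(1) by (auto simp: nth_list_update)
  ultimately show ?thesis using assms by (simp add: in_facets)
qed

lemma sign_square: "\<sigma> \<in> cells d H \<Longrightarrow> of_int (\<epsilon> \<sigma>) * (of_int (\<epsilon> \<sigma>) * x) = (x :: 'k::field)"
  using orientation by (auto simp: orientation_def)

lemma sign_vertex: "\<sigma> \<in> cells d H \<Longrightarrow> cell_dim \<sigma> = 0 \<Longrightarrow> \<epsilon> \<sigma> = 1"
  using orientation by (auto simp: orientation_def)

lemma supp_bd_cells:
  "supp x \<subseteq> B (Suc i) \<Longrightarrow> bd (verts H) \<tau> x \<noteq> 0 \<Longrightarrow> \<tau> \<in> B i"
  using supp_bd[OF edges_Pow, of x d "Suc i" \<tau>] unfolding cells_product by auto

text \<open>Changing the orientation conjugates the boundary matrix by the diagonal matrix of the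
  signs \<epsilon>. Since these square to 1, all questions of exactness reduce to the product
  orientation used in \<open>bd\<close>.\<close>

lemma sum_cell_sign:
  fixes x :: "cell \<Rightarrow> 'k::field"
  assumes x: "supp x \<subseteq> B (Suc i)"
  shows "(\<Sum>\<sigma>\<in>B (Suc i). x \<sigma> * cell_sign d H \<epsilon> \<sigma> \<tau>) =
    of_int (\<epsilon> \<tau>) * bd (verts H) \<tau> (\<lambda>\<sigma>. of_int (\<epsilon> \<sigma>) * x \<sigma>)"
proof (cases "\<tau> \<in> B i")
  case True
  then have \<tau>: "\<tau> \<in> cells d H" by simp
  let ?L = "{\<sigma>. set \<sigma> \<subseteq> Pow (verts H) \<and> length \<sigma> = length \<tau>}"
  have finL: "finite ?L" by (rule finite_lists_length_eq) (simp add: finite_verts)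
  have sub: "B (Suc i) \<subseteq> ?L"
  proof
    fix \<sigma> assume "\<sigma> \<in> B (Suc i)"
    then have "\<sigma> \<in> cells d H" by simp
    from cellD[OF this] cellD(1)[OF \<tau>] show "\<sigma> \<in> ?L" by auto
  qed
  have "(\<Sum>\<sigma>\<in>B (Suc i). x \<sigma> * cell_sign d H \<epsilon> \<sigma> \<tau>) =
      (\<Sum>\<sigma>\<in>?L. of_int (\<epsilon> \<tau>) * ((of_int (\<epsilon> \<sigma>) * x \<sigma>) * of_int (product_sign \<sigma> \<tau>)))"
  proof (rule sum.mono_neutral_cong_left[OF finL sub])
    show "\<forall>\<sigma>\<in>?L - B (Suc i). of_int (\<epsilon> \<tau>) * ((of_int (\<epsilon> \<sigma>) * x \<sigma>) * of_int (product_sign \<sigma> \<tau>)) = 0"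
    proof
      fix \<sigma> assume "\<sigma> \<in> ?L - B (Suc i)"
      then have "x \<sigma> = 0" using x unfolding supp_def by blast
      then show "of_int (\<epsilon> \<tau>) * ((of_int (\<epsilon> \<sigma>) * x \<sigma>) * of_int (product_sign \<sigma> \<tau>)) = 0" by simp
    qed
    fix \<sigma> assume "\<sigma> \<in> B (Suc i)"
    then have \<sigma>: "\<sigma> \<in> cells d H" by simp
    show "x \<sigma> * cell_sign d H \<epsilon> \<sigma> \<tau> =
        of_int (\<epsilon> \<tau>) * ((of_int (\<epsilon> \<sigma>) * x \<sigma>) * of_int (product_sign \<sigma> \<tau>))"
    proof (cases "product_sign \<sigma> \<tau> = 0")
      case False
      then show ?thesis using facet_of_product_sign[OF \<sigma> \<tau>] by (simp add: cell_sign_def)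
    qed (simp add: cell_sign_def)
  qed
  also have "\<dots> = of_int (\<epsilon> \<tau>) * bd (verts H) \<tau> (\<lambda>\<sigma>. of_int (\<epsilon> \<sigma>) * x \<sigma>)"
    unfolding sum_distrib_left[symmetric]
    by (subst bd_eq_sum_product_sign[OF finite_verts]) (use cellD[OF \<tau>] in auto)
  finally show ?thesis .
next
  case False
  have "supp (\<lambda>\<sigma>. of_int (\<epsilon> \<sigma>) * x \<sigma>) \<subseteq> B (Suc i)" using x by (auto simp: supp_def)
  then have "bd (verts H) \<tau> (\<lambda>\<sigma>. of_int (\<epsilon> \<sigma>) * x \<sigma>) = 0" using supp_bd_cells False by blast
  moreover have "cell_sign d H \<epsilon> \<sigma> \<tau> = (0 :: 'k)" if "\<sigma> \<in> B (Suc i)" for \<sigma>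
    using False that by (auto simp: cell_sign_def in_facets)
  ultimately show ?thesis by simp
qed

lemma sum_cell_sign_single:
  assumes \<sigma>: "\<sigma> \<in> B (Suc i)"
  defines "y \<equiv> (\<lambda>\<rho>. if \<rho> = \<sigma> then of_int (\<epsilon> \<sigma>) else (0 :: 'k::field))"
  shows "supp y \<subseteq> B (Suc i)" "cell_sign d H \<epsilon> \<sigma> \<tau> = of_int (\<epsilon> \<tau>) * bd (verts H) \<tau> y"
proof -
  show "supp y \<subseteq> B (Suc i)" using \<sigma> by (auto simp: supp_def y_def)
  have "supp (\<lambda>\<rho>. if \<rho> = \<sigma> then 1 else (0::'k)) \<subseteq> B (Suc i)" using \<sigma> by (auto simp: supp_def)
  note sum_cell_sign[OF this, of \<tau>]
  moreover have "(\<Sum>\<rho>\<in>B (Suc i). (if \<rho> = \<sigma> then 1 else 0) * cell_sign d H \<epsilon> \<rho> \<tau>) = (cell_sign d H \<epsilon> \<sigma> \<tau> :: 'k)"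
    using \<sigma> finite_cells by (simp add: if_distrib[of "\<lambda>t. t * _"] sum.delta cong: if_cong)
  moreover have "(\<lambda>\<rho>. of_int (\<epsilon> \<rho>) * (if \<rho> = \<sigma> then 1 else 0)) = y" by (auto simp: y_def)
  ultimately show "cell_sign d H \<epsilon> \<sigma> \<tau> = of_int (\<epsilon> \<tau>) * bd (verts H) \<tau> y" by simp
qed

lemma aug_eq_sum_vertices:
  fixes x :: "cell \<Rightarrow> 'k::field"
  assumes "supp x \<subseteq> B 0" shows "aug (verts H) d x = (\<Sum>\<sigma>\<in>B 0. x \<sigma>)"
proof -
  let ?L = "{vs. set vs \<subseteq> verts H \<and> length vs = d}"
  have inj: "inj_on (map (\<lambda>v::int. {v})) ?L" by (auto simp: inj_on_def dest: map_injective)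
  have "B 0 \<subseteq> map (\<lambda>v. {v}) ` ?L"
  proof
    fix \<sigma> assume \<sigma>: "\<sigma> \<in> B 0"
    then have c: "\<sigma> \<in> cells d H" "cell_dim \<sigma> = 0" by auto
    have "A = {the_elem A} \<and> the_elem A \<in> verts H" if A: "A \<in> set \<sigma>" for A
    proof -
      have "card A - 1 = 0" using c(2) A by (simp add: cell_dim_def)
      moreover have "card A > 0" "A \<subseteq> verts H" using cellD(2)[OF c(1) A] by (auto simp: card_gt_0_iff)
      ultimately have "card A = 1" by linarith
      then obtain v where "A = {v}" by (auto simp: card_1_singleton_iff)
      then show ?thesis using \<open>A \<subseteq> verts H\<close> by simp
    qed
    then have "\<sigma> = map (\<lambda>v. {v}) (map the_elem \<sigma>)" "set (map the_elem \<sigma>) \<subseteq> verts H"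
      by (auto simp: list_eq_iff_nth_eq)
    moreover have "length (map the_elem \<sigma>) = d" using cellD(1)[OF c(1)] by simp
    ultimately show "\<sigma> \<in> map (\<lambda>v. {v}) ` ?L" by blast
  qed
  moreover have "finite ?L" by (rule finite_lists_length_eq[OF finite_verts])
  moreover have "x \<sigma> = 0" if "\<sigma> \<notin> B 0" for \<sigma> using that assms unfolding supp_def by blast
  ultimately have "(\<Sum>\<sigma>\<in>B 0. x \<sigma>) = (\<Sum>\<sigma>\<in>map (\<lambda>v. {v}) ` ?L. x \<sigma>)"
    by (intro sum.mono_neutral_left) auto
  also have "\<dots> = (\<Sum>vs\<in>?L. x (map (\<lambda>v. {v}) vs))" by (simp add: sum.reindex[OF inj])
  finally show ?thesis by (simp add: aug_eq_sum[OF finite_verts])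
qed

text \<open>The cells with label dividing m are those of the subgraph induced on the support W of m.
  Acyclicity gives a filling z of x twisted by \<epsilon>, and z twisted by \<epsilon> fills x
  itself.\<close>

lemma strand_exact:
  fixes x :: "cell \<Rightarrow> 'k::field"
  assumes x: "supp x \<subseteq> {\<sigma> \<in> B i. expo_le (cell_label \<sigma>) m}"
    and cycle: "\<And>\<tau>. bd (verts H) \<tau> (\<lambda>\<sigma>. of_int (\<epsilon> \<sigma>) * x \<sigma>) = 0"
    and aug: "i = 0 \<Longrightarrow> (\<Sum>\<sigma>\<in>B 0. x \<sigma>) = 0"
  shows "\<exists>z. supp z \<subseteq> {\<sigma> \<in> B (Suc i). expo_le (cell_label \<sigma>) m} \<and>
    (\<forall>\<tau>. (\<Sum>\<sigma>\<in>B (Suc i). z \<sigma> * cell_sign d H \<epsilon> \<sigma> \<tau>) = x \<tau>)"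
proof -
  define W where "W = {v. lookup m v \<ge> 1}"
  let ?E = "{e \<in> edges H. e \<subseteq> W}"
  have strand: "product_cells d ?E \<inter> {\<sigma>. cell_dim \<sigma> = j} = {\<sigma> \<in> B j. expo_le (cell_label \<sigma>) m}" for j
    unfolding product_cells_restrict cells_product[symmetric] W_def using label_le_iff by blast
  let ?x = "\<lambda>\<sigma>. of_int (\<epsilon> \<sigma>) * x \<sigma>"
  have "\<exists>z. supp z \<subseteq> product_cells d ?E \<inter> {\<sigma>. cell_dim \<sigma> = Suc i} \<and> (\<forall>\<tau>. bd (verts H) \<tau> z = ?x \<tau>)"
  proof (rule product_cells_acyclic[OF finite_verts])
    show "?E \<subseteq> Pow (verts H)" using edges_Pow by auto
    show "nested_layers d ?E"
      by (rule nested_layers_restrict[OF nested_layers_of_cointerval[OF d_graph cointerval]])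
    show "supp ?x \<subseteq> product_cells d ?E \<inter> {\<sigma>. cell_dim \<sigma> = i}"
      unfolding strand using x by (auto simp: supp_def)
    show "bd (verts H) \<tau> ?x = 0" for \<tau> by (rule cycle)
    show "aug (verts H) d ?x = 0" if "i = 0"
    proof -
      have "supp ?x \<subseteq> B 0" using x that by (auto simp: supp_def)
      then have "aug (verts H) d ?x = (\<Sum>\<sigma>\<in>B 0. ?x \<sigma>)" by (rule aug_eq_sum_vertices)
      also have "\<dots> = (\<Sum>\<sigma>\<in>B 0. x \<sigma>)" by (rule sum.cong) (auto simp: sign_vertex)
      finally show ?thesis using aug that by simp
    qed
  qed
  then obtain z where z: "supp z \<subseteq> {\<sigma> \<in> B (Suc i). expo_le (cell_label \<sigma>) m}"
      "\<And>\<tau>. bd (verts H) \<tau> z = ?x \<tau>"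
    unfolding strand by blast
  define y where "y \<sigma> = of_int (\<epsilon> \<sigma>) * z \<sigma>" for \<sigma>
  have y: "supp y \<subseteq> {\<sigma> \<in> B (Suc i). expo_le (cell_label \<sigma>) m}" using z(1) by (auto simp: supp_def y_def)
  have ey: "(\<lambda>\<sigma>. of_int (\<epsilon> \<sigma>) * y \<sigma>) = z"
  proof
    fix \<sigma>
    show "of_int (\<epsilon> \<sigma>) * y \<sigma> = z \<sigma>"
    proof (cases "z \<sigma> = 0")
      case False
      then have "\<sigma> \<in> cells d H" using z(1) by (auto simp: supp_def)
      then show ?thesis by (simp add: y_def sign_square)
    qed (simp add: y_def)
  qed
  have "(\<Sum>\<sigma>\<in>B (Suc i). y \<sigma> * cell_sign d H \<epsilon> \<sigma> \<tau>) = x \<tau>" for \<tau>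
  proof -
    have "supp y \<subseteq> B (Suc i)" using y by blast
    from sum_cell_sign[OF this, of \<tau>]
    have "(\<Sum>\<sigma>\<in>B (Suc i). y \<sigma> * cell_sign d H \<epsilon> \<sigma> \<tau>) = of_int (\<epsilon> \<tau>) * (of_int (\<epsilon> \<tau>) * x \<tau>)"
      by (simp only: ey z(2))
    also have "\<dots> = x \<tau>"
    proof (cases "x \<tau> = 0")
      case False
      then have "\<tau> \<in> cells d H" using x by (auto simp: supp_def)
      then show ?thesis by (rule sign_square)
    qed simp
    finally show ?thesis .
  qed
  then show ?thesis using y by blast
qed

lemma monomial_resolution_cells:
  "monomial_resolution (verts H) B cell_label (cell_sign d H \<epsilon> :: cell \<Rightarrow> cell \<Rightarrow> 'k::field)"
proof
  show "finite (B i)" for i using finite_cells by simp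
  show "keys (cell_label \<sigma>) \<subseteq> verts H" if \<sigma>: "\<sigma> \<in> B i" for i \<sigma>
  proof
    fix v assume "v \<in> keys (cell_label \<sigma>)"
    then have "v \<in> \<Union>(set \<sigma>)" using \<sigma> by (simp add: in_keys_iff lookup_label split: if_splits)
    then show "v \<in> verts H" using cellD(2) \<sigma> by blast
  qed
  show "\<tau> \<in> B i \<and> expo_le (cell_label \<tau>) (cell_label \<sigma>) \<and> cell_label \<tau> \<noteq> cell_label \<sigma>"
    if st: "\<sigma> \<in> B (Suc i)" "cell_sign d H \<epsilon> \<sigma> \<tau> \<noteq> (0 :: 'k)" for i \<sigma> \<tau>
  proof -
    have f: "\<tau> \<in> cells d H" "list_all2 (\<subseteq>) \<tau> \<sigma>" "Suc (cell_dim \<tau>) = cell_dim \<sigma>"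
      using st(2) by (auto simp: cell_sign_def in_facets split: if_splits)
    have \<sigma>: "\<sigma> \<in> cells d H" using st by simp
    have sub: "\<Union>(set \<tau>) \<subseteq> \<Union>(set \<sigma>)"
    proof
      fix v assume "v \<in> \<Union>(set \<tau>)"
      then obtain i where "i < length \<tau>" "v \<in> \<tau> ! i" by (auto simp: in_set_conv_nth)
      then have "\<sigma> ! i \<in> set \<sigma>" "v \<in> \<sigma> ! i" using f(2) by (auto simp: list_all2_conv_all_nth)
      then show "v \<in> \<Union>(set \<sigma>)" by blast
    qed
    then have "expo_le (cell_label \<tau>) (cell_label \<sigma>)"
      by (auto simp: expo_le_def lookup_label[OF f(1)] lookup_label[OF \<sigma>])
    moreover have "cell_label \<tau> \<noteq> cell_label \<sigma>"
    proof
      assume eq: "cell_label \<tau> = cell_label \<sigma>"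
      have "\<Union>(set \<tau>) = \<Union>(set \<sigma>)"
        by (rule Set.set_eqI) (simp only: mem_Union_iff[OF f(1)] mem_Union_iff[OF \<sigma>] eq)
      then show False using card_Union[OF f(1)] card_Union[OF \<sigma>] f(3) by simp
    qed
    ultimately show ?thesis using f st by simp
  qed
  show "(\<Sum>\<tau>\<in>B (Suc i). cell_sign d H \<epsilon> \<sigma> \<tau> * cell_sign d H \<epsilon> \<tau> \<rho>) = (0 :: 'k)"
    if \<sigma>: "\<sigma> \<in> B (Suc (Suc i))" for i \<sigma> \<rho>
  proof -
    \<comment> \<open>A chain concentrated on \<sigma>: it turns row \<sigma> of the sign matrix
      into a boundary, so that \<open>bd_bd\<close> applies.\<close>
    define y where "y = (\<lambda>\<rho>. if \<rho> = \<sigma> then of_int (\<epsilon> \<sigma>) else (0 :: 'k))"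
    have y: "supp y \<subseteq> B (Suc (Suc i))" "\<And>\<tau>. cell_sign d H \<epsilon> \<sigma> \<tau> = of_int (\<epsilon> \<tau>) * bd (verts H) \<tau> y"
      unfolding y_def by (rule sum_cell_sign_single[OF \<sigma>])+
    have supp: "supp (\<lambda>\<tau>. of_int (\<epsilon> \<tau>) * bd (verts H) \<tau> y) \<subseteq> B (Suc i)"
      using supp_bd_cells[OF y(1)] by (auto simp: supp_def)
    have "(\<lambda>\<tau>. of_int (\<epsilon> \<tau>) * (of_int (\<epsilon> \<tau>) * bd (verts H) \<tau> y)) = (\<lambda>\<tau>. bd (verts H) \<tau> y)"
    proof
      fix \<tau>
      show "of_int (\<epsilon> \<tau>) * (of_int (\<epsilon> \<tau>) * bd (verts H) \<tau> y) = bd (verts H) \<tau> y"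
      proof (cases "bd (verts H) \<tau> y = 0")
        case False
        then have "\<tau> \<in> cells d H" using supp_bd_cells[OF y(1)] by blast
        then show ?thesis by (rule sign_square)
      qed simp
    qed
    then show ?thesis using sum_cell_sign[OF supp, of \<rho>] bd_bd[OF finite_verts, of \<rho> y] by (simp add: y(2))
  qed
  show "(\<Sum>\<tau>\<in>B 0. cell_sign d H \<epsilon> \<sigma> \<tau>) = (0 :: 'k)" if "\<sigma> \<in> B 1" for \<sigma>
  proof -
    have \<sigma>: "\<sigma> \<in> B (Suc 0)" using that by simp
    define y where "y = (\<lambda>\<rho>. if \<rho> = \<sigma> then of_int (\<epsilon> \<sigma>) else (0 :: 'k))"
    have y: "supp y \<subseteq> B (Suc 0)" "\<And>\<tau>. cell_sign d H \<epsilon> \<sigma> \<tau> = of_int (\<epsilon> \<tau>) * bd (verts H) \<tau> y"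
      unfolding y_def by (rule sum_cell_sign_single[OF \<sigma>])+
    have "(\<Sum>\<tau>\<in>B 0. cell_sign d H \<epsilon> \<sigma> \<tau>) = (\<Sum>\<tau>\<in>B 0. bd (verts H) \<tau> y)"
      by (rule sum.cong) (auto simp: y(2) sign_vertex)
    also have "\<dots> = aug (verts H) d (\<lambda>\<tau>. bd (verts H) \<tau> y)"
      by (rule aug_eq_sum_vertices[symmetric]) (use supp_bd_cells[OF y(1)] in \<open>auto simp: supp_def\<close>)
    also have "\<dots> = 0" by (rule aug_bd[OF finite_verts])
    finally show ?thesis .
  qed
  show "\<exists>z. supp z \<subseteq> {\<sigma> \<in> B 1. expo_le (cell_label \<sigma>) m} \<and>
      (\<forall>\<tau>. (\<Sum>\<sigma>\<in>B 1. z \<sigma> * cell_sign d H \<epsilon> \<sigma> \<tau>) = x \<tau>)"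
    if x: "supp x \<subseteq> {\<sigma> \<in> B 0. expo_le (cell_label \<sigma>) m}" "(\<Sum>\<sigma>\<in>B 0. x \<sigma>) = 0"
    for m and x :: "cell \<Rightarrow> 'k"
  proof -
    \<comment> \<open>A chain of vertices has no boundary: by \<open>supp_bd\<close> its dimension
      would have to be a successor.\<close>
    have "bd (verts H) \<tau> (\<lambda>\<sigma>. of_int (\<epsilon> \<sigma>) * x \<sigma>) = 0" for \<tau>
    proof (rule ccontr)
      assume nz: "bd (verts H) \<tau> (\<lambda>\<sigma>. of_int (\<epsilon> \<sigma>) * x \<sigma>) \<noteq> 0"
      have "supp (\<lambda>\<sigma>. of_int (\<epsilon> \<sigma>) * x \<sigma>) \<subseteq> product_cells d (edges H) \<inter> {\<sigma>. cell_dim \<sigma> = 0}"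
        using x(1) unfolding cells_product by (auto simp: supp_def)
      from supp_bd[OF edges_Pow this nz] show False by simp
    qed
    from strand_exact[OF x(1) this] x(2) show ?thesis by simp
  qed
  show "\<exists>z. supp z \<subseteq> {\<sigma> \<in> B (Suc (Suc i)). expo_le (cell_label \<sigma>) m} \<and>
      (\<forall>\<tau>. (\<Sum>\<sigma>\<in>B (Suc (Suc i)). z \<sigma> * cell_sign d H \<epsilon> \<sigma> \<tau>) = x \<tau>)"
    if x: "supp x \<subseteq> {\<sigma> \<in> B (Suc i). expo_le (cell_label \<sigma>) m}"
      "\<And>\<tau>. (\<Sum>\<sigma>\<in>B (Suc i). x \<sigma> * cell_sign d H \<epsilon> \<sigma> \<tau>) = 0" for i m and x :: "cell \<Rightarrow> 'k"
  proof -
    have xB: "supp x \<subseteq> B (Suc i)" using x(1) by blast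
    then have exB: "supp (\<lambda>\<sigma>. of_int (\<epsilon> \<sigma>) * x \<sigma>) \<subseteq> B (Suc i)" by (auto simp: supp_def)
    have "bd (verts H) \<tau> (\<lambda>\<sigma>. of_int (\<epsilon> \<sigma>) * x \<sigma>) = 0" for \<tau>
    proof (rule ccontr)
      assume nz: "bd (verts H) \<tau> (\<lambda>\<sigma>. of_int (\<epsilon> \<sigma>) * x \<sigma>) \<noteq> 0"
      then have \<tau>: "\<tau> \<in> cells d H" using supp_bd_cells[OF exB] by blast
      have "of_int (\<epsilon> \<tau>) * bd (verts H) \<tau> (\<lambda>\<sigma>. of_int (\<epsilon> \<sigma>) * x \<sigma>) = 0"
        using sum_cell_sign[OF xB, of \<tau>] x(2) by simp
      then have "of_int (\<epsilon> \<tau>) * (of_int (\<epsilon> \<tau>) * bd (verts H) \<tau> (\<lambda>\<sigma>. of_int (\<epsilon> \<sigma>) * x \<sigma>)) = 0" by simp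
      then show False using nz unfolding sign_square[OF \<tau>] by simp
    qed
    from strand_exact[OF x(1) this] show ?thesis by simp
  qed
qed

lemma cellular_complex_eq:
  "cellular_complex (X_complex d H \<epsilon>) =
    monomial_complex B cell_label (cell_sign d H \<epsilon> :: cell \<Rightarrow> cell \<Rightarrow> 'k::field)"
proof -
  have "(\<Sum>F\<in>{F \<in> cells d H. cell_dim F = Suc i \<and> G \<in> facets (X_complex d H \<epsilon>) F}.
        x F * single (cell_label F - cell_label G) (of_int (\<epsilon> F * product_sign F G * \<epsilon> G))) =
      (\<Sum>F\<in>B (Suc i). x F * single (cell_label F - cell_label G) (cell_sign d H \<epsilon> F G))"
    for i and x :: "cell \<Rightarrow> 'k mpoly" and G
    by (rule sum.mono_neutral_cong_left) (use finite_cells in \<open>auto simp: cell_sign_def\<close>)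
  then show ?thesis
    unfolding cellular_complex_def monomial_complex_def
    by (simp add: X_complex_def[of d H \<epsilon>, THEN arg_cong[of _ _ faces]]
        X_complex_def[of d H \<epsilon>, THEN arg_cong[of _ _ cdim]]
        X_complex_def[of d H \<epsilon>, THEN arg_cong[of _ _ csign]]
        X_complex_def[of d H \<epsilon>, THEN arg_cong[of _ _ label]])
qed

lemma vertex_cell:
  assumes vs: "length vs = d" "sorted_wrt (<) vs" "set vs \<in> edges H"
  shows "map (\<lambda>v. {v}) vs \<in> B 0" "cell_label (map (\<lambda>v. {v}) vs) = squarefree_expo (set vs)"
proof -
  have "list_all2 (\<in>) ws (map (\<lambda>v. {v}) vs) \<Longrightarrow> ws = vs" for ws :: "int list"
    by (auto simp: list_all2_conv_all_nth list_eq_iff_nth_eq)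
  moreover have "set vs \<subseteq> verts H" using vs edges_Pow by auto
  ultimately have c: "map (\<lambda>v. {v}) vs \<in> cells d H"
    unfolding cells_alt using vs by (auto simp: sorted_wrt_map)
  moreover have "cell_dim (map (\<lambda>v. {v}) vs) = 0"
    unfolding cell_dim_def by (induction vs) auto
  ultimately show "map (\<lambda>v. {v}) vs \<in> B 0" by simp
  show "cell_label (map (\<lambda>v. {v}) vs) = squarefree_expo (set vs)"
    by (rule poly_mapping_eqI) (auto simp: lookup_label[OF c] lookup_squarefree_expo)
qed

lemma sorted_transversal:
  assumes "\<sigma> \<in> cells d H" "list_all2 (\<in>) vs \<sigma>"
  shows "length vs = d" "sorted_wrt (<) vs" "set vs \<in> edges H"
proof -
  show "length vs = d" using assms cellD(1) list_all2_lengthD by metis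
  show "set vs \<in> edges H" using cellD(4)[OF assms] .
  show "sorted_wrt (<) vs"
    unfolding sorted_wrt_iff_nth_less
  proof (intro allI impI)
    fix i j assume ij: "i < j" "j < length vs"
    then have len: "j < length \<sigma>" and m: "vs ! i \<in> \<sigma> ! i" "vs ! j \<in> \<sigma> ! j"
      using assms(2) by (auto simp: list_all2_conv_all_nth)
    then show "vs ! i < vs ! j" using cellD(3)[OF assms(1)] ij(1) unfolding sorted_wrt_iff_nth_less by blast
  qed
qed

text \<open>A vertex of the complex has singleton factors in increasing order, so it is an edge
  listed increasingly. This identifies the image of the augmentation with the edge ideal.\<close>

lemma vertex_labels: "cell_label ` B 0 = squarefree_expo ` edges H"
proof
  show "squarefree_expo ` edges H \<subseteq> cell_label ` B 0"
  proof
    fix m assume "m \<in> squarefree_expo ` edges H"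
    then obtain e where e: "e \<in> edges H" "m = squarefree_expo e" by auto
    then have fin: "finite e" and card: "card e = d"
      using d_graph finite_subset unfolding d_graph_def by blast+
    let ?vs = "sorted_list_of_set e"
    have "length ?vs = d" "sorted_wrt (<) ?vs" "set ?vs \<in> edges H"
      using fin card e by auto
    note vc = vertex_cell[OF this]
    have "m = cell_label (map (\<lambda>v. {v}) ?vs)" using vc(2) e(2) fin by simp
    then show "m \<in> cell_label ` B 0" using vc(1) by (rule image_eqI)
  qed
  show "cell_label ` B 0 \<subseteq> squarefree_expo ` edges H"
  proof
    fix m assume "m \<in> cell_label ` B 0"
    then obtain \<sigma> where \<sigma>: "\<sigma> \<in> cells d H" "cell_dim \<sigma> = 0" "m = cell_label \<sigma>" by auto
    have "\<forall>A\<in>set \<sigma>. A \<noteq> {}" using cellD(2)[OF \<sigma>(1)] by blast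
    then obtain vs where vs: "list_all2 (\<in>) vs \<sigma>" using transversal_exists by blast
    note st = sorted_transversal[OF \<sigma>(1) vs]
    have "A = {v}" if "A \<in> set \<sigma>" "v \<in> A" for A v
    proof -
      have "card A - 1 = 0" using \<sigma>(2) that by (simp add: cell_dim_def)
      moreover have "finite A" using cellD(2)[OF \<sigma>(1)] that by blast
      ultimately have "card A \<le> card {v}" by simp
      then show ?thesis using card_seteq[of A "{v}"] \<open>finite A\<close> that by auto
    qed
    then have "\<sigma> = map (\<lambda>v. {v}) vs" using vs
      by (auto simp: list_all2_conv_all_nth list_eq_iff_nth_eq)
    then show "m \<in> squarefree_expo ` edges H" using vertex_cell(2)[OF st] st(3) \<sigma>(3) by simp
  qed
qed

text \<open>All exponents are 0 or 1, and no vertex of a cell uses a variable that the cell lacks.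
  The maximum is attained at a transversal through u if u occurs in \<sigma>, and at any transversal
  otherwise.\<close>

lemma lcm_labeled: "lcm_labeled (X_complex d H \<epsilon>)"
  unfolding lcm_labeled_def
proof (intro ballI allI)
  fix \<sigma> u assume "\<sigma> \<in> faces (X_complex d H \<epsilon>)"
  then have \<sigma>: "\<sigma> \<in> cells d H" by (simp add: X_complex_def)
  let ?S = "{lookup (label (X_complex d H \<epsilon>) v) u | v. v \<in> faces (X_complex d H \<epsilon>) \<and>
      cdim (X_complex d H \<epsilon>) v = 0 \<and> face_le (X_complex d H \<epsilon>) v \<sigma>}"
  have S: "?S = {lookup (cell_label \<tau>) u | \<tau>. \<tau> \<in> B 0 \<and> list_all2 (\<subseteq>) \<tau> \<sigma>}"
    by (auto simp: X_complex_def)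
  have trans: "map (\<lambda>v. {v}) vs \<in> B 0 \<and> list_all2 (\<subseteq>) (map (\<lambda>v. {v}) vs) \<sigma>"
    if "list_all2 (\<in>) vs \<sigma>" for vs
    using vertex_cell(1)[OF sorted_transversal[OF \<sigma> that]] that
    by (auto simp: list_all2_conv_all_nth)
  have ne: "\<forall>A\<in>set \<sigma>. A \<noteq> {}" using cellD(2)[OF \<sigma>] by blast
  have le: "lookup (cell_label \<tau>) u \<le> lookup (cell_label \<sigma>) u"
    if \<tau>: "\<tau> \<in> B 0" "list_all2 (\<subseteq>) \<tau> \<sigma>" for \<tau>
  proof -
    have "u \<in> \<Union>(set \<sigma>)" if u: "u \<in> \<Union>(set \<tau>)"
    proof -
      obtain i where "i < length \<tau>" "u \<in> \<tau> ! i" using u by (auto simp: in_set_conv_nth)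
      then have "\<sigma> ! i \<in> set \<sigma>" "u \<in> \<sigma> ! i" using \<tau>(2) by (auto simp: list_all2_conv_all_nth)
      then show ?thesis by blast
    qed
    then show ?thesis using \<tau>(1) \<sigma> by (simp add: lookup_label)
  qed
  have mem: "lookup (cell_label \<sigma>) u \<in> ?S"
  proof (cases "u \<in> \<Union>(set \<sigma>)")
    case True
    then obtain A where A: "A \<in> set \<sigma>" "u \<in> A" by blast
    obtain vs where vs: "list_all2 (\<in>) vs \<sigma>" "u \<in> set vs" using transversal_through[OF ne A] by blast
    note t = trans[OF vs(1)]
    have "u \<in> \<Union>(set (map (\<lambda>v. {v}) vs))" using vs(2) by auto
    then have "lookup (cell_label (map (\<lambda>v. {v}) vs)) u = lookup (cell_label \<sigma>) u"
      using lookup_label[OF \<sigma>, of u] lookup_label[of "map (\<lambda>v. {v}) vs" u] True t by simp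
    then show ?thesis unfolding S using t by (intro CollectI exI[of _ "map (\<lambda>v. {v}) vs"]) simp
  next
    case False
    obtain vs where vs: "list_all2 (\<in>) vs \<sigma>" using transversal_exists[OF ne] by blast
    note t = trans[OF vs]
    have "lookup (cell_label (map (\<lambda>v. {v}) vs)) u = lookup (cell_label \<sigma>) u"
      using le[of "map (\<lambda>v. {v}) vs"] t lookup_label[OF \<sigma>, of u] False by simp
    then show ?thesis unfolding S using t by (intro CollectI exI[of _ "map (\<lambda>v. {v}) vs"]) simp
  qed
  have fin: "finite ?S"
  proof -
    have "?S \<subseteq> (\<lambda>\<tau>. lookup (cell_label \<tau>) u) ` cells d H" unfolding S by auto
    then show ?thesis using finite_cells finite_subset by blast
  qed
  have "Max ?S = lookup (cell_label \<sigma>) u"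
    by (rule Max_eqI[OF fin _ mem]) (use le in \<open>auto simp: S\<close>)
  then show "lookup (label (X_complex d H \<epsilon>) \<sigma>) u = Max ?S" by (simp add: X_complex_def[of d H \<epsilon>])
qed

lemma edge_ideal_labels:
  "edge_ideal H = (monomial_ideal (verts H) (cell_label ` B 0) :: 'k::field mpoly set)"
  using edge_ideal_eq[OF finite_verts edges_Pow] by (simp add: vertex_labels)

theorem supports_resolution:
  "supports_minimal_cellular_resolution (verts H) (X_complex d H \<epsilon>) (edge_ideal H :: 'k::field mpoly set)"
  unfolding supports_minimal_cellular_resolution_def cellular_complex_eq edge_ideal_labels
  using lcm_labeled monomial_resolution.minimal_resolution[OF monomial_resolution_cells] by blast

lemma label_indicator_iff:
  assumes "\<sigma> \<in> cells d H" "finite \<alpha>"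
  shows "(\<lambda>v. int (lookup (cell_label \<sigma>) v)) = indicator \<alpha> \<longleftrightarrow> \<Union>(set \<sigma>) = \<alpha>"
    and "cell_label \<sigma> = squarefree_expo \<alpha> \<longleftrightarrow> \<Union>(set \<sigma>) = \<alpha>"
proof -
  have "int (lookup (cell_label \<sigma>) v) = indicator \<alpha> v \<longleftrightarrow> (v \<in> \<Union>(set \<sigma>) \<longleftrightarrow> v \<in> \<alpha>)" for v
    unfolding lookup_label[OF assms(1)] by (simp add: indicator_def)
  then show "(\<lambda>v. int (lookup (cell_label \<sigma>) v)) = indicator \<alpha> \<longleftrightarrow> \<Union>(set \<sigma>) = \<alpha>"
    unfolding fun_eq_iff by (simp only:) blast
  have "lookup (cell_label \<sigma>) v = lookup (squarefree_expo \<alpha>) v \<longleftrightarrow>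
      (v \<in> \<Union>(set \<sigma>) \<longleftrightarrow> v \<in> \<alpha>)" for v
    unfolding lookup_label[OF assms(1)] lookup_squarefree_expo[OF assms(2)] by simp
  then show "cell_label \<sigma> = squarefree_expo \<alpha> \<longleftrightarrow> \<Union>(set \<sigma>) = \<alpha>"
    unfolding poly_mapping_eq_iff fun_eq_iff by (simp only:) blast
qed

lemma betti_edge_ideal:
  assumes "\<alpha> \<subseteq> verts H" "i \<ge> 0"
  shows "betti (verts H) (edge_ideal H :: 'k::field mpoly set) i (indicator \<alpha>) =
    card {\<sigma> \<in> cells d H. int (cell_dim \<sigma>) = i \<and> \<Union>(set \<sigma>) = \<alpha>}"
proof -
  have fin: "finite \<alpha>" using assms finite_verts finite_subset by blast
  have "finite (\<Union>i. B i)" by (rule finite_subset[OF _ finite_cells]) auto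
  then have "betti (verts H) (edge_ideal H :: 'k mpoly set) i (indicator \<alpha>) =
      card {\<sigma> \<in> B (nat i). (\<lambda>v. int (lookup (cell_label \<sigma>) v)) = indicator \<alpha>}"
    unfolding edge_ideal_labels
    by (rule monomial_resolution.betti_eq_card[OF monomial_resolution_cells finite_verts _ assms(2)])
  also have "{\<sigma> \<in> B (nat i). (\<lambda>v. int (lookup (cell_label \<sigma>) v)) = indicator \<alpha>} =
      {\<sigma> \<in> cells d H. int (cell_dim \<sigma>) = i \<and> \<Union>(set \<sigma>) = \<alpha>}"
    using label_indicator_iff(1)[OF _ fin] assms(2) by auto
  finally show ?thesis .
qed

text \<open>A cell of dimension \<open>card \<alpha> - d\<close> has as many vertices as \<alpha>,
  so if it lies inside \<alpha> it uses all of them.\<close>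

lemma top_cells_induced:
  assumes "\<alpha> \<subseteq> verts H"
  shows "{\<sigma> \<in> cells d (induced H \<alpha>). int (cell_dim \<sigma>) = int (card \<alpha>) - int d} =
    {\<sigma> \<in> cells d H. int (cell_dim \<sigma>) = int (card \<alpha>) - int d \<and> \<Union>(set \<sigma>) = \<alpha>}"
proof -
  have fin: "finite \<alpha>" using assms finite_verts finite_subset by blast
  have "d_graph d (induced H \<alpha>)" using d_graph fin by (auto simp: d_graph_def induced_def)
  then have c: "cells d (induced H \<alpha>) = {\<sigma> \<in> cells d H. \<Union>(set \<sigma>) \<subseteq> \<alpha>}"
    by (auto simp: cells_eq_product_cells cells_product induced_def product_cells_restrict)
  have "\<Union>(set \<sigma>) = \<alpha>" if "\<sigma> \<in> cells d H" "\<Union>(set \<sigma>) \<subseteq> \<alpha>" "int (cell_dim \<sigma>) = int (card \<alpha>) - int d" for \<sigma>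
    using card_subset_eq[OF fin that(2)] card_Union[OF that(1)] that(3) by linarith
  then show ?thesis unfolding c by auto
qed

end

theorem theorem4p4:
  fixes d :: nat and H :: hgraph and \<epsilon> :: "cell \<Rightarrow> int"
  assumes "d \<ge> 1"
    and "d_graph d H"
    and "cointerval d H"
    and "orientation d H \<epsilon>"
  shows
    "supports_minimal_cellular_resolution (verts H) (X_complex d H \<epsilon>)
       (edge_ideal H :: 'k::field mpoly set) \<and>
     (\<forall>\<alpha>. \<alpha> \<subseteq> verts H \<longrightarrow>
        (\<forall>i::int. i \<ge> 0 \<longrightarrow> i \<noteq> int (card \<alpha>) - int d \<longrightarrow>
           betti (verts H) (edge_ideal H :: 'k mpoly set) i (indicator \<alpha>) = 0) \<and>
        betti (verts H) (edge_ideal H :: 'k mpoly set) (int (card \<alpha>) - int d) (indicator \<alpha>) =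
          card {\<sigma> \<in> cells d (induced H \<alpha>). int (cell_dim \<sigma>) = int (card \<alpha>) - int d} \<and>
        (\<forall>i::int. i \<ge> 0 \<longrightarrow>
           betti (verts H) (edge_ideal H :: 'k mpoly set) i (indicator \<alpha>) =
             card {\<sigma> \<in> cells d H. int (cell_dim \<sigma>) = i \<and> cell_label \<sigma> = squarefree_expo \<alpha>}))"
proof -
  interpret oriented_cointerval d H \<epsilon> by unfold_locales (use assms in auto)
  have zero: "betti (verts H) (edge_ideal H :: 'k mpoly set) i (indicator \<alpha>) = 0"
    if \<alpha>: "\<alpha> \<subseteq> verts H" "i \<ge> 0" "i \<noteq> int (card \<alpha>) - int d" for \<alpha> i
  proof -
    have "{\<sigma> \<in> cells d H. int (cell_dim \<sigma>) = i \<and> \<Union>(set \<sigma>) = \<alpha>} = {}"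
      using \<alpha>(3) card_Union by fastforce
    then show ?thesis using betti_edge_ideal[OF \<alpha>(1,2), where 'k = 'k] by (simp only: card.empty)
  qed
  have top: "betti (verts H) (edge_ideal H :: 'k mpoly set) (int (card \<alpha>) - int d) (indicator \<alpha>) =
      card {\<sigma> \<in> cells d (induced H \<alpha>). int (cell_dim \<sigma>) = int (card \<alpha>) - int d}"
    if \<alpha>: "\<alpha> \<subseteq> verts H" for \<alpha>
  proof (cases "int (card \<alpha>) - int d \<ge> 0")
    case True
    then show ?thesis unfolding top_cells_induced[OF \<alpha>] by (rule betti_edge_ideal[OF \<alpha>])
  next
    \<comment> \<open>Here \<alpha> has fewer than d elements: no cell has negative dimension, in
      agreement with the value 0 of \<open>betti\<close> in negative degrees.\<close>
    case False
    then have "{\<sigma> \<in> cells d (induced H \<alpha>). int (cell_dim \<sigma>) = int (card \<alpha>) - int d} = {}" by auto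
    then show ?thesis using False by (simp add: betti_def)
  qed
  have all: "betti (verts H) (edge_ideal H :: 'k mpoly set) i (indicator \<alpha>) =
      card {\<sigma> \<in> cells d H. int (cell_dim \<sigma>) = i \<and> cell_label \<sigma> = squarefree_expo \<alpha>}"
    if \<alpha>: "\<alpha> \<subseteq> verts H" "i \<ge> 0" for \<alpha> i
  proof -
    have "finite \<alpha>" using \<alpha>(1) finite_verts finite_subset by blast
    then have "{\<sigma> \<in> cells d H. int (cell_dim \<sigma>) = i \<and> \<Union>(set \<sigma>) = \<alpha>} =
        {\<sigma> \<in> cells d H. int (cell_dim \<sigma>) = i \<and> cell_label \<sigma> = squarefree_expo \<alpha>}"
      using label_indicator_iff(2) by blast
    then show ?thesis using betti_edge_ideal[OF \<alpha>, where 'k = 'k] by (simp only:)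
  qed
  show ?thesis using supports_resolution zero top all by blast
qed

end
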